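(* Suppose that $(\gamma_1,\gamma_2)\in\boldsymbol{\Delta}$ with $\gamma_1\ge\gamma_2$. If $(\gamma_1,\gamma_2)\to(-1/2,-1/2)$ in such a way that $$\frac{\gamma_1+1/2}{\gamma_2+1/2}\to\rho\in[0,1],$$ then $$Z_{\gamma_1,\gamma_2}(t)\Rightarrow Y_\rho(t)=t\cdot\left[\frac{(\rho+1)^{-1}+(2\sqrt{\rho})^{-1}}{\sqrt{2(\rho+1)^{-2}+(2\rho)^{-1}}}\,X_1+\frac{(\rho+1)^{-1}-(2\sqrt{\rho})^{-1}}{\sqrt{2(\rho+1)^{-2}+(2\rho)^{-1}}}\,X_2\right],$$ where $X_1$ and $X_2$ are two independent standardized chi-squared random variables with one degree of freedom (standardized to have mean $0$ and variance $1$). The case $\rho=0$ is understood as the limit of the coefficients as $\rho\to0$.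
   Context: Let $\boldsymbol{\Delta}=\{(\gamma_1,\gamma_2): -1<\gamma_1<-1/2,\ -1<\gamma_2<-1/2,\ \gamma_1+\gamma_2>-3/2\}$. Write $u_+^{\gamma}=u^\gamma$ if $u>0$ and $0$ otherwise. For $(\gamma_1,\gamma_2)\in\boldsymbol{\Delta}$, the standardized generalized Rosenblatt process is $$Z_{\gamma_1,\gamma_2}(t)=\frac{A}{2}\int_{\mathbb{R}^2}'\left[\int_0^t\big[(s-x_1)_+^{\gamma_1}(s-x_2)_+^{\gamma_2}+(s-x_1)_+^{\gamma_2}(s-x_2)_+^{\gamma_1}\big]ds\right]B(dx_1)B(dx_2),$$ where $B(\cdot)$ is a Brownian random measure on $\mathbb{R}$ (Gaussian white noise with Lebesgue control measure) and $\int'$ denotes the double Wiener-Itô integral (diagonals $x_1=x_2$ excluded). The constant $A=A(\gamma_1,\gamma_2)>0$ is chosen so that $\mathrm{Var}[Z_{\gamma_1,\gamma_2}(1)]=1$; explicitly, with $\mathrm{B}(x,y)=\int_0^1u^{x-1}(1-u)^{y-1}du$ the beta function, $$A(\gamma_1,\gamma_2)=\big[(\gamma_1+\gamma_2+2)(2(\gamma_1+\gamma_2)+3)\big]^{1/2}\big[\mathrm{B}(\gamma_1+1,-\gamma_1-\gamma_2-1)\mathrm{B}(\gamma_2+1,-\gamma_1-\gamma_2-1)+\mathrm{B}(\gamma_1+1,-2\gamma_1-1)\mathrm{B}(\gamma_2+1,-2\gamma_2-1)\big]^{-1/2}.$$ The process is taken in its continuous version, and $\Rightarrow$ denotes weak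 convergence in the space $C[0,1]$ with the uniform metric. A standardized chi-squared random variable with one degree of freedom is $(N^2-1)/\sqrt{2}$ with $N$ standard normal. *)

theory Defs
  imports "HOL-Probability.Probability"
begin

section \<open>Brownian random measure and the double Wiener--Ito integral\<close>

definition centered_normal :: "'a measure \<Rightarrow> ('a \<Rightarrow> real) \<Rightarrow> real \<Rightarrow> bool" where
  "centered_normal M X v \<longleftrightarrow> X \<in> borel_measurable M \<and>
     (if v = 0 then AE \<omega> in M. X \<omega> = 0
      else distributed M lborel X (\<lambda>x. ennreal (normal_density 0 (sqrt v) x)))"

text \<open>Gaussian white noise on the real line with Lebesgue control measure. Only the values
  \<open>B A\<close> for Borel sets \<open>A\<close> of finite Lebesgue measure matter. Finite disjoint families are the case
  where all but finitely many \<open>A n\<close> are empty.\<close>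

definition brownian_random_measure :: "'a measure \<Rightarrow> (real set \<Rightarrow> 'a \<Rightarrow> real) \<Rightarrow> bool" where
  "brownian_random_measure M B \<longleftrightarrow>
     prob_space M \<and>
     (\<forall>A\<in>sets borel. emeasure lborel A < \<infinity> \<longrightarrow> centered_normal M (B A) (measure lborel A)) \<and>
     (\<forall>A :: nat \<Rightarrow> real set. range A \<subseteq> sets borel \<longrightarrow> (\<forall>n. emeasure lborel (A n) < \<infinity>) \<longrightarrow>
        disjoint_family A \<longrightarrow> prob_space.indep_vars M (\<lambda>_. borel) (\<lambda>n. B (A n)) UNIV) \<and>
     (\<forall>A :: nat \<Rightarrow> real set. range A \<subseteq> sets borel \<longrightarrow> emeasure lborel (\<Union>n. A n) < \<infinity> \<longrightarrow>
        disjoint_family A \<longrightarrow> (AE \<omega> in M. (\<lambda>n. B (A n) \<omega>) sums B (\<Union>n. A n) \<omega>))"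

text \<open>Simple functions on the plane that vanish on the diagonal: combinations of indicators of the
  rectangles \<open>A i \<times> A j\<close> with \<open>i \<noteq> j\<close>, where the \<open>A i\<close> are disjoint.\<close>

definition off_diagonal_step :: "nat \<Rightarrow> (nat \<Rightarrow> real set) \<Rightarrow> (nat \<Rightarrow> nat \<Rightarrow> real) \<Rightarrow> bool" where
  "off_diagonal_step m A a \<longleftrightarrow>
     (\<forall>i<m. A i \<in> sets borel \<and> emeasure lborel (A i) < \<infinity>) \<and>
     disjoint_family_on A {..<m} \<and> (\<forall>i<m. a i i = 0)"

definition step_function ::
  "nat \<Rightarrow> (nat \<Rightarrow> real set) \<Rightarrow> (nat \<Rightarrow> nat \<Rightarrow> real) \<Rightarrow> real \<times> real \<Rightarrow> real" where
  "step_function m A a =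
     (\<lambda>(x, y). \<Sum>i<m. \<Sum>j<m. a i j * indicator (A i) x * indicator (A j) y)"

definition step_integral ::
  "(real set \<Rightarrow> 'a \<Rightarrow> real) \<Rightarrow> nat \<Rightarrow> (nat \<Rightarrow> real set) \<Rightarrow> (nat \<Rightarrow> nat \<Rightarrow> real) \<Rightarrow> 'a \<Rightarrow> real" where
  "step_integral B m A a = (\<lambda>\<omega>. \<Sum>i<m. \<Sum>j<m. a i j * B (A i) \<omega> * B (A j) \<omega>)"

text \<open>\<open>X\<close> is (a version of) the double integral of \<open>f\<close>: the \<open>L\<^sup>2\<close>-extension of the integral of
  off-diagonal simple functions. It determines \<open>X\<close> up to almost sure equality, since the integral
  of simple functions is continuous in \<open>L\<^sup>2\<close>.\<close>

definition is_double_wiener_ito_integral ::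
  "'a measure \<Rightarrow> (real set \<Rightarrow> 'a \<Rightarrow> real) \<Rightarrow> (real \<times> real \<Rightarrow> real) \<Rightarrow> ('a \<Rightarrow> real) \<Rightarrow> bool" where
  "is_double_wiener_ito_integral M B f X \<longleftrightarrow>
     f \<in> borel_measurable (lborel \<Otimes>\<^sub>M lborel) \<and>
     integrable (lborel \<Otimes>\<^sub>M lborel) (\<lambda>p. (f p)\<^sup>2) \<and>
     X \<in> borel_measurable M \<and> integrable M (\<lambda>\<omega>. (X \<omega>)\<^sup>2) \<and>
     (\<exists>m A a. (\<forall>n. off_diagonal_step (m n) (A n) (a n)) \<and>
        (\<lambda>n. \<integral>\<^sup>+ p. ennreal ((f p - step_function (m n) (A n) (a n) p)\<^sup>2)
              \<partial>(lborel \<Otimes>\<^sub>M lborel)) \<longlonglongrightarrow> 0 \<and>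
        (\<lambda>n. \<integral>\<^sup>+ \<omega>. ennreal ((X \<omega> - step_integral B (m n) (A n) (a n) \<omega>)\<^sup>2) \<partial>M)
              \<longlonglongrightarrow> 0)"


section \<open>The generalized Rosenblatt process\<close>

definition rosenblatt_domain :: "(real \<times> real) set" where
  "rosenblatt_domain =
     {(g1, g2). -1 < g1 \<and> g1 < -1/2 \<and> -1 < g2 \<and> g2 < -1/2 \<and> g1 + g2 > -3/2}"

definition pos_powr :: "real \<Rightarrow> real \<Rightarrow> real" where
  "pos_powr u g = (if u > 0 then u powr g else 0)"

definition rosenblatt_const :: "real \<Rightarrow> real \<Rightarrow> real" where
  "rosenblatt_const g1 g2 =
     sqrt ((g1 + g2 + 2) * (2 * (g1 + g2) + 3)) /
     sqrt (Beta (g1 + 1) (- g1 - g2 - 1) * Beta (g2 + 1) (- g1 - g2 - 1)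
           + Beta (g1 + 1) (- 2 * g1 - 1) * Beta (g2 + 1) (- 2 * g2 - 1))"

text \<open>The inner integral converges for \<open>x1 \<noteq> x2\<close>. On the diagonal, a null set, it may diverge, and
  then its formal value is \<open>0\<close>.\<close>

definition rosenblatt_kernel :: "real \<Rightarrow> real \<Rightarrow> real \<Rightarrow> real \<times> real \<Rightarrow> real" where
  "rosenblatt_kernel g1 g2 t = (\<lambda>(x1, x2). rosenblatt_const g1 g2 / 2 *
     (LINT s:{0..t}|lborel. pos_powr (s - x1) g1 * pos_powr (s - x2) g2
                          + pos_powr (s - x1) g2 * pos_powr (s - x2) g1))"

text \<open>\<open>Z\<close> is a continuous version of the standardized generalized Rosenblatt process driven
  by \<open>B\<close>.\<close>

definition generalized_rosenblatt_process ::
  "'a measure \<Rightarrow> (real set \<Rightarrow> 'a \<Rightarrow> real) \<Rightarrow> real \<Rightarrow> real \<Rightarrow> (real \<Rightarrow> 'a \<Rightarrow> real) \<Rightarrow> bool" where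
  "generalized_rosenblatt_process M B g1 g2 Z \<longleftrightarrow>
     (\<forall>t\<ge>0. is_double_wiener_ito_integral M B (rosenblatt_kernel g1 g2 t) (Z t)) \<and>
     (\<forall>\<omega>\<in>space M. continuous_on {0..} (\<lambda>t. Z t \<omega>))"


section \<open>Weak convergence in \<open>C[0,1]\<close>\<close>

text \<open>Points of this metric space are the continuous functions on \<open>[0,1]\<close>, represented by functions
  on the whole line that are \<open>undefined\<close> outside \<open>[0,1]\<close>; the metric is the uniform one.\<close>

definition C01 :: "(real \<Rightarrow> real) metric" where
  "C01 = cfunspace (top_of_set {0..1}) euclidean_metric"

definition borel_C01 :: "(real \<Rightarrow> real) measure" where
  "borel_C01 = sigma (mspace C01) {U. openin (mtopology_of C01) U}"

definition path01 :: "(real \<Rightarrow> 'a \<Rightarrow> real) \<Rightarrow> 'a \<Rightarrow> real \<Rightarrow> real" where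
  "path01 Z \<omega> = (\<lambda>t\<in>{0..1}. Z t \<omega>)"

definition weak_conv_C01 ::
  "('i \<Rightarrow> (real \<Rightarrow> real) measure) \<Rightarrow> (real \<Rightarrow> real) measure \<Rightarrow> 'i filter \<Rightarrow> bool" where
  "weak_conv_C01 \<mu> \<nu> F \<longleftrightarrow>
     (\<forall>\<phi>. continuous_map (mtopology_of C01) euclideanreal \<phi> \<and> bounded (\<phi> ` mspace C01) \<longrightarrow>
        ((\<lambda>i. \<integral>x. \<phi> x \<partial>\<mu> i) \<longlongrightarrow> (\<integral>x. \<phi> x \<partial>\<nu>)) F)"

text \<open>Convergence in distribution of processes. Measurability is part of the notion, because
  \<open>distr\<close> is only meaningful for measurable maps.\<close>

definition conv_in_distribution_C01 ::
  "'a measure \<Rightarrow> ('i \<Rightarrow> real \<Rightarrow> 'a \<Rightarrow> real) \<Rightarrow> 'b measure \<Rightarrow> (real \<Rightarrow> 'b \<Rightarrow> real) \<Rightarrow> 'i filter \<Rightarrow> bool"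
  where
  "conv_in_distribution_C01 M Z N Y F \<longleftrightarrow>
     (\<forall>i. path01 (Z i) \<in> measurable M borel_C01) \<and>
     path01 Y \<in> measurable N borel_C01 \<and>
     weak_conv_C01 (\<lambda>i. distr M borel_C01 (path01 (Z i))) (distr N borel_C01 (path01 Y)) F"


section \<open>The limit process\<close>

definition std_chi_squared_1 :: "'b measure \<Rightarrow> ('b \<Rightarrow> real) \<Rightarrow> bool" where
  "std_chi_squared_1 N X \<longleftrightarrow> X \<in> borel_measurable N \<and>
     distr N borel X =
     distr (density lborel (\<lambda>x. ennreal (std_normal_density x))) borel (\<lambda>x. (x\<^sup>2 - 1) / sqrt 2)"

definition coeff1_formula :: "real \<Rightarrow> real" where
  "coeff1_formula r = (inverse (r + 1) + inverse (2 * sqrt r)) /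
                      sqrt (2 * (inverse (r + 1))\<^sup>2 + inverse (2 * r))"

definition coeff2_formula :: "real \<Rightarrow> real" where
  "coeff2_formula r = (inverse (r + 1) - inverse (2 * sqrt r)) /
                      sqrt (2 * (inverse (r + 1))\<^sup>2 + inverse (2 * r))"

definition coeff1 :: "real \<Rightarrow> real" where
  "coeff1 r = (if r = 0 then Lim (at_right 0) coeff1_formula else coeff1_formula r)"

definition coeff2 :: "real \<Rightarrow> real" where
  "coeff2 r = (if r = 0 then Lim (at_right 0) coeff2_formula else coeff2_formula r)"

definition limit_process ::
  "real \<Rightarrow> ('b \<Rightarrow> real) \<Rightarrow> ('b \<Rightarrow> real) \<Rightarrow> real \<Rightarrow> 'b \<Rightarrow> real" where
  "limit_process r X1 X2 t \<omega> = t * (coeff1 r * X1 \<omega> + coeff2 r * X2 \<omega>)"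

end

theory Submission
  imports Defs
begin

text \<open>Write \<open>\<gamma>\<^sub>j = -1/2 - a\<^sub>j\<close>. As \<open>a\<^sub>j\<close> tends to zero, the squared \<open>L\<^sup>2\<close> norm \<open>1 / (2 a\<^sub>j)\<close> of the tail
  \<open>(-x)\<close> to the power \<open>\<gamma>\<^sub>j\<close>, \<open>x < -1\<close>, explodes, whereas what the kernel contains besides these tails
  stays bounded. The squared normalizing constant is asymptotic to \<open>4 a\<^sub>1 a\<^sub>2 / (1 + r\<^sup>2)\<close> with
  \<open>r = 2 \<surd>\<rho> / (1 + \<rho>)\<close>, so that in \<open>L\<^sup>2\<close> the kernel at time \<open>t\<close> is \<open>t\<close> times a multiple of the symmetrized
  tensor product of the two tails, up to an error whose increments over \<open>[s, t]\<close> are of order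
  \<open>o(1) (t - s)\<^sup>3\<^sup>/\<^sup>2\<close> in mean square; by chaining, the error is uniformly small in \<open>t\<close>. The double
  integral of the tensor product is the centred product of two Gaussian variables whose correlation
  tends to \<open>r\<close>, and a rotation diagonalizes this quadratic form with eigenvalues proportional to
  \<open>1 + r\<close> and \<open>r - 1\<close>. Since the tails may be replaced by step functions on a fine mesh, these
  Gaussian variables are finite sums of white noise, and single Wiener integrals do not occur.\<close>

section \<open>Step integrals of white noise\<close>

text \<open>The obstacle is the order of the error in \<open>t - s\<close>: chaining needs an
  exponent above 1. The remedy is a majorant of which the fourth power bounds the error and the
  seventh is still integrable; one of the eight factors of the squared error is then free to supply
  an extra root of \<open>t - s\<close>. From this come 2/15 (as \<open>7 * 2/15 < 1\<close>) and
  the restriction of the exponents to at least -8/15, four times -2/15; 3/8 is a quarter of the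
  exponent 3/2 with which differences of powers decay at infinity. The order \<open>t - s\<close> to
  the power 3/2 in turn leaves room for a geometric weight on the dyadic levels. Of the double
  integral three facts enter: its value on off-diagonal step functions, linearity, and an
  \<open>L^2\<close> bound up to a constant. All limits are along an arbitrary filter, so dominated
  convergence is confined to sequences and the filter enters by continuity in finitely many real
  parameters.\<close>

lemma (in prob_space) centered_normal_moments:
  assumes X: "centered_normal M X v" and v: "0 \<le> v"
  shows "integrable M (\<lambda>\<omega>. X \<omega> ^ k)"
    and "expectation X = 0"
    and "expectation (\<lambda>\<omega>. X \<omega> ^ 2) = v"
    and "expectation (\<lambda>\<omega>. X \<omega> ^ 4) = 3 * v\<^sup>2"
proof -
  have [measurable]: "X \<in> borel_measurable M"
    using X by (simp add: centered_normal_def)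
  have "integrable M (\<lambda>\<omega>. X \<omega> ^ k) \<and> expectation X = 0 \<and>
      expectation (\<lambda>\<omega>. X \<omega> ^ 2) = v \<and> expectation (\<lambda>\<omega>. X \<omega> ^ 4) = 3 * v\<^sup>2"
  proof (cases "v = 0")
    case True
    then have ae: "AE \<omega> in M. X \<omega> = 0"
      using X by (simp add: centered_normal_def)
    have "integrable M (\<lambda>\<omega>. X \<omega> ^ k) \<longleftrightarrow> integrable M (\<lambda>\<omega>. 0 ^ k :: real)"
      using ae by (intro integrable_cong_AE) auto
    moreover have "expectation (\<lambda>\<omega>. X \<omega> ^ j) = expectation (\<lambda>\<omega>. 0 ^ j)" for j
      using ae by (intro integral_cong_AE) auto
    from this[of 1] this[of 2] this[of 4] have "expectation X = 0"
      "expectation (\<lambda>\<omega>. X \<omega> ^ 2) = v" "expectation (\<lambda>\<omega>. X \<omega> ^ 4) = 3 * v\<^sup>2"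
      using True by simp_all
    ultimately show ?thesis by simp
  next
    case False
    then have s: "0 < sqrt v" using v by simp
    have D: "distributed M lborel X (\<lambda>x. ennreal (normal_density 0 (sqrt v) x))"
      using X False by (simp add: centered_normal_def)
    have I: "integrable M (\<lambda>\<omega>. X \<omega> ^ j)" for j
      using integrable_normal_moment[OF s, of 0 j]
      by (subst distributed_integrable[OF D, symmetric]) (auto simp: normal_density_nonneg)
    have E: "expectation (\<lambda>\<omega>. X \<omega> ^ j) = (\<integral>x. normal_density 0 (sqrt v) x * x ^ j \<partial>lborel)" for j
      by (subst distributed_integral[OF D, symmetric]) (auto simp: normal_density_nonneg)
    show ?thesis
      using I E[of 1] E[of 2] E[of 4] integral_normal_moment_nz_1[OF s, of 0]
        integral_normal_moment_even[OF s, of 0 1] integral_normal_moment_even[OF s, of 0 2] v False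
      by (simp add: fact_numeral field_simps power2_eq_square)
  qed
  then show "integrable M (\<lambda>\<omega>. X \<omega> ^ k)" "expectation X = 0"
    "expectation (\<lambda>\<omega>. X \<omega> ^ 2) = v" "expectation (\<lambda>\<omega>. X \<omega> ^ 4) = 3 * v\<^sup>2"
    by simp_all
qed

text \<open>Serves as the triangle inequality of \<open>L^2\<close>. With values in
  \<open>ennreal\<close> it needs no integrability, and the lost factor 2 is harmless, since only
  limits zero and bounds up to a constant are drawn from it.\<close>

lemma nn_integral_square_add_le:
  fixes f g :: "'a \<Rightarrow> real"
  assumes [measurable]: "f \<in> borel_measurable M" "g \<in> borel_measurable M"
  shows "(\<integral>\<^sup>+x. ennreal ((f x + g x)\<^sup>2) \<partial>M) \<le>
    2 * (\<integral>\<^sup>+x. ennreal ((f x)\<^sup>2) \<partial>M) + 2 * (\<integral>\<^sup>+x. ennreal ((g x)\<^sup>2) \<partial>M)"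
proof -
  have "(\<integral>\<^sup>+x. ennreal ((f x + g x)\<^sup>2) \<partial>M) \<le>
      (\<integral>\<^sup>+x. 2 * ennreal ((f x)\<^sup>2) + 2 * ennreal ((g x)\<^sup>2) \<partial>M)"
  proof (intro nn_integral_mono)
    fix x
    have "(f x + g x)\<^sup>2 \<le> 2 * (f x)\<^sup>2 + 2 * (g x)\<^sup>2"
      using sum_squares_bound[of "f x" "g x"] by (simp add: power2_sum)
    then have "ennreal ((f x + g x)\<^sup>2) \<le> ennreal (2 * (f x)\<^sup>2 + 2 * (g x)\<^sup>2)"
      by (rule ennreal_leI)
    then show "ennreal ((f x + g x)\<^sup>2) \<le> 2 * ennreal ((f x)\<^sup>2) + 2 * ennreal ((g x)\<^sup>2)"
      by (simp add: ennreal_plus ennreal_mult')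
  qed
  also have "\<dots> = 2 * (\<integral>\<^sup>+x. ennreal ((f x)\<^sup>2) \<partial>M) + 2 * (\<integral>\<^sup>+x. ennreal ((g x)\<^sup>2) \<partial>M)"
    by (simp add: nn_integral_add nn_integral_cmult)
  finally show ?thesis .
qed

text \<open>Bookkeeping for a common refinement: \<open>b i j\<close> is the value of an additive
  object on the cell \<open>(i, j)\<close>, and the indices \<open>m\<close> and \<open>m'\<close>
  stand for the complements of the two families, where the coefficients are zero. Leaving
  \<open>b\<close> and \<open>b2\<close> abstract lets one identity serve indicators, taken at two
  points, and noise, taken at one outcome.\<close>

lemma refined_double_sum:
  fixes b b2 :: "nat \<Rightarrow> nat \<Rightarrow> real"
  assumes \<alpha>: "\<And>i. i < m \<Longrightarrow> \<alpha> i = (\<Sum>j\<le>m'. b i j)"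
    and \<alpha>': "\<And>j. j < m' \<Longrightarrow> \<alpha>' j = (\<Sum>i\<le>m. b i j)"
    and \<beta>: "\<And>i. i < m \<Longrightarrow> \<beta> i = (\<Sum>j\<le>m'. b2 i j)"
    and \<beta>': "\<And>j. j < m' \<Longrightarrow> \<beta>' j = (\<Sum>i\<le>m. b2 i j)"
  shows "(\<Sum>(i, j)\<in>{..m} \<times> {..m'}. \<Sum>(k, l)\<in>{..m} \<times> {..m'}.
      ((if i < m \<and> k < m then a i k else 0) + c * (if j < m' \<and> l < m' then a' j l else 0)) *
        b i j * b2 k l) =
    (\<Sum>i<m. \<Sum>k<m. a i k * \<alpha> i * \<beta> k) + c * (\<Sum>j<m'. \<Sum>l<m'. a' j l * \<alpha>' j * \<beta>' l)"
proof -
  have ext: "(\<Sum>i<m. f i) = (\<Sum>i\<le>m. if i < m then f i else 0)" for f :: "nat \<Rightarrow> real" and m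
    unfolding lessThan_Suc_atMost[symmetric] by simp
  have 1: "(\<Sum>i<m. \<Sum>k<m. a i k * \<alpha> i * \<beta> k) =
      (\<Sum>(i, j)\<in>{..m} \<times> {..m'}. \<Sum>(k, l)\<in>{..m} \<times> {..m'}.
        (if i < m \<and> k < m then a i k else 0) * b i j * b2 k l)"
  proof -
    have "(\<Sum>i<m. \<Sum>k<m. a i k * \<alpha> i * \<beta> k) =
        (\<Sum>i\<le>m. \<Sum>k\<le>m. (if i < m \<and> k < m then a i k else 0) *
          (\<Sum>j\<le>m'. b i j) * (\<Sum>l\<le>m'. b2 k l))"
      unfolding ext by (intro sum.cong refl) (auto simp: \<alpha> \<beta> intro!: sum.cong)
    also have "\<dots> = (\<Sum>i\<le>m. \<Sum>k\<le>m. \<Sum>j\<le>m'. \<Sum>l\<le>m'.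
        (if i < m \<and> k < m then a i k else 0) * b i j * b2 k l)"
      by (intro sum.cong refl) (simp only: mult.assoc sum_product, simp only: sum_distrib_left)
    also have "\<dots> = (\<Sum>i\<le>m. \<Sum>j\<le>m'. \<Sum>k\<le>m. \<Sum>l\<le>m'.
        (if i < m \<and> k < m then a i k else 0) * b i j * b2 k l)"
      by (intro sum.cong refl sum.swap)
    finally show ?thesis
      by (simp only: sum.cartesian_product[symmetric])
  qed
  have 2: "(\<Sum>j<m'. \<Sum>l<m'. a' j l * \<alpha>' j * \<beta>' l) =
      (\<Sum>(i, j)\<in>{..m} \<times> {..m'}. \<Sum>(k, l)\<in>{..m} \<times> {..m'}.
        (if j < m' \<and> l < m' then a' j l else 0) * b i j * b2 k l)"
  proof -
    have "(\<Sum>j<m'. \<Sum>l<m'. a' j l * \<alpha>' j * \<beta>' l) =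
        (\<Sum>j\<le>m'. \<Sum>l\<le>m'. (if j < m' \<and> l < m' then a' j l else 0) *
          (\<Sum>i\<le>m. b i j) * (\<Sum>k\<le>m. b2 k l))"
      unfolding ext by (intro sum.cong refl) (auto simp: \<alpha>' \<beta>' intro!: sum.cong)
    also have "\<dots> = (\<Sum>j\<le>m'. \<Sum>l\<le>m'. \<Sum>i\<le>m. \<Sum>k\<le>m.
        (if j < m' \<and> l < m' then a' j l else 0) * b i j * b2 k l)"
      by (intro sum.cong refl) (simp only: mult.assoc sum_product, simp only: sum_distrib_left)
    also have "\<dots> = (\<Sum>j\<le>m'. \<Sum>i\<le>m. \<Sum>l\<le>m'. \<Sum>k\<le>m.
        (if j < m' \<and> l < m' then a' j l else 0) * b i j * b2 k l)"
      by (intro sum.cong refl sum.swap)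
    also have "\<dots> = (\<Sum>i\<le>m. \<Sum>j\<le>m'. \<Sum>l\<le>m'. \<Sum>k\<le>m.
        (if j < m' \<and> l < m' then a' j l else 0) * b i j * b2 k l)"
      by (rule sum.swap)
    also have "\<dots> = (\<Sum>i\<le>m. \<Sum>j\<le>m'. \<Sum>k\<le>m. \<Sum>l\<le>m'.
        (if j < m' \<and> l < m' then a' j l else 0) * b i j * b2 k l)"
      by (intro sum.cong refl sum.swap)
    finally show ?thesis
      by (simp only: sum.cartesian_product[symmetric])
  qed
  show ?thesis
    unfolding 1 2
    by (simp add: sum_distrib_left sum.distrib[symmetric] case_prod_unfold algebra_simps)
qed

lemma indicator_sum_UN:
  fixes A :: "nat \<Rightarrow> 'a set"
  assumes "finite I" "disjoint_family_on A I"
  shows "(\<Sum>i\<in>I. indicator (A i) x :: real) = indicator (\<Union>i\<in>I. A i) x"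
  using indicator_UN_disjoint[OF assms] by (rule sym)

lemma step_function_measurable:
  assumes "off_diagonal_step m A a"
  shows "step_function m A a \<in> borel_measurable (lborel \<Otimes>\<^sub>M lborel)"
proof -
  have [measurable]: "A i \<in> sets borel" if "i < m" for i
    using assms that by (auto simp: off_diagonal_step_def)
  show ?thesis
    unfolding step_function_def by measurable
qed

section \<open>Additivity of the noise, common refinement and second moments of step
  integrals\<close>

locale white_noise =
  fixes M :: "'a measure" and B :: "real set \<Rightarrow> 'a \<Rightarrow> real"
  assumes noise: "brownian_random_measure M B"
begin

sublocale prob_space M
  using noise by (simp add: brownian_random_measure_def)

context
  fixes A :: "real set"
  assumes A: "A \<in> sets borel" "emeasure lborel A < \<infinity>"
begin

lemma noise_centered_normal: "centered_normal M (B A) (measure lborel A)"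
  using noise A by (simp add: brownian_random_measure_def)

lemma noise_measurable: "B A \<in> borel_measurable M"
  using noise_centered_normal by (simp add: centered_normal_def)

lemmas noise_moments = centered_normal_moments[OF noise_centered_normal measure_nonneg]

end

lemma noise_empty: "AE \<omega> in M. B {} \<omega> = 0"
  using noise_centered_normal[of "{}"] by (simp add: centered_normal_def)

text \<open>The family is padded with empty sets to an infinite one. The series of countable
  additivity is then a finite sum, because \<open>B {}\<close>, a centred normal variable of
  variance 0, vanishes almost surely.\<close>

lemma noise_finite_additive:
  assumes A: "\<And>i. i \<in> I \<Longrightarrow> A i \<in> sets borel" "emeasure lborel (\<Union>i\<in>I. A i) < \<infinity>"
    and disj: "disjoint_family_on A I" and I: "finite (I :: nat set)"
  shows "AE \<omega> in M. B (\<Union>i\<in>I. A i) \<omega> = (\<Sum>i\<in>I. B (A i) \<omega>)"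
proof -
  define A' where "A' i = (if i \<in> I then A i else {})" for i
  have U: "(\<Union>i. A' i) = (\<Union>i\<in>I. A i)"
    by (auto simp: A'_def)
  have "disjoint_family A'"
    using disj unfolding disjoint_family_on_def A'_def by auto
  moreover have "range A' \<subseteq> sets borel"
    using A by (auto simp: A'_def)
  moreover have "emeasure lborel (\<Union>n. A' n) < \<infinity>"
    using A by (simp add: U)
  ultimately have "AE \<omega> in M. (\<lambda>n. B (A' n) \<omega>) sums B (\<Union>n. A' n) \<omega>"
    using noise unfolding brownian_random_measure_def by blast
  then show ?thesis
    using noise_empty
  proof eventually_elim
    case (elim \<omega>)
    have "(\<lambda>n. B (A' n) \<omega>) sums (\<Sum>i\<in>I. B (A' i) \<omega>)"
      by (rule sums_finite[OF I]) (simp add: A'_def elim)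
    with elim have "B (\<Union>n. A' n) \<omega> = (\<Sum>i\<in>I. B (A' i) \<omega>)"
      using sums_unique2 by blast
    then show ?case
      by (simp add: U A'_def)
  qed
qed

text \<open>Step functions for two different families are rewritten on their common refinement. The
  vanishing diagonal survives, since the coefficient of a cell with itself is built from diagonal
  coefficients of both. The integrals agree only almost surely, because the noise is additive only
  almost surely.\<close>

lemma step_combine:
  assumes S: "off_diagonal_step m A a" and S': "off_diagonal_step m' A' a'"
  obtains n C d where "off_diagonal_step n C d"
    and "\<And>p. step_function n C d p = step_function m A a p + c * step_function m' A' a' p"
    and "AE \<omega> in M. step_integral B n C d \<omega> =
      step_integral B m A a \<omega> + c * step_integral B m' A' a' \<omega>"
proof -
  \<comment> \<open>The extra indices \<open>m\<close> and \<open>m'\<close> name the complements.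
    This turns both families into partitions of the line, so that each \<open>A i\<close> is the
    union of its cells.\<close>
  define P where "P i = (if i < m then A i else - (\<Union>k<m. A k))" for i
  define P' where "P' j = (if j < m' then A' j else - (\<Union>k<m'. A' k))" for j
  \<comment> \<open>the cell outside both families has infinite measure and is dropped\<close>
  define cell where "cell i j = (if i < m \<or> j < m' then P i \<inter> P' j else {})" for i j
  define I where "I = {..m} \<times> {..m'}"
  define e where "e = (\<lambda>(i, j) (k, l). (if i < m \<and> k < m then a i k else 0) +
    c * (if j < m' \<and> l < m' then a' j l else 0))"
  have A: "A i \<in> sets borel" "emeasure lborel (A i) < \<infinity>" "a i i = 0" if "i < m" for i
    using S that by (auto simp: off_diagonal_step_def)
  have A': "A' i \<in> sets borel" "emeasure lborel (A' i) < \<infinity>" "a' i i = 0" if "i < m'" for i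
    using S' that by (auto simp: off_diagonal_step_def)
  have P: "P i \<in> sets borel" for i
  proof -
    have "(\<Union>k<m. A k) \<in> sets borel" using A by auto
    then show ?thesis unfolding P_def by (split if_split) (use A borel_comp in blast)
  qed
  have P': "P' i \<in> sets borel" for i
  proof -
    have "(\<Union>k<m'. A' k) \<in> sets borel" using A' by auto
    then show ?thesis unfolding P'_def by (split if_split) (use A' borel_comp in blast)
  qed
  have cell_sets: "cell i j \<in> sets borel" for i j
    using P P' by (auto simp: cell_def)
  have cell_fin: "emeasure lborel (cell i j) < \<infinity>" for i j
  proof -
    consider "i < m" | "j < m'" | "\<not> i < m \<and> \<not> j < m'" by blast
    then show ?thesis
    proof cases
      case 1
      have "emeasure lborel (cell i j) \<le> emeasure lborel (A i)"
        using 1 A by (intro emeasure_mono) (auto simp: cell_def P_def)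
      then show ?thesis using A(2)[OF 1] by (simp add: le_less_trans)
    next
      case 2
      have "emeasure lborel (cell i j) \<le> emeasure lborel (A' j)"
        using 2 A' by (intro emeasure_mono) (auto simp: cell_def P'_def)
      then show ?thesis using A'(2)[OF 2] by (simp add: le_less_trans)
    qed (simp add: cell_def)
  qed
  have dA: "disjoint_family_on A {..<m}" and dA': "disjoint_family_on A' {..<m'}"
    using S S' by (auto simp: off_diagonal_step_def)
  have Pdisj: "P i \<inter> P k = {}" if "i \<le> m" "k \<le> m" "i \<noteq> k" for i k
    using that dA unfolding disjoint_family_on_def P_def by auto
  have Pdisj': "P' i \<inter> P' k = {}" if "i \<le> m'" "k \<le> m'" "i \<noteq> k" for i k
    using that dA' unfolding disjoint_family_on_def P'_def by auto
  have cell_disj: "cell i j \<inter> cell k l = {}"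
    if "i \<le> m" "j \<le> m'" "k \<le> m" "l \<le> m'" "(i, j) \<noteq> (k, l)" for i j k l
    using that Pdisj[of i k] Pdisj'[of j l] by (auto simp: cell_def)
  have UP: "(\<Union>i\<le>m. P i) = UNIV"
  proof -
    have "x \<in> (\<Union>i\<le>m. P i)" for x
    proof (cases "x \<in> (\<Union>k<m. A k)")
      case True then show ?thesis by (auto simp: P_def intro: less_imp_le)
    next
      case False then have "x \<in> P m" by (auto simp: P_def)
      then show ?thesis by blast
    qed
    then show ?thesis by blast
  qed
  have UP': "(\<Union>i\<le>m'. P' i) = UNIV"
  proof -
    have "x \<in> (\<Union>i\<le>m'. P' i)" for x
    proof (cases "x \<in> (\<Union>k<m'. A' k)")
      case True then show ?thesis by (auto simp: P'_def intro: less_imp_le)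
    next
      case False then have "x \<in> P' m'" by (auto simp: P'_def)
      then show ?thesis by blast
    qed
    then show ?thesis by blast
  qed
  have UA: "(\<Union>j\<le>m'. cell i j) = A i" if "i < m" for i
    using that UP' unfolding cell_def P_def by auto
  have UA': "(\<Union>i\<le>m. cell i j) = A' j" if "j < m'" for j
    using that UP unfolding cell_def P'_def by auto
  have fd: "disjoint_family_on (cell i) {..m'}" if "i \<le> m" for i
    using that cell_disj unfolding disjoint_family_on_def by simp
  have fd': "disjoint_family_on (\<lambda>i. cell i j) {..m}" if "j \<le> m'" for j
    using that cell_disj unfolding disjoint_family_on_def by simp
  \<comment> \<open>\<open>off_diagonal_step\<close> demands a family indexed by an initial segment
    of the naturals, so the pairs are enumerated by a bijection \<open>h\<close>.\<close>
  have "finite I" by (simp add: I_def)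
  then obtain h where h: "bij_betw h {..<card I} I"
    using ex_bij_betw_nat_finite by (metis atLeast0LessThan)
  define C where "C k = case_prod cell (h k)" for k
  define d where "d k l = e (h k) (h l)" for k l
  have hI: "h k \<in> I" if "k < card I" for k
    using h that by (auto simp: bij_betw_def)
  have hinj: "h k \<noteq> h l" if "k < card I" "l < card I" "k \<noteq> l" for k l
    using h that by (auto simp: bij_betw_def inj_on_def)
  have step: "off_diagonal_step (card I) C d"
    unfolding off_diagonal_step_def
  proof (intro conjI allI impI)
    fix k
    show "C k \<in> sets borel" "emeasure lborel (C k) < \<infinity>"
      using cell_sets cell_fin by (auto simp: C_def split: prod.split)
    assume "k < card I"
    then show "d k k = 0"
      using hI[of k] A(3) A'(3) by (auto simp: d_def e_def split: prod.split)
  next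
    show "disjoint_family_on C {..<card I}"
      unfolding disjoint_family_on_def
    proof (intro ballI impI)
      fix k l assume kl: "k \<in> {..<card I}" "l \<in> {..<card I}" "k \<noteq> l"
      then have "h k \<in> I" "h l \<in> I" "h k \<noteq> h l"
        using hI hinj by auto
      then show "C k \<inter> C l = {}"
        unfolding C_def I_def using cell_disj by (cases "h k"; cases "h l") auto
    qed
  qed
  have reindex: "(\<Sum>k<card I. \<Sum>l<card I. d k l * b (h k) * b2 (h l)) =
      (\<Sum>p\<in>I. \<Sum>q\<in>I. e p q * b p * b2 q)" for b b2 :: "nat \<times> nat \<Rightarrow> real"
  proof -
    have "(\<Sum>k<card I. \<Sum>l<card I. d k l * b (h k) * b2 (h l)) =
        (\<Sum>k<card I. (\<Sum>q\<in>I. e (h k) q * b (h k) * b2 q))"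
      unfolding d_def
      by (intro sum.cong refl sum.reindex_bij_betw[OF h, of "\<lambda>q. e (h _) q * b (h _) * b2 q"])
    also have "\<dots> = (\<Sum>p\<in>I. \<Sum>q\<in>I. e p q * b p * b2 q)"
      by (intro sum.reindex_bij_betw[OF h, of "\<lambda>p. \<Sum>q\<in>I. e p q * b p * b2 q"])
    finally show ?thesis .
  qed
  have I_sum: "(\<Sum>p\<in>I. \<Sum>q\<in>I. e p q * case_prod b p * case_prod b2 q) =
    (\<Sum>(i, j)\<in>{..m} \<times> {..m'}. \<Sum>(k, l)\<in>{..m} \<times> {..m'}.
      ((if i < m \<and> k < m then a i k else 0) + c * (if j < m' \<and> l < m' then a' j l else 0)) *
        b i j * b2 k l)" for b b2 :: "nat \<Rightarrow> nat \<Rightarrow> real"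
    unfolding I_def e_def by (simp add: case_prod_unfold)
  have fun_eq: "step_function (card I) C d p =
      step_function m A a p + c * step_function m' A' a' p" for p
  proof -
    obtain x y where p: "p = (x, y)" by (cases p)
    have 1: "step_function (card I) C d p =
        (\<Sum>k<card I. \<Sum>l<card I. d k l * indicator (case_prod cell (h k)) x *
          indicator (case_prod cell (h l)) y)"
      by (simp add: step_function_def p C_def)
    have 2: "indicator (A i) z = (\<Sum>j\<le>m'. indicator (cell i j) z :: real)" if "i < m" for i z
      using indicator_sum_UN[OF _ fd[of i], of z] UA[of i] that by simp
    have 3: "indicator (A' j) z = (\<Sum>i\<le>m. indicator (cell i j) z :: real)" if "j < m'" for j z
      using indicator_sum_UN[OF _ fd'[of j], of z] UA'[of j] that by simp
    have "step_function (card I) C d p = (\<Sum>p\<in>I. \<Sum>q\<in>I. e p q *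
        (\<lambda>(i, j). indicator (cell i j) x) p * (\<lambda>(i, j). indicator (cell i j) y) q)"
      unfolding reindex[symmetric] 1 by (simp add: case_prod_unfold)
    also have "\<dots> = (\<Sum>i<m. \<Sum>k<m. a i k * indicator (A i) x * indicator (A k) y) +
       c * (\<Sum>j<m'. \<Sum>l<m'. a' j l * indicator (A' j) x * indicator (A' l) y)"
      unfolding I_sum by (rule refined_double_sum) (auto simp: 2 3)
    finally show ?thesis
      by (simp add: step_function_def p)
  qed
  have ae1: "AE \<omega> in M. \<forall>i\<in>{..<m}. B (A i) \<omega> = (\<Sum>j\<le>m'. B (cell i j) \<omega>)"
  proof (intro AE_finite_allI)
    fix i assume "i \<in> {..<m}"
    then show "AE \<omega> in M. B (A i) \<omega> = (\<Sum>j\<le>m'. B (cell i j) \<omega>)"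
      using noise_finite_additive[of "{..m'}" "cell i"] cell_sets UA[of i] A[of i] fd[of i] by simp
  qed simp
  have ae2: "AE \<omega> in M. \<forall>j\<in>{..<m'}. B (A' j) \<omega> = (\<Sum>i\<le>m. B (cell i j) \<omega>)"
  proof (intro AE_finite_allI)
    fix j assume "j \<in> {..<m'}"
    then show "AE \<omega> in M. B (A' j) \<omega> = (\<Sum>i\<le>m. B (cell i j) \<omega>)"
      using noise_finite_additive[of "{..m}" "\<lambda>i. cell i j"] cell_sets UA'[of j] A'[of j] fd'[of j]
      by simp
  qed simp
  have "AE \<omega> in M. step_integral B (card I) C d \<omega> =
      step_integral B m A a \<omega> + c * step_integral B m' A' a' \<omega>"
    using ae1 ae2
  proof eventually_elim
    case (elim \<omega>)
    have "step_integral B (card I) C d \<omega> =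
        (\<Sum>p\<in>I. \<Sum>q\<in>I. e p q * (\<lambda>(i, j). B (cell i j) \<omega>) p * (\<lambda>(i, j). B (cell i j) \<omega>) q)"
      unfolding reindex[symmetric] step_integral_def C_def by (simp add: case_prod_unfold)
    then show ?case
      unfolding I_sum step_integral_def
      by (subst (asm) refined_double_sum[where \<alpha> = "\<lambda>i. B (A i) \<omega>" and \<beta> = "\<lambda>i. B (A i) \<omega>"
          and \<alpha>' = "\<lambda>i. B (A' i) \<omega>" and \<beta>' = "\<lambda>i. B (A' i) \<omega>"]) (use elim in auto)
  qed
  with step fun_eq show ?thesis by (rule that)
qed


text \<open>The rectangles are disjoint, so each point meets at most one term and squaring acts on
  the coefficients alone.\<close>

lemma step_square_nn_integral:
  assumes S: "off_diagonal_step m A a"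
  shows "(\<integral>\<^sup>+p. ennreal ((step_function m A a p)\<^sup>2) \<partial>(lborel \<Otimes>\<^sub>M lborel)) =
    ennreal (\<Sum>i<m. \<Sum>j<m. (a i j)\<^sup>2 * measure lborel (A i) * measure lborel (A j))"
proof -
  have A[measurable]: "A i \<in> sets borel" and fin: "emeasure lborel (A i) < \<infinity>" if "i < m" for i
    using S that by (auto simp: off_diagonal_step_def)
  have disj: "disjoint_family_on A {..<m}"
    using S by (auto simp: off_diagonal_step_def)
  have sq: "(step_function m A a (x, y))\<^sup>2 =
      (\<Sum>i<m. \<Sum>j<m. (a i j)\<^sup>2 * indicator (A i) x * indicator (A j) y)" for x y
  proof (cases "x \<in> (\<Union>i<m. A i) \<and> y \<in> (\<Union>i<m. A i)")
    case True
    then obtain i j where ij: "i < m" "x \<in> A i" "j < m" "y \<in> A j" by blast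
    have ix: "indicator (A k) x = (if k = i then 1 else 0 :: real)" if "k < m" for k
      using ij disj that by (auto simp: disjoint_family_on_def indicator_def)
    have jy: "indicator (A k) y = (if k = j then 1 else 0 :: real)" if "k < m" for k
      using ij disj that by (auto simp: disjoint_family_on_def indicator_def)
    have "(\<Sum>k<m. \<Sum>l<m. c k l * indicator (A k) x * indicator (A l) y) = c i j" for c :: "nat \<Rightarrow> nat \<Rightarrow> real"
    proof -
      have "(\<Sum>k<m. \<Sum>l<m. c k l * indicator (A k) x * indicator (A l) y) =
          (\<Sum>k<m. \<Sum>l<m. if k = i then (if l = j then c k l else 0) else 0)"
        by (intro sum.cong refl) (auto simp: ix jy)
      also have "\<dots> = (\<Sum>k<m. if k = i then (\<Sum>l<m. if l = j then c k l else 0) else 0)"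
        by (intro sum.cong refl) auto
      finally show ?thesis using ij by (simp add: sum.delta)
    qed
    then show ?thesis by (simp add: step_function_def)
  next
    case False
    then have "indicator (A i) x * indicator (A j) y = (0 :: real)" if "i < m" "j < m" for i j
      using that by (auto simp: indicator_def)
    then have "(\<Sum>k<m. \<Sum>l<m. c k l * indicator (A k) x * indicator (A l) y) = 0"
      for c :: "nat \<Rightarrow> nat \<Rightarrow> real"
      by (intro sum.neutral ballI) (simp add: mult.assoc del: mult_eq_0_iff)
    then show ?thesis by (simp add: step_function_def)
  qed
  have "(\<integral>\<^sup>+p. ennreal ((step_function m A a p)\<^sup>2) \<partial>(lborel \<Otimes>\<^sub>M lborel)) =
      (\<integral>\<^sup>+p. (\<Sum>i<m. \<Sum>j<m. ennreal ((a i j)\<^sup>2) * indicator (A i \<times> A j) p) \<partial>(lborel \<Otimes>\<^sub>M lborel))"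
  proof (intro nn_integral_cong)
    fix p :: "real \<times> real"
    obtain x y where p: "p = (x, y)" by (cases p)
    have "ennreal ((step_function m A a p)\<^sup>2) =
        (\<Sum>i<m. \<Sum>j<m. ennreal ((a i j)\<^sup>2 * indicator (A i) x * indicator (A j) y))"
      unfolding p sq by (simp add: sum_ennreal sum_nonneg)
    also have "\<dots> = (\<Sum>i<m. \<Sum>j<m. ennreal ((a i j)\<^sup>2) * indicator (A i \<times> A j) p)"
      by (intro sum.cong refl) (auto simp: p indicator_def)
    finally show "ennreal ((step_function m A a p)\<^sup>2) =
        (\<Sum>i<m. \<Sum>j<m. ennreal ((a i j)\<^sup>2) * indicator (A i \<times> A j) p)" .
  qed
  also have "\<dots> = (\<Sum>i<m. \<Sum>j<m. ennreal ((a i j)\<^sup>2) * (emeasure lborel (A i) * emeasure lborel (A j)))"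
  proof -
    have [measurable]: "A i \<times> A j \<in> sets (lborel \<Otimes>\<^sub>M lborel)" if "i < m" "j < m" for i j
      using that by (intro pair_measureI) auto
    have "(\<integral>\<^sup>+p. (\<Sum>i<m. \<Sum>j<m. ennreal ((a i j)\<^sup>2) * indicator (A i \<times> A j) p) \<partial>(lborel \<Otimes>\<^sub>M lborel)) =
        (\<Sum>i<m. \<integral>\<^sup>+p. (\<Sum>j<m. ennreal ((a i j)\<^sup>2) * indicator (A i \<times> A j) p) \<partial>(lborel \<Otimes>\<^sub>M lborel))"
      by (rule nn_integral_sum) measurable
    also have "\<dots> = (\<Sum>i<m. \<Sum>j<m. \<integral>\<^sup>+p. ennreal ((a i j)\<^sup>2) * indicator (A i \<times> A j) p \<partial>(lborel \<Otimes>\<^sub>M lborel))"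
      by (intro sum.cong refl nn_integral_sum) measurable
    also have "\<dots> = (\<Sum>i<m. \<Sum>j<m. ennreal ((a i j)\<^sup>2) * (emeasure lborel (A i) * emeasure lborel (A j)))"
      by (intro sum.cong refl)
        (simp add: nn_integral_cmult_indicator lborel.emeasure_pair_measure_Times)
    finally show ?thesis .
  qed
  also have "\<dots> = (\<Sum>i<m. \<Sum>j<m. ennreal ((a i j)\<^sup>2 * measure lborel (A i) * measure lborel (A j)))"
    using fin by (intro sum.cong refl)
      (simp add: emeasure_eq_ennreal_measure ennreal_mult'[symmetric] mult.assoc less_top[symmetric])
  finally show ?thesis
    by (simp add: sum_ennreal sum_nonneg)
qed

lemma noise_indep:
  assumes S: "off_diagonal_step m A a"
  shows "indep_vars (\<lambda>_. borel) (\<lambda>i. B (A i)) {..<m}"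
proof -
  define A' where "A' i = (if i < m then A i else {})" for i
  have "disjoint_family A'" "range A' \<subseteq> sets borel" "\<forall>n. emeasure lborel (A' n) < \<infinity>"
    using S by (auto simp: off_diagonal_step_def disjoint_family_on_def A'_def)
  then have "indep_vars (\<lambda>_. borel) (\<lambda>n. B (A' n)) UNIV"
    using noise unfolding brownian_random_measure_def by blast
  then have "indep_vars (\<lambda>_. borel) (\<lambda>n. B (A' n)) {..<m}"
    by (rule indep_vars_subset) simp
  then show ?thesis
    by (subst indep_vars_cong[where Y = "\<lambda>n. B (A' n)"]) (auto simp: A'_def)
qed

lemma noise_power_product:
  assumes S: "off_diagonal_step m A a"
  shows "integrable M (\<lambda>\<omega>. \<Prod>i<m. B (A i) \<omega> ^ e i)"
    and "expectation (\<lambda>\<omega>. \<Prod>i<m. B (A i) \<omega> ^ e i) = (\<Prod>i<m. expectation (\<lambda>\<omega>. B (A i) \<omega> ^ e i))"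
proof -
  have ind: "indep_vars (\<lambda>_. borel) (\<lambda>i \<omega>. B (A i) \<omega> ^ e i) {..<m}"
    by (rule indep_vars_compose2[OF noise_indep[OF S]]) simp
  have int: "integrable M (\<lambda>\<omega>. B (A i) \<omega> ^ e i)" if "i \<in> {..<m}" for i
    using S that by (intro noise_moments) (auto simp: off_diagonal_step_def)
  show "integrable M (\<lambda>\<omega>. \<Prod>i<m. B (A i) \<omega> ^ e i)"
    using ind int by (intro indep_vars_integrable) auto
  show "expectation (\<lambda>\<omega>. \<Prod>i<m. B (A i) \<omega> ^ e i) = (\<Prod>i<m. expectation (\<lambda>\<omega>. B (A i) \<omega> ^ e i))"
    using ind int by (intro indep_vars_lebesgue_integral) auto
qed

text \<open>A product of four noises is a monomial in independent variables, with the multiplicity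
  \<open>e p\<close> of the index \<open>p\<close> as exponent, so its expectation factors into
  moments. The second conclusion is Wick's formula, in which the pairing of \<open>i\<close> with
  \<open>j\<close> and \<open>k\<close> with \<open>l\<close> drops out.\<close>

lemma noise_four_products:
  assumes S: "off_diagonal_step m A a" and ijkl: "i < m" "j < m" "k < m" "l < m"
  defines "v \<equiv> \<lambda>i. measure lborel (A i)"
  shows "integrable M (\<lambda>\<omega>. B (A i) \<omega> * B (A j) \<omega> * (B (A k) \<omega> * B (A l) \<omega>))" (is ?int)
    and "i \<noteq> j \<Longrightarrow> k \<noteq> l \<Longrightarrow>
      expectation (\<lambda>\<omega>. B (A i) \<omega> * B (A j) \<omega> * (B (A k) \<omega> * B (A l) \<omega>)) =
        (if k = i \<and> l = j \<or> k = j \<and> l = i then v i * v j else 0)" (is "_ \<Longrightarrow> _ \<Longrightarrow> ?E")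
    and "i \<noteq> k \<Longrightarrow> expectation (\<lambda>\<omega>. (B (A i) \<omega>)\<^sup>2 * (B (A k) \<omega>)\<^sup>2) = v i * v k" (is "_ \<Longrightarrow> ?E2")
proof -
  define e :: "nat \<Rightarrow> nat" where
    "e p = of_bool (p = i) + of_bool (p = j) + of_bool (p = k) + of_bool (p = l)" for p
  have delta: "(\<Prod>p<m. x p ^ of_bool (p = q)) = x q" if "q < m" for x :: "nat \<Rightarrow> real" and q
  proof -
    have "(\<Prod>p<m. x p ^ of_bool (p = q)) = (\<Prod>p<m. if p = q then x p else 1)"
      by (intro prod.cong) auto
    then show ?thesis using that by (simp add: prod.delta)
  qed
  have prod_e: "(\<Prod>p<m. x p ^ e p) = x i * x j * (x k * x l)" for x :: "nat \<Rightarrow> real"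
    using ijkl by (simp only: e_def power_add prod.distrib delta mult.assoc)
  show ?int
    using noise_power_product(1)[OF S, of e] by (simp only: prod_e)
  have A: "A p \<in> sets borel" "emeasure lborel (A p) < \<infinity>" if "p < m" for p
    using S that by (auto simp: off_diagonal_step_def)
  define \<mu> where "\<mu> p q = expectation (\<lambda>\<omega>. B (A p) \<omega> ^ q)" for p q
  have \<mu>: "\<mu> p 0 = 1" "\<mu> p (Suc 0) = 0" "\<mu> p 2 = v p" if "p < m" for p
    using noise_moments[OF A(1) A(2), OF that that] by (simp_all add: \<mu>_def v_def prob_space)
  have E: "expectation (\<lambda>\<omega>. B (A i) \<omega> * B (A j) \<omega> * (B (A k) \<omega> * B (A l) \<omega>)) =
      (\<Prod>p<m. \<mu> p (e p))"
    using noise_power_product(2)[OF S, of e] by (simp only: prod_e \<mu>_def)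
  have pair: "(\<Prod>p<m. \<mu> p (e p)) = v r * v s"
    if "r < m" "s < m" "r \<noteq> s" "\<And>p. e p = (if p = r \<or> p = s then 2 else 0)" for r s :: nat
  proof -
    have "(\<Prod>p<m. \<mu> p (e p)) = (\<Prod>p<m. (if p = r then v p else 1) * (if p = s then v p else 1))"
      using that by (intro prod.cong refl) (auto simp: \<mu>)
    also have "\<dots> = v r * v s"
      using that by (simp add: prod.distrib prod.delta)
    finally show ?thesis .
  qed
  {
    assume ne: "i \<noteq> j" "k \<noteq> l"
    show ?E
    proof (cases "k = i \<and> l = j \<or> k = j \<and> l = i")
      case True
      then have "\<And>p. e p = (if p = i \<or> p = j then 2 else 0)"
        using ne by (auto simp: e_def)
      with True show ?thesis using E pair[of i j] ijkl ne by simp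
    next
      case False
      \<comment> \<open>The two index pairs are different two-element sets. An index that lies in
        exactly one of them has multiplicity 1 and contributes a first moment, which is
        zero.\<close>
      then have "\<exists>q<m. e q = Suc 0"
        using ne ijkl unfolding e_def by (cases "k = i \<or> k = j") auto
      then obtain q where "q < m" "\<mu> q (e q) = 0"
        using \<mu> by auto
      then have "(\<Prod>p<m. \<mu> p (e p)) = 0" by auto
      with E False show ?thesis by metis
    qed
  }
  {
    assume ne: "i \<noteq> k"
    define e' :: "nat \<Rightarrow> nat" where "e' p = 2 * of_bool (p = i) + 2 * of_bool (p = k)" for p
    have "(\<Prod>p<m. x p ^ e' p) = (x i)\<^sup>2 * (x k)\<^sup>2" for x :: "nat \<Rightarrow> real"
      using ijkl by (simp only: e'_def power_add power_mult prod.distrib delta[of _ "\<lambda>p. (x p)\<^sup>2"])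
    then have "expectation (\<lambda>\<omega>. (B (A i) \<omega>)\<^sup>2 * (B (A k) \<omega>)\<^sup>2) = (\<Prod>p<m. \<mu> p (e' p))"
      using noise_power_product(2)[OF S, of e'] by (simp only: \<mu>_def)
    also have "\<dots> = (\<Prod>p<m. (if p = i then v p else 1) * (if p = k then v p else 1))"
      using ne ijkl by (intro prod.cong refl) (auto simp: \<mu> e'_def simp flip: numeral_2_eq_2)
    also have "\<dots> = v i * v k"
      using ijkl by (simp add: prod.distrib prod.delta)
    finally show ?E2 .
  }
qed

lemma step_integral_measurable:
  assumes "off_diagonal_step m A a"
  shows "step_integral B m A a \<in> borel_measurable M"
proof -
  have [measurable]: "B (A i) \<in> borel_measurable M" if "i < m" for i
    using assms that by (intro noise_measurable) (auto simp: off_diagonal_step_def)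
  show ?thesis
    unfolding step_integral_def by measurable
qed

text \<open>By the four-product rule the second moment is the sum of
  \<open>(a i j * a i j + a i j * a j i) * v i * v j\<close>. As no symmetry of \<open>a\<close> is
  assumed, the mixed term is estimated by squares, hence an inequality with the factor 2.\<close>

lemma step_integral_square:
  assumes S: "off_diagonal_step m A a"
  shows "integrable M (\<lambda>\<omega>. (step_integral B m A a \<omega>)\<^sup>2)"
    and "expectation (\<lambda>\<omega>. (step_integral B m A a \<omega>)\<^sup>2) \<le>
      2 * (\<Sum>i<m. \<Sum>j<m. (a i j)\<^sup>2 * measure lborel (A i) * measure lborel (A j))"
proof -
  define v where "v i = measure lborel (A i)" for i
  have v: "0 \<le> v i" for i by (simp add: v_def)
  have a0: "a i i = 0" if "i < m" for i
    using S that by (auto simp: off_diagonal_step_def)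
  have sq: "(step_integral B m A a \<omega>)\<^sup>2 = (\<Sum>i<m. \<Sum>j<m. \<Sum>k<m. \<Sum>l<m.
      a i j * a k l * (B (A i) \<omega> * B (A j) \<omega> * (B (A k) \<omega> * B (A l) \<omega>)))" for \<omega>
    unfolding step_integral_def power2_eq_square
    by (simp only: sum_distrib_left sum_distrib_right) (simp only: mult_ac)
  have int: "integrable M (\<lambda>\<omega>. a i j * a k l * (B (A i) \<omega> * B (A j) \<omega> * (B (A k) \<omega> * B (A l) \<omega>)))"
    if "i < m" "j < m" "k < m" "l < m" for i j k l
    using noise_four_products(1)[OF S that] by simp
  show "integrable M (\<lambda>\<omega>. (step_integral B m A a \<omega>)\<^sup>2)"
    unfolding sq using int by (intro Bochner_Integration.integrable_sum) auto
  have "expectation (\<lambda>\<omega>. (step_integral B m A a \<omega>)\<^sup>2) = (\<Sum>i<m. \<Sum>j<m. \<Sum>k<m. \<Sum>l<m.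
      a i j * a k l * expectation (\<lambda>\<omega>. B (A i) \<omega> * B (A j) \<omega> * (B (A k) \<omega> * B (A l) \<omega>)))"
    unfolding sq
    by (subst Bochner_Integration.integral_sum, (intro Bochner_Integration.integrable_sum int; simp), intro sum.cong refl)+
      simp
  also have "\<dots> = (\<Sum>i<m. \<Sum>j<m. \<Sum>k<m. \<Sum>l<m.
      (if k = i then if l = j then a i j * a i j * v i * v j else 0 else 0) +
      (if k = j then if l = i then a i j * a j i * v i * v j else 0 else 0))"
  proof (intro sum.cong refl)
    fix i j k l assume "i \<in> {..<m}" "j \<in> {..<m}" "k \<in> {..<m}" "l \<in> {..<m}"
    then have *: "i < m" "j < m" "k < m" "l < m" by auto
    show "a i j * a k l * expectation (\<lambda>\<omega>. B (A i) \<omega> * B (A j) \<omega> * (B (A k) \<omega> * B (A l) \<omega>)) =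
      (if k = i then if l = j then a i j * a i j * v i * v j else 0 else 0) +
      (if k = j then if l = i then a i j * a j i * v i * v j else 0 else 0)"
    proof (cases "i = j \<or> k = l")
      case True
      then show ?thesis using * a0 by auto
    next
      case False
      then show ?thesis using noise_four_products(2)[OF S *] by (auto simp: v_def)
    qed
  qed
  also have "\<dots> = (\<Sum>i<m. \<Sum>j<m. (a i j * a i j + a i j * a j i) * v i * v j)"
  proof (intro sum.cong refl)
    fix i j assume ij: "i \<in> {..<m}" "j \<in> {..<m}"
    have swap_if: "(\<Sum>l<m. if P then f l else 0) = (if P then (\<Sum>l<m. f l) else 0)"
      for P and f :: "nat \<Rightarrow> real" by simp
    show "(\<Sum>k<m. \<Sum>l<m. (if k = i then if l = j then a i j * a i j * v i * v j else 0 else 0) +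
        (if k = j then if l = i then a i j * a j i * v i * v j else 0 else 0)) =
        (a i j * a i j + a i j * a j i) * v i * v j"
      using ij by (simp add: sum.distrib swap_if sum.delta algebra_simps)
  qed
  \<comment> \<open>Summed over both indices, the transposed square contributes as much as the other
    one, so the weights 3/2 and 1/2 add up to 2.\<close>
  also have "\<dots> \<le> (\<Sum>i<m. \<Sum>j<m. (3/2 * (a i j)\<^sup>2 + 1/2 * (a j i)\<^sup>2) * v i * v j)"
  proof (intro sum_mono mult_right_mono v)
    fix i j
    show "a i j * a i j + a i j * a j i \<le> 3/2 * (a i j)\<^sup>2 + 1/2 * (a j i)\<^sup>2"
      using sum_squares_bound[of "a i j" "a j i"] by (simp add: power2_eq_square)
  qed
  also have "\<dots> = 3/2 * (\<Sum>i<m. \<Sum>j<m. (a i j)\<^sup>2 * v i * v j) +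
      1/2 * (\<Sum>i<m. \<Sum>j<m. (a j i)\<^sup>2 * v i * v j)"
    by (simp add: sum_distrib_left sum.distrib algebra_simps)
  also have "(\<Sum>i<m. \<Sum>j<m. (a j i)\<^sup>2 * v i * v j) = (\<Sum>i<m. \<Sum>j<m. (a i j)\<^sup>2 * v i * v j)"
    by (subst sum.swap) (simp add: mult_ac)
  finally show "expectation (\<lambda>\<omega>. (step_integral B m A a \<omega>)\<^sup>2) \<le>
      2 * (\<Sum>i<m. \<Sum>j<m. (a i j)\<^sup>2 * measure lborel (A i) * measure lborel (A j))"
    by (simp add: v_def)
qed

lemma step_integral_nn_bound:
  assumes S: "off_diagonal_step m A a"
  shows "(\<integral>\<^sup>+\<omega>. ennreal ((step_integral B m A a \<omega>)\<^sup>2) \<partial>M) \<le>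
    2 * (\<integral>\<^sup>+p. ennreal ((step_function m A a p)\<^sup>2) \<partial>(lborel \<Otimes>\<^sub>M lborel))"
proof -
  have "(\<integral>\<^sup>+\<omega>. ennreal ((step_integral B m A a \<omega>)\<^sup>2) \<partial>M) =
      ennreal (expectation (\<lambda>\<omega>. (step_integral B m A a \<omega>)\<^sup>2))"
    by (intro nn_integral_eq_integral step_integral_square[OF S]) simp
  also have "\<dots> \<le> ennreal (2 * (\<Sum>i<m. \<Sum>j<m. (a i j)\<^sup>2 * measure lborel (A i) * measure lborel (A j)))"
    by (intro ennreal_leI step_integral_square[OF S])
  finally show ?thesis
    unfolding step_square_nn_integral[OF S] by (simp add: ennreal_mult')
qed


end

section \<open>The double integral: step functions, linearity and an L2 bound\<close>

context white_noise
begin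

lemma double_integral_step:
  assumes S: "off_diagonal_step m A a"
  shows "is_double_wiener_ito_integral M B (step_function m A a) (step_integral B m A a)"
proof -
  have [measurable]: "step_function m A a \<in> borel_measurable (lborel \<Otimes>\<^sub>M lborel)"
    by (rule step_function_measurable[OF S])
  have "integrable (lborel \<Otimes>\<^sub>M lborel) (\<lambda>p. (step_function m A a p)\<^sup>2)"
    by (rule integrableI_nonneg) (simp_all add: step_square_nn_integral[OF S])
  then show ?thesis
    unfolding is_double_wiener_ito_integral_def
    using S step_integral_measurable[OF S] step_integral_square(1)[OF S]
    by (intro conjI exI[of _ "\<lambda>_. m"] exI[of _ "\<lambda>_. A"] exI[of _ "\<lambda>_. a"]) simp_all
qed

text \<open>The approximating step functions are combined termwise on common refinements; both
  errors are then controlled by those of \<open>f\<close> and \<open>g\<close> through the squared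
  triangle inequality.\<close>

lemma double_integral_combine:
  assumes f: "is_double_wiener_ito_integral M B f X" and g: "is_double_wiener_ito_integral M B g Y"
  shows "is_double_wiener_ito_integral M B (\<lambda>p. f p + c * g p) (\<lambda>\<omega>. X \<omega> + c * Y \<omega>)"
proof -
  let ?L = "lborel \<Otimes>\<^sub>M lborel :: (real \<times> real) measure"
  from f obtain m A a where S: "\<And>n. off_diagonal_step (m n) (A n) (a n)"
    and fl: "(\<lambda>n. \<integral>\<^sup>+ p. ennreal ((f p - step_function (m n) (A n) (a n) p)\<^sup>2) \<partial>?L) \<longlonglongrightarrow> 0"
    and Xl: "(\<lambda>n. \<integral>\<^sup>+ \<omega>. ennreal ((X \<omega> - step_integral B (m n) (A n) (a n) \<omega>)\<^sup>2) \<partial>M) \<longlonglongrightarrow> 0"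
    and [measurable]: "f \<in> borel_measurable ?L" "X \<in> borel_measurable M"
    and fi: "integrable ?L (\<lambda>p. (f p)\<^sup>2)" and Xi: "integrable M (\<lambda>\<omega>. (X \<omega>)\<^sup>2)"
    unfolding is_double_wiener_ito_integral_def by blast
  from g obtain m' A' a' where S': "\<And>n. off_diagonal_step (m' n) (A' n) (a' n)"
    and gl: "(\<lambda>n. \<integral>\<^sup>+ p. ennreal ((g p - step_function (m' n) (A' n) (a' n) p)\<^sup>2) \<partial>?L) \<longlonglongrightarrow> 0"
    and Yl: "(\<lambda>n. \<integral>\<^sup>+ \<omega>. ennreal ((Y \<omega> - step_integral B (m' n) (A' n) (a' n) \<omega>)\<^sup>2) \<partial>M) \<longlonglongrightarrow> 0"
    and [measurable]: "g \<in> borel_measurable ?L" "Y \<in> borel_measurable M"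
    and gi: "integrable ?L (\<lambda>p. (g p)\<^sup>2)" and Yi: "integrable M (\<lambda>\<omega>. (Y \<omega>)\<^sup>2)"
    unfolding is_double_wiener_ito_integral_def by blast
  have [measurable]: "step_function (m n) (A n) (a n) \<in> borel_measurable ?L"
    "step_function (m' n) (A' n) (a' n) \<in> borel_measurable ?L"
    "step_integral B (m n) (A n) (a n) \<in> borel_measurable M"
    "step_integral B (m' n) (A' n) (a' n) \<in> borel_measurable M" for n
    using S S' by (auto intro: step_function_measurable step_integral_measurable)
  have "\<exists>k C d. off_diagonal_step k C d \<and>
     (\<forall>p. step_function k C d p = step_function (m n) (A n) (a n) p + c * step_function (m' n) (A' n) (a' n) p) \<and>
     (AE \<omega> in M. step_integral B k C d \<omega> =
      step_integral B (m n) (A n) (a n) \<omega> + c * step_integral B (m' n) (A' n) (a' n) \<omega>)" for n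
    using step_combine[OF S[of n] S'[of n], of c] by metis
  \<comment> \<open>The three data of a refined step function are packed into one triple, so that a
    single use of choice yields the sequence.\<close>
  then have "\<forall>n. \<exists>T. off_diagonal_step (fst T) (fst (snd T)) (snd (snd T)) \<and>
     (\<forall>p. step_function (fst T) (fst (snd T)) (snd (snd T)) p =
       step_function (m n) (A n) (a n) p + c * step_function (m' n) (A' n) (a' n) p) \<and>
     (AE \<omega> in M. step_integral B (fst T) (fst (snd T)) (snd (snd T)) \<omega> =
      step_integral B (m n) (A n) (a n) \<omega> + c * step_integral B (m' n) (A' n) (a' n) \<omega>)"
    by simp
  from choice[OF this] obtain T where T': "\<And>n. off_diagonal_step (fst (T n)) (fst (snd (T n))) (snd (snd (T n))) \<and>
     (\<forall>p. step_function (fst (T n)) (fst (snd (T n))) (snd (snd (T n))) p =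
       step_function (m n) (A n) (a n) p + c * step_function (m' n) (A' n) (a' n) p) \<and>
     (AE \<omega> in M. step_integral B (fst (T n)) (fst (snd (T n))) (snd (snd (T n))) \<omega> =
      step_integral B (m n) (A n) (a n) \<omega> + c * step_integral B (m' n) (A' n) (a' n) \<omega>)"
    by blast
  define k where "k n = fst (T n)" for n
  define C where "C n = fst (snd (T n))" for n
  define d where "d n = snd (snd (T n))" for n
  have T: "off_diagonal_step (k n) (C n) (d n)"
    and Tf: "step_function (k n) (C n) (d n) p =
      step_function (m n) (A n) (a n) p + c * step_function (m' n) (A' n) (a' n) p"
    and Ti: "AE \<omega> in M. step_integral B (k n) (C n) (d n) \<omega> =
      step_integral B (m n) (A n) (a n) \<omega> + c * step_integral B (m' n) (A' n) (a' n) \<omega>" for n p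
    using T'[of n] unfolding k_def C_def d_def by blast+
  have null: "(\<lambda>n. 2 * x n + ennreal (2 * c\<^sup>2) * y n) \<longlonglongrightarrow> 0"
    if "x \<longlonglongrightarrow> 0" "y \<longlonglongrightarrow> 0" for x y :: "nat \<Rightarrow> ennreal"
  proof -
    have "(\<lambda>n. 2 * x n + ennreal (2 * c\<^sup>2) * y n) \<longlonglongrightarrow> 2 * 0 + ennreal (2 * c\<^sup>2) * 0"
      by (intro tendsto_add ennreal_tendsto_cmult that) auto
    then show ?thesis by simp
  qed
  have scale: "2 * (\<integral>\<^sup>+x. ennreal ((c * h x)\<^sup>2) \<partial>N) = ennreal (2 * c\<^sup>2) * (\<integral>\<^sup>+x. ennreal ((h x)\<^sup>2) \<partial>N)"
    if [measurable]: "h \<in> borel_measurable N" for h :: "'c \<Rightarrow> real" and N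
    by (simp add: power_mult_distrib ennreal_mult' nn_integral_cmult mult.assoc)
  have 1: "(\<lambda>n. \<integral>\<^sup>+ p. ennreal ((f p + c * g p - step_function (k n) (C n) (d n) p)\<^sup>2) \<partial>?L) \<longlonglongrightarrow> 0"
  proof (rule tendsto_sandwich[OF _ _ tendsto_const null[OF fl gl]])
    show "\<forall>\<^sub>F n in sequentially. (\<integral>\<^sup>+ p. ennreal ((f p + c * g p - step_function (k n) (C n) (d n) p)\<^sup>2) \<partial>?L) \<le>
      2 * (\<integral>\<^sup>+ p. ennreal ((f p - step_function (m n) (A n) (a n) p)\<^sup>2) \<partial>?L) +
      ennreal (2 * c\<^sup>2) * (\<integral>\<^sup>+ p. ennreal ((g p - step_function (m' n) (A' n) (a' n) p)\<^sup>2) \<partial>?L)"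
    proof (intro always_eventually allI)
      fix n
      have "(\<integral>\<^sup>+ p. ennreal ((f p + c * g p - step_function (k n) (C n) (d n) p)\<^sup>2) \<partial>?L) =
        (\<integral>\<^sup>+ p. ennreal (((f p - step_function (m n) (A n) (a n) p) +
           c * (g p - step_function (m' n) (A' n) (a' n) p))\<^sup>2) \<partial>?L)"
        by (simp add: Tf algebra_simps)
      also have "\<dots> \<le> 2 * (\<integral>\<^sup>+ p. ennreal ((f p - step_function (m n) (A n) (a n) p)\<^sup>2) \<partial>?L) +
        2 * (\<integral>\<^sup>+ p. ennreal ((c * (g p - step_function (m' n) (A' n) (a' n) p))\<^sup>2) \<partial>?L)"
        by (rule nn_integral_square_add_le) measurable
      finally show "(\<integral>\<^sup>+ p. ennreal ((f p + c * g p - step_function (k n) (C n) (d n) p)\<^sup>2) \<partial>?L) \<le>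
          2 * (\<integral>\<^sup>+ p. ennreal ((f p - step_function (m n) (A n) (a n) p)\<^sup>2) \<partial>?L) +
          ennreal (2 * c\<^sup>2) * (\<integral>\<^sup>+ p. ennreal ((g p - step_function (m' n) (A' n) (a' n) p)\<^sup>2) \<partial>?L)"
        by (simp add: scale)
    qed
  qed simp
  have 2: "(\<lambda>n. \<integral>\<^sup>+ \<omega>. ennreal ((X \<omega> + c * Y \<omega> - step_integral B (k n) (C n) (d n) \<omega>)\<^sup>2) \<partial>M) \<longlonglongrightarrow> 0"
  proof (rule tendsto_sandwich[OF _ _ tendsto_const null[OF Xl Yl]])
    show "\<forall>\<^sub>F n in sequentially. (\<integral>\<^sup>+ \<omega>. ennreal ((X \<omega> + c * Y \<omega> - step_integral B (k n) (C n) (d n) \<omega>)\<^sup>2) \<partial>M) \<le>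
      2 * (\<integral>\<^sup>+ \<omega>. ennreal ((X \<omega> - step_integral B (m n) (A n) (a n) \<omega>)\<^sup>2) \<partial>M) +
      ennreal (2 * c\<^sup>2) * (\<integral>\<^sup>+ \<omega>. ennreal ((Y \<omega> - step_integral B (m' n) (A' n) (a' n) \<omega>)\<^sup>2) \<partial>M)"
    proof (intro always_eventually allI)
      fix n
      have "(\<integral>\<^sup>+ \<omega>. ennreal ((X \<omega> + c * Y \<omega> - step_integral B (k n) (C n) (d n) \<omega>)\<^sup>2) \<partial>M) =
        (\<integral>\<^sup>+ \<omega>. ennreal (((X \<omega> - step_integral B (m n) (A n) (a n) \<omega>) +
           c * (Y \<omega> - step_integral B (m' n) (A' n) (a' n) \<omega>))\<^sup>2) \<partial>M)"
        using Ti[of n] by (intro nn_integral_cong_AE) (auto simp: algebra_simps)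
      also have "\<dots> \<le> 2 * (\<integral>\<^sup>+ \<omega>. ennreal ((X \<omega> - step_integral B (m n) (A n) (a n) \<omega>)\<^sup>2) \<partial>M) +
        2 * (\<integral>\<^sup>+ \<omega>. ennreal ((c * (Y \<omega> - step_integral B (m' n) (A' n) (a' n) \<omega>))\<^sup>2) \<partial>M)"
        by (rule nn_integral_square_add_le) measurable
      finally show "(\<integral>\<^sup>+ \<omega>. ennreal ((X \<omega> + c * Y \<omega> - step_integral B (k n) (C n) (d n) \<omega>)\<^sup>2) \<partial>M) \<le>
          2 * (\<integral>\<^sup>+ \<omega>. ennreal ((X \<omega> - step_integral B (m n) (A n) (a n) \<omega>)\<^sup>2) \<partial>M) +
          ennreal (2 * c\<^sup>2) * (\<integral>\<^sup>+ \<omega>. ennreal ((Y \<omega> - step_integral B (m' n) (A' n) (a' n) \<omega>)\<^sup>2) \<partial>M)"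
        by (simp add: scale)
    qed
  qed simp
  have int: "integrable N (\<lambda>x. (u x + c * w x)\<^sup>2)"
    if [measurable]: "u \<in> borel_measurable N" "w \<in> borel_measurable N"
      and "integrable N (\<lambda>x. (u x)\<^sup>2)" "integrable N (\<lambda>x. (w x)\<^sup>2)" for u w :: "'c \<Rightarrow> real" and N
  proof (rule Bochner_Integration.integrable_bound[where f = "\<lambda>x. 2 * (u x)\<^sup>2 + 2 * c\<^sup>2 * (w x)\<^sup>2"])
    show "integrable N (\<lambda>x. 2 * (u x)\<^sup>2 + 2 * c\<^sup>2 * (w x)\<^sup>2)"
      using that by simp
    show "AE x in N. norm ((u x + c * w x)\<^sup>2) \<le> norm (2 * (u x)\<^sup>2 + 2 * c\<^sup>2 * (w x)\<^sup>2)"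
    proof (intro always_eventually allI)
      fix x
      show "norm ((u x + c * w x)\<^sup>2) \<le> norm (2 * (u x)\<^sup>2 + 2 * c\<^sup>2 * (w x)\<^sup>2)"
      proof -
        have "(u x + c * w x)\<^sup>2 \<le> 2 * (u x)\<^sup>2 + 2 * c\<^sup>2 * (w x)\<^sup>2"
          using sum_squares_bound[of "u x" "c * w x"] by (simp add: power2_sum power_mult_distrib)
        then show ?thesis by simp
      qed
    qed
  qed measurable
  show ?thesis
    unfolding is_double_wiener_ito_integral_def
    using T 1 2 int[OF _ _ fi gi] int[OF _ _ Xi Yi]
    by (intro conjI exI[of _ k] exI[of _ C] exI[of _ d] allI) simp_all
qed

text \<open>The bound 2 for step integrals passes to the limit, and each of two squared triangle
  inequalities costs another factor 2, hence 8. The constant later enters only bounds of errors that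
  tend to zero.\<close>

lemma double_integral_bound:
  assumes f: "is_double_wiener_ito_integral M B f X"
  shows "(\<integral>\<^sup>+\<omega>. ennreal ((X \<omega>)\<^sup>2) \<partial>M) \<le> 8 * (\<integral>\<^sup>+p. ennreal ((f p)\<^sup>2) \<partial>(lborel \<Otimes>\<^sub>M lborel))"
proof -
  let ?L = "lborel \<Otimes>\<^sub>M lborel :: (real \<times> real) measure"
  from f obtain m A a where S: "\<And>n. off_diagonal_step (m n) (A n) (a n)"
    and fl: "(\<lambda>n. \<integral>\<^sup>+ p. ennreal ((f p - step_function (m n) (A n) (a n) p)\<^sup>2) \<partial>?L) \<longlonglongrightarrow> 0"
    and Xl: "(\<lambda>n. \<integral>\<^sup>+ \<omega>. ennreal ((X \<omega> - step_integral B (m n) (A n) (a n) \<omega>)\<^sup>2) \<partial>M) \<longlonglongrightarrow> 0"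
    and [measurable]: "f \<in> borel_measurable ?L" "X \<in> borel_measurable M"
    unfolding is_double_wiener_ito_integral_def by blast
  have [measurable]: "step_function (m n) (A n) (a n) \<in> borel_measurable ?L"
    "step_integral B (m n) (A n) (a n) \<in> borel_measurable M" for n
    using S by (auto intro: step_function_measurable step_integral_measurable)
  let ?e = "\<lambda>n. \<integral>\<^sup>+ p. ennreal ((f p - step_function (m n) (A n) (a n) p)\<^sup>2) \<partial>?L"
  let ?d = "\<lambda>n. \<integral>\<^sup>+ \<omega>. ennreal ((X \<omega> - step_integral B (m n) (A n) (a n) \<omega>)\<^sup>2) \<partial>M"
  let ?F = "\<integral>\<^sup>+p. ennreal ((f p)\<^sup>2) \<partial>?L"
  have bound: "(\<integral>\<^sup>+\<omega>. ennreal ((X \<omega>)\<^sup>2) \<partial>M) \<le> 2 * ?d n + 8 * ?e n + 8 * ?F" for n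
  proof -
    have "(\<integral>\<^sup>+\<omega>. ennreal ((X \<omega>)\<^sup>2) \<partial>M) = (\<integral>\<^sup>+\<omega>. ennreal (((X \<omega> - step_integral B (m n) (A n) (a n) \<omega>) +
        step_integral B (m n) (A n) (a n) \<omega>)\<^sup>2) \<partial>M)" by simp
    also have "\<dots> \<le> 2 * ?d n + 2 * (\<integral>\<^sup>+\<omega>. ennreal ((step_integral B (m n) (A n) (a n) \<omega>)\<^sup>2) \<partial>M)"
      by (rule nn_integral_square_add_le) measurable
    also have "\<dots> \<le> 2 * ?d n + 2 * (2 * (\<integral>\<^sup>+p. ennreal ((step_function (m n) (A n) (a n) p)\<^sup>2) \<partial>?L))"
      by (intro add_left_mono mult_left_mono step_integral_nn_bound S) simp
    also have "(\<integral>\<^sup>+p. ennreal ((step_function (m n) (A n) (a n) p)\<^sup>2) \<partial>?L) =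
        (\<integral>\<^sup>+p. ennreal (((step_function (m n) (A n) (a n) p - f p) + f p)\<^sup>2) \<partial>?L)" by simp
    also have "\<dots> \<le> 2 * (\<integral>\<^sup>+p. ennreal ((step_function (m n) (A n) (a n) p - f p)\<^sup>2) \<partial>?L) + 2 * ?F"
      by (rule nn_integral_square_add_le) measurable
    also have "(\<integral>\<^sup>+p. ennreal ((step_function (m n) (A n) (a n) p - f p)\<^sup>2) \<partial>?L) = ?e n"
      by (simp add: power2_commute)
    finally show ?thesis
      by (simp add: distrib_left mult.assoc[symmetric] add.assoc mult_left_mono add_left_mono)
  qed
  have "(\<lambda>n. 2 * ?d n + 8 * ?e n + 8 * ?F) \<longlonglongrightarrow> 2 * 0 + 8 * 0 + 8 * ?F"
    by (intro tendsto_add ennreal_tendsto_cmult fl Xl tendsto_const) auto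
  then have "(\<integral>\<^sup>+\<omega>. ennreal ((X \<omega>)\<^sup>2) \<partial>M) \<le> 2 * 0 + 8 * 0 + 8 * ?F"
    by (rule LIMSEQ_le_const) (use bound in auto)
  then show ?thesis by simp
qed

end

section \<open>Pairs of Gaussian variables\<close>

abbreviation std_gauss :: "real measure" where
  "std_gauss \<equiv> density lborel (\<lambda>x. ennreal (std_normal_density x))"

interpretation std_gauss: prob_space std_gauss
  by (rule prob_space_normal_density) simp

interpretation std_gauss_pair: pair_prob_space std_gauss std_gauss ..

interpretation std_gauss_product: product_prob_space "\<lambda>_. std_gauss" I for I ..

lemma nn_integral_std_gauss:
  "f \<in> borel_measurable borel \<Longrightarrow>
    (\<integral>\<^sup>+x. f x \<partial>std_gauss) = (\<integral>\<^sup>+x. ennreal (std_normal_density x) * f x \<partial>lborel)"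
  by (subst nn_integral_density) auto

text \<open>The rotation is carried out one coordinate at a time: \<open>u = c * x + s * y\<close>
  replaces \<open>x\<close> at fixed \<open>y\<close>, then \<open>y = s * u + c * v\<close>
  replaces \<open>y\<close> at fixed \<open>u\<close>. The Jacobians
  \<open>\<bar>1 / c\<bar>\<close> and \<open>\<bar>c\<bar>\<close> cancel, and the product of the
  two densities depends on the radius alone.\<close>

lemma std_gauss_rotation_aux:
  fixes h :: "real \<times> real \<Rightarrow> ennreal"
  assumes [measurable]: "h \<in> borel_measurable (borel \<Otimes>\<^sub>M borel)" and cs: "c\<^sup>2 + s\<^sup>2 = 1" and c: "c \<noteq> 0"
  shows "(\<integral>\<^sup>+x. \<integral>\<^sup>+y. h (c * x + s * y, c * y - s * x) \<partial>std_gauss \<partial>std_gauss) =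
    (\<integral>\<^sup>+x. \<integral>\<^sup>+y. h (x, y) \<partial>std_gauss \<partial>std_gauss)"
proof -
  let ?n = "\<lambda>x. ennreal (std_normal_density x)"
  have expand: "(\<integral>\<^sup>+x. \<integral>\<^sup>+y. k (x, y) \<partial>std_gauss \<partial>std_gauss) =
      (\<integral>\<^sup>+x. \<integral>\<^sup>+y. ?n x * ?n y * k (x, y) \<partial>lborel \<partial>lborel)"
    if [measurable]: "k \<in> borel_measurable (borel \<Otimes>\<^sub>M borel)" for k :: "real \<times> real \<Rightarrow> ennreal"
    by (simp add: nn_integral_std_gauss nn_integral_cmult[symmetric] mult.assoc)
  have "(\<integral>\<^sup>+x. \<integral>\<^sup>+y. h (c * x + s * y, c * y - s * x) \<partial>std_gauss \<partial>std_gauss) =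
      (\<integral>\<^sup>+x. \<integral>\<^sup>+y. ?n x * ?n y * h (c * x + s * y, c * y - s * x) \<partial>lborel \<partial>lborel)"
    using expand[of "\<lambda>(x, y). h (c * x + s * y, c * y - s * x)"] by simp
  also have "\<dots> = (\<integral>\<^sup>+y. \<integral>\<^sup>+x. ?n x * ?n y * h (c * x + s * y, c * y - s * x) \<partial>lborel \<partial>lborel)"
    by (rule lborel_pair.Fubini') measurable
  also have "\<dots> = (\<integral>\<^sup>+y. \<integral>\<^sup>+u. ennreal \<bar>1 / c\<bar> * (?n ((u - s * y) / c) * ?n y * h (u, (y - s * u) / c)) \<partial>lborel \<partial>lborel)"
  proof (rule nn_integral_cong)
    fix y :: real
    have eq: "(- s * y / c) + 1 / c * u = (u - s * y) / c" "c * ((u - s * y) / c) + s * y = u"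
      "c * y - s * ((u - s * y) / c) = (y - s * u) / c" for u
    proof -
      have y: "c\<^sup>2 * y + s\<^sup>2 * y = y" using cs by (simp flip: distrib_right)
      show "(- s * y / c) + 1 / c * u = (u - s * y) / c" "c * ((u - s * y) / c) + s * y = u"
        "c * y - s * ((u - s * y) / c) = (y - s * u) / c"
        using c y by (auto simp: field_simps power2_eq_square)
    qed
    have "(\<integral>\<^sup>+x. ?n x * ?n y * h (c * x + s * y, c * y - s * x) \<partial>lborel) =
      ennreal \<bar>1 / c\<bar> * (\<integral>\<^sup>+u. ?n ((- s * y / c) + 1 / c * u) * ?n y *
        h (c * ((- s * y / c) + 1 / c * u) + s * y, c * y - s * ((- s * y / c) + 1 / c * u)) \<partial>lborel)"
      using c by (intro nn_integral_real_affine) auto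
    also have "\<dots> = (\<integral>\<^sup>+u. ennreal \<bar>1 / c\<bar> * (?n ((u - s * y) / c) * ?n y * h (u, (y - s * u) / c)) \<partial>lborel)"
      unfolding eq by (rule nn_integral_cmult[symmetric]) measurable
    finally show "(\<integral>\<^sup>+x. ?n x * ?n y * h (c * x + s * y, c * y - s * x) \<partial>lborel) =
      (\<integral>\<^sup>+u. ennreal \<bar>1 / c\<bar> * (?n ((u - s * y) / c) * ?n y * h (u, (y - s * u) / c)) \<partial>lborel)" .
  qed
  also have "\<dots> = (\<integral>\<^sup>+u. \<integral>\<^sup>+y. ennreal \<bar>1 / c\<bar> * (?n ((u - s * y) / c) * ?n y * h (u, (y - s * u) / c)) \<partial>lborel \<partial>lborel)"
    by (rule lborel_pair.Fubini') measurable
  also have "\<dots> = (\<integral>\<^sup>+u. \<integral>\<^sup>+v. ?n u * ?n v * h (u, v) \<partial>lborel \<partial>lborel)"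
  proof (rule nn_integral_cong)
    fix u :: real
    have eq: "(u - s * (s * u + c * v)) / c = c * u - s * v" "(s * u + c * v - s * u) / c = v" for v
    proof -
      have u: "c\<^sup>2 * u + s\<^sup>2 * u = u" using cs by (simp flip: distrib_right)
      show "(u - s * (s * u + c * v)) / c = c * u - s * v" "(s * u + c * v - s * u) / c = v"
        using c u by (auto simp: field_simps power2_eq_square)
    qed
    have dens: "?n (c * u - s * v) * ?n (s * u + c * v) = ?n u * ?n v" for v
    proof -
      have "(c * u - s * v)\<^sup>2 + (s * u + c * v)\<^sup>2 = (c\<^sup>2 + s\<^sup>2) * (u\<^sup>2 + v\<^sup>2)"
        by (simp add: power2_eq_square algebra_simps)
      then have "- (c * u - s * v)\<^sup>2 / 2 + - (s * u + c * v)\<^sup>2 / 2 = - u\<^sup>2 / 2 + - v\<^sup>2 / 2"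
        using cs by simp
      then have "std_normal_density (c * u - s * v) * std_normal_density (s * u + c * v) =
          std_normal_density u * std_normal_density v"
        unfolding std_normal_density_def by (simp add: exp_add[symmetric])
      then show ?thesis
        by (simp add: ennreal_mult'[symmetric])
    qed
    have "(\<integral>\<^sup>+y. ennreal \<bar>1 / c\<bar> * (?n ((u - s * y) / c) * ?n y * h (u, (y - s * u) / c)) \<partial>lborel) =
      ennreal \<bar>c\<bar> * (\<integral>\<^sup>+v. ennreal \<bar>1 / c\<bar> * (?n ((u - s * (s * u + c * v)) / c) * ?n (s * u + c * v) *
         h (u, (s * u + c * v - s * u) / c)) \<partial>lborel)"
      using c by (intro nn_integral_real_affine) auto
    also have "\<dots> = (\<integral>\<^sup>+v. ennreal \<bar>c\<bar> * (ennreal \<bar>1 / c\<bar> * (?n u * ?n v * h (u, v))) \<partial>lborel)"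
      unfolding eq dens by (rule nn_integral_cmult[symmetric]) measurable
    also have "\<dots> = (\<integral>\<^sup>+v. ?n u * ?n v * h (u, v) \<partial>lborel)"
      using c by (simp add: mult.assoc[symmetric] ennreal_mult'[symmetric])
    finally show "(\<integral>\<^sup>+y. ennreal \<bar>1 / c\<bar> * (?n ((u - s * y) / c) * ?n y * h (u, (y - s * u) / c)) \<partial>lborel) =
      (\<integral>\<^sup>+v. ?n u * ?n v * h (u, v) \<partial>lborel)" .
  qed
  also have "\<dots> = (\<integral>\<^sup>+x. \<integral>\<^sup>+y. h (x, y) \<partial>std_gauss \<partial>std_gauss)"
    by (rule expand[symmetric]) measurable
  finally show ?thesis .
qed

lemma std_gauss_rotation:
  fixes h :: "real \<times> real \<Rightarrow> ennreal"
  assumes h[measurable]: "h \<in> borel_measurable (borel \<Otimes>\<^sub>M borel)" and cs: "c\<^sup>2 + s\<^sup>2 = 1"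
  shows "(\<integral>\<^sup>+x. \<integral>\<^sup>+y. h (c * x + s * y, c * y - s * x) \<partial>std_gauss \<partial>std_gauss) =
    (\<integral>\<^sup>+x. \<integral>\<^sup>+y. h (x, y) \<partial>std_gauss \<partial>std_gauss)"
proof (cases "c = 0")
  case False
  then show ?thesis by (rule std_gauss_rotation_aux[OF h cs])
next
  case True
  \<comment> \<open>a quarter turn is two eighths of a turn\<close>
  define r where "r = 1 / sqrt (2 :: real)"
  have s: "s\<^sup>2 = 1" using True cs by simp
  have r: "r\<^sup>2 = 1 / 2" "r \<noteq> 0" by (simp_all add: r_def power_divide)
  have cs': "r\<^sup>2 + (s * r)\<^sup>2 = 1" by (simp add: power_mult_distrib s r)
  have e: "r * (r * x + s * r * y) + s * r * (r * y - s * r * x) = s * y"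
    "r * (r * y - s * r * x) - s * r * (r * x + s * r * y) = - s * x" for x y
  proof -
    have "r * r = 1 / 2" "s * s = 1" using r s by (simp_all add: power2_eq_square)
    moreover have "r * (r * x + s * r * y) + s * r * (r * y - s * r * x) =
        (r * r) * x + 2 * (r * r) * s * y - (s * s) * (r * r) * x"
      "r * (r * y - s * r * x) - s * r * (r * x + s * r * y) =
        (r * r) * y - 2 * (r * r) * s * x - (s * s) * (r * r) * y"
      by (simp_all add: algebra_simps)
    ultimately show "r * (r * x + s * r * y) + s * r * (r * y - s * r * x) = s * y"
      "r * (r * y - s * r * x) - s * r * (r * x + s * r * y) = - s * x"
      by simp_all
  qed
  define g where "g = (\<lambda>(x, y). h (r * x + s * r * y, r * y - s * r * x))"
  have g[measurable]: "g \<in> borel_measurable (borel \<Otimes>\<^sub>M borel)"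
    unfolding g_def by measurable
  have "(\<integral>\<^sup>+x. \<integral>\<^sup>+y. h (c * x + s * y, c * y - s * x) \<partial>std_gauss \<partial>std_gauss) =
      (\<integral>\<^sup>+x. \<integral>\<^sup>+y. g (r * x + s * r * y, r * y - s * r * x) \<partial>std_gauss \<partial>std_gauss)"
    by (simp add: g_def e True)
  also have "\<dots> = (\<integral>\<^sup>+x. \<integral>\<^sup>+y. g (x, y) \<partial>std_gauss \<partial>std_gauss)"
    by (rule std_gauss_rotation_aux[OF g cs' r(2)])
  also have "\<dots> = (\<integral>\<^sup>+x. \<integral>\<^sup>+y. h (x, y) \<partial>std_gauss \<partial>std_gauss)"
    using std_gauss_rotation_aux[OF h cs' r(2)] by (simp add: g_def)
  finally show ?thesis .
qed

lemma polar_coordinates: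
  fixes a b :: real
  obtains c s where "c\<^sup>2 + s\<^sup>2 = 1" "c * sqrt (a\<^sup>2 + b\<^sup>2) = a" "s * sqrt (a\<^sup>2 + b\<^sup>2) = b"
proof (cases "a\<^sup>2 + b\<^sup>2 = 0")
  case True
  then have "a = 0" "b = 0" by (simp_all add: sum_power2_eq_zero_iff)
  then show ?thesis using that[of 1 0] by simp
next
  case False
  then have "0 < a\<^sup>2 + b\<^sup>2" by (simp add: order_less_le)
  then show ?thesis
    using that[of "a / sqrt (a\<^sup>2 + b\<^sup>2)" "b / sqrt (a\<^sup>2 + b\<^sup>2)"] False
    by (simp add: power_divide add_divide_distrib[symmetric])
qed

text \<open>The numbers \<alpha>, \<beta>, \<delta> form the triangular (Cholesky) factor of the
  covariance matrix of the two linear forms. In the induction a new coordinate leads to three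
  Gaussians, which two rotations reduce to two again. Degenerate covariances are covered, since
  \<open>polar_coordinates\<close> includes the zero vector.\<close>

lemma gauss_linear_pair:
  fixes p q :: "nat \<Rightarrow> real"
  shows "\<exists>\<alpha> \<beta> \<delta>. 0 \<le> \<alpha> \<and> 0 \<le> \<delta> \<and> \<alpha>\<^sup>2 = (\<Sum>k<m. (p k)\<^sup>2) \<and> \<alpha> * \<beta> = (\<Sum>k<m. p k * q k) \<and>
    \<beta>\<^sup>2 + \<delta>\<^sup>2 = (\<Sum>k<m. (q k)\<^sup>2) \<and>
    (\<forall>h \<in> borel_measurable (borel \<Otimes>\<^sub>M borel).
      (\<integral>\<^sup>+\<omega>. h (\<Sum>k<m. p k * \<omega> k, \<Sum>k<m. q k * \<omega> k) \<partial>PiM {..<m} (\<lambda>_. std_gauss)) =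
      (\<integral>\<^sup>+x. \<integral>\<^sup>+y. h (\<alpha> * x, \<beta> * x + \<delta> * y) \<partial>std_gauss \<partial>std_gauss))"
proof (induction m)
  case 0
  show ?case
    by (intro exI[of _ 0]) (simp add: PiM_empty nn_integral_count_space_finite std_gauss.emeasure_space_1[simplified])
next
  case (Suc m)
  then obtain \<alpha> \<beta> \<delta> where IH: "0 \<le> \<alpha>" "0 \<le> \<delta>" "\<alpha>\<^sup>2 = (\<Sum>k<m. (p k)\<^sup>2)"
    "\<alpha> * \<beta> = (\<Sum>k<m. p k * q k)" "\<beta>\<^sup>2 + \<delta>\<^sup>2 = (\<Sum>k<m. (q k)\<^sup>2)"
    and law: "\<And>h. h \<in> borel_measurable (borel \<Otimes>\<^sub>M borel) \<Longrightarrow>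
      (\<integral>\<^sup>+\<omega>. h (\<Sum>k<m. p k * \<omega> k, \<Sum>k<m. q k * \<omega> k) \<partial>PiM {..<m} (\<lambda>_. std_gauss)) =
      (\<integral>\<^sup>+x. \<integral>\<^sup>+y. h (\<alpha> * x, \<beta> * x + \<delta> * y) \<partial>std_gauss \<partial>std_gauss)"
    by blast
  \<comment> \<open>The first rotation turns the coefficients \<alpha> and \<open>p m\<close> of the
    first form into \<open>R\<close> and 0; \<open>\<beta>'\<close> and \<kappa> are the
    coefficients of the second form along and across the new direction.\<close>
  define R where "R = sqrt (\<alpha>\<^sup>2 + (p m)\<^sup>2)"
  obtain c s where cs: "c\<^sup>2 + s\<^sup>2 = 1" "c * R = \<alpha>" "s * R = p m"
    unfolding R_def by (rule polar_coordinates)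
  define \<beta>' where "\<beta>' = \<beta> * c + q m * s"
  define \<kappa> where "\<kappa> = q m * c - \<beta> * s"
  \<comment> \<open>The coefficients \<kappa> and \<delta> both belong to Gaussians that no longer
    occur in the first form, so a second rotation may merge them into \<open>R'\<close>.\<close>
  define R' where "R' = sqrt (\<kappa>\<^sup>2 + \<delta>\<^sup>2)"
  obtain c' s' where cs': "c'\<^sup>2 + s'\<^sup>2 = 1" "c' * R' = \<kappa>" "s' * R' = \<delta>"
    unfolding R'_def by (rule polar_coordinates)
  have "R\<^sup>2 = (\<Sum>k<Suc m. (p k)\<^sup>2)"
    using IH by (simp add: R_def sum_nonneg)
  moreover have "R * \<beta>' = (\<Sum>k<Suc m. p k * q k)"
  proof -
    have "R * \<beta>' = (c * R) * \<beta> + (s * R) * q m" by (simp add: \<beta>'_def algebra_simps)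
    then show ?thesis using cs IH by simp
  qed
  moreover have "\<beta>'\<^sup>2 + R'\<^sup>2 = (\<Sum>k<Suc m. (q k)\<^sup>2)"
  proof -
    have "\<beta>'\<^sup>2 + \<kappa>\<^sup>2 = (c\<^sup>2 + s\<^sup>2) * (\<beta>\<^sup>2 + (q m)\<^sup>2)"
      by (simp add: \<beta>'_def \<kappa>_def power2_eq_square algebra_simps)
    then have "\<beta>'\<^sup>2 + \<kappa>\<^sup>2 = \<beta>\<^sup>2 + (q m)\<^sup>2" using cs by simp
    moreover have "R'\<^sup>2 = \<kappa>\<^sup>2 + \<delta>\<^sup>2" by (simp add: R'_def)
    ultimately show ?thesis using IH by simp
  qed
  moreover have "(\<integral>\<^sup>+\<omega>. h (\<Sum>k<Suc m. p k * \<omega> k, \<Sum>k<Suc m. q k * \<omega> k) \<partial>PiM {..<Suc m} (\<lambda>_. std_gauss)) =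
      (\<integral>\<^sup>+x. \<integral>\<^sup>+y. h (R * x, \<beta>' * x + R' * y) \<partial>std_gauss \<partial>std_gauss)"
    if [measurable]: "h \<in> borel_measurable (borel \<Otimes>\<^sub>M borel)" for h
  proof -
    let ?h' = "\<lambda>(u, v). \<integral>\<^sup>+z. h (u + p m * z, v + q m * z) \<partial>std_gauss"
    have "(\<integral>\<^sup>+\<omega>. h (\<Sum>k<Suc m. p k * \<omega> k, \<Sum>k<Suc m. q k * \<omega> k) \<partial>PiM {..<Suc m} (\<lambda>_. std_gauss)) =
        (\<integral>\<^sup>+\<omega>. \<integral>\<^sup>+z. h (\<Sum>k<Suc m. p k * (fun_upd \<omega> m z) k, \<Sum>k<Suc m. q k * (fun_upd \<omega> m z) k) \<partial>std_gauss
          \<partial>PiM {..<m} (\<lambda>_. std_gauss))"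
      unfolding lessThan_Suc
      by (subst std_gauss_product.product_nn_integral_insert) (auto simp: lessThan_Suc[symmetric])
    also have "\<dots> = (\<integral>\<^sup>+\<omega>. ?h' (\<Sum>k<m. p k * \<omega> k, \<Sum>k<m. q k * \<omega> k) \<partial>PiM {..<m} (\<lambda>_. std_gauss))"
      by simp
    also have "\<dots> = (\<integral>\<^sup>+x. \<integral>\<^sup>+y. ?h' (\<alpha> * x, \<beta> * x + \<delta> * y) \<partial>std_gauss \<partial>std_gauss)"
      by (rule law) measurable
    also have "\<dots> = (\<integral>\<^sup>+x. \<integral>\<^sup>+z. \<integral>\<^sup>+y. h (\<alpha> * x + p m * z, \<beta> * x + \<delta> * y + q m * z) \<partial>std_gauss \<partial>std_gauss \<partial>std_gauss)"
    proof (rule nn_integral_cong)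
      fix x :: real
      show "(\<integral>\<^sup>+y. ?h' (\<alpha> * x, \<beta> * x + \<delta> * y) \<partial>std_gauss) =
          (\<integral>\<^sup>+z. \<integral>\<^sup>+y. h (\<alpha> * x + p m * z, \<beta> * x + \<delta> * y + q m * z) \<partial>std_gauss \<partial>std_gauss)"
        unfolding prod.case by (rule std_gauss_pair.Fubini') measurable
    qed
    also have "\<dots> = (\<integral>\<^sup>+x. \<integral>\<^sup>+z. (\<lambda>(x, z). \<integral>\<^sup>+y. h (R * x, \<beta>' * x + (\<kappa> * z + \<delta> * y)) \<partial>std_gauss)
        (c * x + s * z, c * z - s * x) \<partial>std_gauss \<partial>std_gauss)"
    proof (intro nn_integral_cong, unfold prod.case, intro nn_integral_cong)
      fix x y z :: real
      have 1: "R * (c * x + s * z) = \<alpha> * x + p m * z"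
        using cs by (simp add: algebra_simps flip: cs(2,3))
      have "\<beta>' * (c * x + s * z) + \<kappa> * (c * z - s * x) = (c\<^sup>2 + s\<^sup>2) * (\<beta> * x + q m * z)"
        by (simp add: \<beta>'_def \<kappa>_def power2_eq_square algebra_simps)
      then have 2: "\<beta>' * (c * x + s * z) + (\<kappa> * (c * z - s * x) + \<delta> * y) = \<beta> * x + \<delta> * y + q m * z"
        using cs by simp
      show "h (\<alpha> * x + p m * z, \<beta> * x + \<delta> * y + q m * z) =
        h (R * (c * x + s * z), \<beta>' * (c * x + s * z) + (\<kappa> * (c * z - s * x) + \<delta> * y))"
        unfolding 1 2 ..
    qed
    also have "\<dots> = (\<integral>\<^sup>+x. \<integral>\<^sup>+z. \<integral>\<^sup>+y. h (R * x, \<beta>' * x + (\<kappa> * z + \<delta> * y)) \<partial>std_gauss \<partial>std_gauss \<partial>std_gauss)"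
      by (subst std_gauss_rotation[OF _ cs(1)]) (simp_all, measurable)
    also have "\<dots> = (\<integral>\<^sup>+x. \<integral>\<^sup>+y. h (R * x, \<beta>' * x + R' * y) \<partial>std_gauss \<partial>std_gauss)"
    proof (rule nn_integral_cong)
      fix x :: real
      let ?g = "\<lambda>(z, y :: real). h (R * x, \<beta>' * x + R' * z)"
      have "(\<integral>\<^sup>+z. \<integral>\<^sup>+y. h (R * x, \<beta>' * x + (\<kappa> * z + \<delta> * y)) \<partial>std_gauss \<partial>std_gauss) =
          (\<integral>\<^sup>+z. \<integral>\<^sup>+y. ?g (c' * z + s' * y, c' * y - s' * z) \<partial>std_gauss \<partial>std_gauss)"
        by (intro nn_integral_cong) (simp add: algebra_simps flip: cs'(2,3))
      also have "\<dots> = (\<integral>\<^sup>+z. \<integral>\<^sup>+y. ?g (z, y) \<partial>std_gauss \<partial>std_gauss)"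
        by (rule std_gauss_rotation[OF _ cs'(1)]) measurable
      also have "\<dots> = (\<integral>\<^sup>+z. h (R * x, \<beta>' * x + R' * z) \<partial>std_gauss)"
        by (simp add: std_gauss.emeasure_space_1[simplified])
      finally show "(\<integral>\<^sup>+z. \<integral>\<^sup>+y. h (R * x, \<beta>' * x + (\<kappa> * z + \<delta> * y)) \<partial>std_gauss \<partial>std_gauss) =
        (\<integral>\<^sup>+y. h (R * x, \<beta>' * x + R' * y) \<partial>std_gauss)" .
    qed
    finally show ?thesis .
  qed
  moreover have "0 \<le> R" "0 \<le> R'" by (simp_all add: R_def R'_def)
  ultimately show ?case
    by (intro exI[of _ R] exI[of _ \<beta>'] exI[of _ R']) blast
qed

text \<open>In the triangular representation the product is
  \<open>\<alpha> * \<beta> * x^2 + \<alpha> * \<delta> * x * y\<close>. Here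
  \<open>\<alpha> * \<beta>\<close> is the covariance and \<open>\<alpha> * \<delta>\<close> the
  root of the determinant of the covariance matrix.\<close>

lemma gauss_product_law:
  fixes p q :: "nat \<Rightarrow> real" and m :: nat
  assumes [measurable]: "h \<in> borel_measurable borel"
  defines "\<kappa> \<equiv> \<Sum>k<m. p k * q k"
  defines "\<mu> \<equiv> sqrt ((\<Sum>k<m. (p k)\<^sup>2) * (\<Sum>k<m. (q k)\<^sup>2) - \<kappa>\<^sup>2)"
  shows "(\<integral>\<^sup>+\<omega>. h ((\<Sum>k<m. p k * \<omega> k) * (\<Sum>k<m. q k * \<omega> k)) \<partial>PiM {..<m} (\<lambda>_. std_gauss)) =
    (\<integral>\<^sup>+x. \<integral>\<^sup>+y. h (\<kappa> * x\<^sup>2 + \<mu> * x * y) \<partial>std_gauss \<partial>std_gauss)"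
proof -
  obtain \<alpha> \<beta> \<delta> where *: "0 \<le> \<alpha>" "0 \<le> \<delta>" "\<alpha>\<^sup>2 = (\<Sum>k<m. (p k)\<^sup>2)"
    "\<alpha> * \<beta> = \<kappa>" "\<beta>\<^sup>2 + \<delta>\<^sup>2 = (\<Sum>k<m. (q k)\<^sup>2)"
    and law: "\<And>h. h \<in> borel_measurable (borel \<Otimes>\<^sub>M borel) \<Longrightarrow>
      (\<integral>\<^sup>+\<omega>. h (\<Sum>k<m. p k * \<omega> k, \<Sum>k<m. q k * \<omega> k) \<partial>PiM {..<m} (\<lambda>_. std_gauss)) =
      (\<integral>\<^sup>+x. \<integral>\<^sup>+y. h (\<alpha> * x, \<beta> * x + \<delta> * y) \<partial>std_gauss \<partial>std_gauss)"
    using gauss_linear_pair[of p m q] unfolding \<kappa>_def by blast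
  have "(\<Sum>k<m. (p k)\<^sup>2) * (\<Sum>k<m. (q k)\<^sup>2) - \<kappa>\<^sup>2 = (\<alpha> * \<delta>)\<^sup>2"
    by (simp add: *(3)[symmetric] *(4)[symmetric] *(5)[symmetric] power_mult_distrib algebra_simps)
  then have \<mu>: "\<mu> = \<alpha> * \<delta>"
    using * by (simp add: \<mu>_def)
  have "(\<integral>\<^sup>+\<omega>. h ((\<Sum>k<m. p k * \<omega> k) * (\<Sum>k<m. q k * \<omega> k)) \<partial>PiM {..<m} (\<lambda>_. std_gauss)) =
      (\<integral>\<^sup>+x. \<integral>\<^sup>+y. h (\<alpha> * x * (\<beta> * x + \<delta> * y)) \<partial>std_gauss \<partial>std_gauss)"
    using law[of "\<lambda>(u, v). h (u * v)"] by simp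
  then show ?thesis
    by (simp add: \<mu> *(4)[symmetric] algebra_simps power2_eq_square)
qed

section \<open>Increments of the kernel\<close>

text \<open>The fourth power of this function dominates the differences
  \<open>(u - x)\<^sub>+\<^sup>\<gamma> - (-x)\<^sup>\<gamma> 1\<^bsub>x < -1\<^esub>\<close> for all exponents \<open>\<gamma>\<close> near \<open>-1/2\<close> and all
  \<open>u \<in> [0, 1]\<close>. The exponents are such that both the fourth and the seventh power are integrable.\<close>

definition kernel_majorant :: "real \<Rightarrow> real" where
  "kernel_majorant y = (if y \<le> 0 then 0 else if y \<le> 2 then 2 * y powr (-2/15) else 2 * y powr (-3/8))"

text \<open>The cut at -1 rather than 0 removes the singularity and leaves a square integrable
  function for every \<open>g < -1/2\<close>, with the explicit squared norm
  \<open>1 / (-2 * g - 1)\<close>. What is lost between -1 and 0 goes to the majorant.\<close>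

definition power_tail :: "real \<Rightarrow> real \<Rightarrow> real" where
  "power_tail g x = (if x < -1 then (- x) powr g else 0)"

lemma kernel_majorant_nonneg: "0 \<le> kernel_majorant y"
  by (simp add: kernel_majorant_def)

lemma kernel_majorant_measurable [measurable]: "kernel_majorant \<in> borel_measurable borel"
  unfolding kernel_majorant_def by measurable

lemma power_tail_measurable [measurable]: "power_tail g \<in> borel_measurable borel"
  unfolding power_tail_def by measurable

lemma power_tail_nonneg: "0 \<le> power_tail g x"
  by (simp add: power_tail_def)

text \<open>The two conditions are integrability at zero, \<open>2 * n / 15 < 1\<close>, and at
  infinity, \<open>3 * n / 8 > 1\<close>; they admit \<open>n\<close> from 3 to 7.\<close>

lemma nn_integral_kernel_majorant_power:
  assumes n: "2 * n < 15" "8 < 3 * n"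
  shows "(\<integral>\<^sup>+y. ennreal (kernel_majorant y ^ n) \<partial>lborel) < \<infinity>"
proof -
  define e1 where "e1 = - (2/15) * real n"
  define e2 where "e2 = - (3/8) * real n"
  have e1: "-1 < e1" and e2: "e2 < -1"
    using n by (simp_all add: e1_def e2_def field_simps)
  have "(\<integral>\<^sup>+y. ennreal (kernel_majorant y ^ n) \<partial>lborel) \<le>
      (\<integral>\<^sup>+y. ennreal (2 ^ n) * (ennreal (y powr e1) * indicator {0..2} y) +
        ennreal (2 ^ n) * (ennreal (y powr e2) * indicator {2..} y) \<partial>lborel)"
  proof (intro nn_integral_mono)
    fix y :: real
    have "(y powr (-2/15)) ^ n = y powr e1" "(y powr (-3/8)) ^ n = y powr e2" if "0 < y"
      using that by (simp_all add: e1_def e2_def powr_realpow[symmetric] powr_powr)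
    then show "ennreal (kernel_majorant y ^ n) \<le>
        ennreal (2 ^ n) * (ennreal (y powr e1) * indicator {0..2} y) +
        ennreal (2 ^ n) * (ennreal (y powr e2) * indicator {2..} y)"
      using n by (cases "y \<le> 0"; cases "y \<le> 2")
        (simp_all add: kernel_majorant_def power_mult_distrib ennreal_mult' zero_power)
  qed
  also have "\<dots> = ennreal (2 ^ n) * (\<integral>\<^sup>+y. ennreal (y powr e1) * indicator {0..2} y \<partial>lborel) +
        ennreal (2 ^ n) * (\<integral>\<^sup>+y. ennreal (y powr e2) * indicator {2..} y \<partial>lborel)"
    by (simp add: nn_integral_add nn_integral_cmult)
  also have "\<dots> = ennreal (2 ^ n) * ennreal (2 powr (e1 + 1) / (e1 + 1)) +
      ennreal (2 ^ n) * ennreal (- (2 powr (e2 + 1)) / (e2 + 1))"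
    using nn_integral_has_integral_lebesgue'[OF _ has_integral_powr_from_0[OF e1, of 2]]
      nn_integral_has_integral_lebesgue'[OF _ has_integral_powr_to_inf[OF e2, of 2]] by simp
  also have "\<dots> < \<infinity>"
    by (simp add: ennreal_mult_less_top)
  finally show ?thesis .
qed

text \<open>Reflection and translation reduce every integral to one over the line, so a single
  constant serves all \<open>t\<close> and \<open>x\<close>. The normalization
  \<open>1 \<le> C\<close> later gives \<open>t - s \<le> sqrt (C * (t - s))\<close> on intervals of
  length at most 1.\<close>

lemma kernel_majorant_powers_bounded:
  obtains C where "1 \<le> C"
    "\<And>t. (\<integral>\<^sup>+x. ennreal (kernel_majorant (t - x) ^ 4) \<partial>lborel) \<le> ennreal C"
    "\<And>t. (\<integral>\<^sup>+x. ennreal (kernel_majorant (t - x) ^ 7) \<partial>lborel) \<le> ennreal C"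
    "\<And>x. (\<integral>\<^sup>+t. ennreal (kernel_majorant (t - x) ^ 4) \<partial>lborel) \<le> ennreal C"
proof -
  let ?I = "\<lambda>n. \<integral>\<^sup>+y. ennreal (kernel_majorant y ^ n) \<partial>lborel"
  define C where "C = max 1 (max (enn2real (?I 4)) (enn2real (?I 7)))"
  have "?I 4 < \<top>" "?I 7 < \<top>"
    using nn_integral_kernel_majorant_power[of 4] nn_integral_kernel_majorant_power[of 7] by simp_all
  then have I: "?I 4 \<le> ennreal C" "?I 7 \<le> ennreal C"
    by (metis C_def ennreal_enn2real ennreal_leI max.cobounded1 max.cobounded2 max.coboundedI2)+
  have refl: "(\<integral>\<^sup>+x. ennreal (kernel_majorant (t - x) ^ n) \<partial>lborel) = ?I n" for t n
    using nn_integral_real_affine[of "\<lambda>y. ennreal (kernel_majorant y ^ n)" "-1" t] by simp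
  have trans: "(\<integral>\<^sup>+t. ennreal (kernel_majorant (t - x) ^ n) \<partial>lborel) = ?I n" for x n
    using nn_integral_real_affine[of "\<lambda>y. ennreal (kernel_majorant y ^ n)" 1 "-x"] by simp
  show ?thesis
  proof (rule that[of C])
    show "1 \<le> C" by (simp add: C_def)
  qed (simp_all add: refl trans I)
qed

text \<open>There are three regions. To the right of \<open>u\<close> both terms vanish. To the left
  of -1 the mean value theorem gains one power and leaves at most \<open>(- x) powr (-3/2)\<close>,
  where \<open>- x\<close> is at least half of \<open>u - x\<close>. In between only
  \<open>(u - x) powr g\<close> is present, at an argument of at most 2 and with a singularity no
  worse than the exponent -8/15. The factor 16, the fourth power of the 2 in the majorant, absorbs
  the powers of 2 that arise.\<close>

lemma power_difference_bound:
  assumes g: "-8/15 \<le> g" "g < -1/2" and u: "0 \<le> u" "u \<le> 1"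
  shows "\<bar>pos_powr (u - x) g - power_tail g x\<bar> \<le> kernel_majorant (u - x) ^ 4"
proof -
  have Q4: "kernel_majorant y ^ 4 = (if y \<le> 2 then 16 * y powr (-8/15) else 16 * y powr (-3/2))"
    if "0 < y" for y
  proof -
    have "(y powr e) ^ 4 = y powr (e * 4)" for e
      using powr_powr[of y e 4] that by simp
    from this[of "-2/15"] this[of "-3/8"] show ?thesis
      using that by (simp add: kernel_majorant_def power_mult_distrib)
  qed
  have two_powr: "1 / 16 \<le> 2 powr e" if "-4 \<le> e" for e :: real
  proof -
    have "1 / 16 = 2 powr (-4 :: real)"
      by (simp add: powr_minus powr_numeral)
    also have "\<dots> \<le> 2 powr e" using that by (intro powr_mono) auto
    finally show ?thesis .
  qed
  consider "u \<le> x" | "x < -1" | "-1 \<le> x" "x < u" by linarith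
  then show ?thesis
  proof cases
    case 1
    then have "pos_powr (u - x) g = 0" "power_tail g x = 0"
      using u by (auto simp: pos_powr_def power_tail_def)
    then show ?thesis by (simp add: kernel_majorant_nonneg)
  next
    case 2
    define w where "w = - x"
    define y where "y = u - x"
    have w: "1 < w" "y = w + u" "1 < y" "y \<le> 2 * w" using 2 u by (auto simp: w_def y_def)
    \<comment> \<open>Weak inequalities for \<open>z\<close> let the degenerate case
      \<open>u = 0\<close>, where both powers agree, take the same route.\<close>
    have "\<exists>z. w \<le> z \<and> z \<le> y \<and> y powr g - w powr g = (y - w) * (g * z powr (g - 1))"
    proof (cases "u = 0")
      case True
      then show ?thesis using w by (intro exI[of _ w]) simp
    next
      case False
      then have "w < y" using w u by simp
      have "\<exists>z. w < z \<and> z < y \<and> y powr g - w powr g = (y - w) * (g * z powr (g - 1))"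
        using \<open>w < y\<close> by (rule MVT2) (use w in \<open>auto intro: has_real_derivative_powr\<close>)
      then show ?thesis by (auto intro: less_imp_le)
    qed
    then obtain z where z: "w \<le> z" "z \<le> y" "y powr g - w powr g = (y - w) * (g * z powr (g - 1))"
      by blast
    have "\<bar>y powr g - w powr g\<bar> = \<bar>u\<bar> * (\<bar>g\<bar> * \<bar>z powr (g - 1)\<bar>)"
      using w(2) unfolding z(3) by (simp only: abs_mult add_diff_cancel_left')
    also have "\<dots> = u * (\<bar>g\<bar> * z powr (g - 1))"
      using u by (simp only: abs_of_nonneg powr_ge_zero)
    also have "\<dots> \<le> 1 * (1 * z powr (g - 1))"
      using u g by (intro mult_mono mult_nonneg_nonneg powr_ge_zero abs_ge_zero) auto
    also have "\<dots> \<le> w powr (g - 1)"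
      using z w g by (simp add: powr_mono2')
    also have "\<dots> \<le> w powr (-3/2)"
      using w g by (intro powr_mono) auto
    also have "\<dots> \<le> (y / 2) powr (-3/2)"
      using w by (intro powr_mono2') auto
    also have "\<dots> = y powr (-3/2) / 2 powr (-3/2)"
      by (rule powr_divide)
    also have "\<dots> \<le> y powr (-3/2) / (1 / 16)"
      using two_powr[of "-3/2"] by (intro divide_left_mono) auto
    also have "\<dots> = 16 * y powr (-3/2)"
      by simp
    also have "\<dots> \<le> kernel_majorant y ^ 4"
    proof -
      have "y powr (-3/2) \<le> y powr (-8/15)" using w by (intro powr_mono) auto
      then show ?thesis using w Q4[of y] by simp
    qed
    finally show ?thesis
      using 2 w by (simp add: pos_powr_def power_tail_def w_def y_def)
  next
    case 3
    define y where "y = u - x"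
    have y: "0 < y" "y \<le> 2" using 3 u by (auto simp: y_def)
    have "y powr g \<le> 16 * y powr (-8/15)"
    proof (cases "y \<le> 1")
      case True
      then have "y powr g \<le> y powr (-8/15)"
        using y g by (intro powr_mono') auto
      also have "\<dots> \<le> 16 * y powr (-8/15)" by simp
      finally show ?thesis .
    next
      case False
      then have "y powr g \<le> y powr 0"
        using y g by (intro powr_mono) auto
      also have "\<dots> \<le> 16 * 2 powr (-8/15)"
        using two_powr[of "-8/15"] y by simp
      also have "\<dots> \<le> 16 * y powr (-8/15)"
        using y by (intro mult_left_mono powr_mono2') auto
      finally show ?thesis .
    qed
    then show ?thesis
      using 3 y Q4[of y] by (simp add: pos_powr_def power_tail_def y_def)
  qed
qed

section \<open>Time integrals of the majorant and their square integrals\<close>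

lemma ennreal_square_sum3_le:
  fixes a b c :: ennreal
  shows "(a + b + c)\<^sup>2 \<le> 3 * (a\<^sup>2 + b\<^sup>2 + c\<^sup>2)"
proof (cases a; cases b; cases c)
  fix x y z :: real
  assume *: "0 \<le> x" "a = ennreal x" "0 \<le> y" "b = ennreal y" "0 \<le> z" "c = ennreal z"
  have "(x + y + z)\<^sup>2 \<le> 3 * (x\<^sup>2 + y\<^sup>2 + z\<^sup>2)"
    using sum_squares_bound[of x y] sum_squares_bound[of x z] sum_squares_bound[of y z]
    by (simp add: power2_eq_square algebra_simps)
  then have "ennreal ((x + y + z)\<^sup>2) \<le> ennreal (3 * (x\<^sup>2 + y\<^sup>2 + z\<^sup>2))"
    by (rule ennreal_leI)
  moreover have "(a + b + c)\<^sup>2 = ennreal ((x + y + z)\<^sup>2)"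
    using * by (simp add: ennreal_power[symmetric])
  moreover have "3 * (a\<^sup>2 + b\<^sup>2 + c\<^sup>2) = ennreal (3 * (x\<^sup>2 + y\<^sup>2 + z\<^sup>2))"
    unfolding * using *(1,3,5) by (simp add: ennreal_mult' ennreal_power)
  ultimately show ?thesis by simp
qed (simp_all add: power2_eq_square ennreal_mult_top ennreal_top_mult)

text \<open>Expanding a product of two perturbed powers gives terms with one error factor,
  accumulated over time here, and a term with two, accumulated in
  \<open>majorant_integral2\<close>.\<close>

definition majorant_integral :: "real \<Rightarrow> real \<Rightarrow> real \<Rightarrow> ennreal" where
  "majorant_integral s t x =
    (\<integral>\<^sup>+u. ennreal (kernel_majorant (u - x) ^ 4) * indicator {s..t} u \<partial>lborel)"

definition majorant_integral2 :: "real \<Rightarrow> real \<Rightarrow> real \<Rightarrow> real \<Rightarrow> ennreal" where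
  "majorant_integral2 s t x y =
    (\<integral>\<^sup>+u. ennreal (kernel_majorant (u - x) ^ 4 * kernel_majorant (u - y) ^ 4) * indicator {s..t} u \<partial>lborel)"

lemma majorant_integral_measurable [measurable]:
  "majorant_integral s t \<in> borel_measurable borel"
  "(\<lambda>p. majorant_integral2 s t (fst p) (snd p)) \<in> borel_measurable (borel \<Otimes>\<^sub>M borel)"
  unfolding majorant_integral_def majorant_integral2_def by measurable

text \<open>An unweighted Cauchy-Schwarz step would put the eighth power of the majorant under the
  integral, with the non-integrable exponent -16/15 at zero. The weighted one splits off a single
  factor, whose time integral is of order \<open>sqrt (t - s)\<close> uniformly in the positions;
  the other seven are integrated over the positions first and yield \<open>t - s\<close>.\<close>

lemma majorant_integral_square_bounds:
  obtains C where "1 \<le> C"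
    "\<And>s t. 0 \<le> s \<Longrightarrow> s \<le> t \<Longrightarrow> t \<le> 1 \<Longrightarrow>
      (\<integral>\<^sup>+x. (majorant_integral s t x)\<^sup>2 \<partial>lborel) \<le> ennreal (C * ((t - s) * sqrt (t - s)))"
    "\<And>s t. 0 \<le> s \<Longrightarrow> s \<le> t \<Longrightarrow> t \<le> 1 \<Longrightarrow>
      (\<integral>\<^sup>+x. \<integral>\<^sup>+y. (majorant_integral2 s t x y)\<^sup>2 \<partial>lborel \<partial>lborel) \<le> ennreal (C * ((t - s) * sqrt (t - s)))"
    "\<And>x. majorant_integral 0 1 x < \<infinity>"
proof -
  obtain C where C: "1 \<le> C"
    "\<And>t. (\<integral>\<^sup>+x. ennreal (kernel_majorant (t - x) ^ 4) \<partial>lborel) \<le> ennreal C"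
    "\<And>t. (\<integral>\<^sup>+x. ennreal (kernel_majorant (t - x) ^ 7) \<partial>lborel) \<le> ennreal C"
    "\<And>x. (\<integral>\<^sup>+t. ennreal (kernel_majorant (t - x) ^ 4) \<partial>lborel) \<le> ennreal C"
    using kernel_majorant_powers_bounded by blast
  let ?Q = kernel_majorant
  let ?r = "\<lambda>s t. sqrt (C * (t - s))"
  have sq_of: "x\<^sup>2 \<le> ennreal (c\<^sup>2) \<Longrightarrow> x \<le> ennreal c" if "0 \<le> c" for x :: ennreal and c :: real
    using that by (cases x) (auto simp: ennreal_power power2_le_iff_abs_le abs_le_iff top_power_ennreal top_unique)
  \<comment> \<open>For the square of the majorant Cauchy-Schwarz against the constant 1 is
    affordable, because the fourth power is integrable.\<close>
  have Q2: "(\<integral>\<^sup>+u. ennreal (?Q (u - x) ^ 2) * indicator {s..t} u \<partial>lborel) \<le> ennreal (?r s t)"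
    if "s \<le> t" for s t x
  proof (rule sq_of)
    have "(\<integral>\<^sup>+u. ennreal (?Q (u - x) ^ 2) * indicator {s..t} u \<partial>lborel)\<^sup>2 \<le>
      (\<integral>\<^sup>+u. (ennreal (?Q (u - x) ^ 2))\<^sup>2 \<partial>lborel) * (\<integral>\<^sup>+u. (indicator {s..t} u)\<^sup>2 \<partial>lborel)"
      by (rule Cauchy_Schwarz_nn_integral) measurable
    also have "(\<integral>\<^sup>+u. (ennreal (?Q (u - x) ^ 2))\<^sup>2 \<partial>lborel) = (\<integral>\<^sup>+u. ennreal (?Q (u - x) ^ 4) \<partial>lborel)"
      by (simp add: ennreal_power power_mult[symmetric])
    also have "(\<integral>\<^sup>+u. (indicator {s..t} u)\<^sup>2 \<partial>lborel) = ennreal (t - s)"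
      using that by (subst nn_integral_cong[where v = "indicator {s..t}"]) (auto simp: indicator_def)
    also have "(\<integral>\<^sup>+u. ennreal (?Q (u - x) ^ 4) \<partial>lborel) * ennreal (t - s) \<le> ennreal C * ennreal (t - s)"
      by (intro mult_right_mono C) simp
    also have "\<dots> = ennreal ((?r s t)\<^sup>2)"
      using that C by (simp add: ennreal_mult')
    finally show "(\<integral>\<^sup>+u. ennreal (?Q (u - x) ^ 2) * indicator {s..t} u \<partial>lborel)\<^sup>2 \<le> ennreal ((?r s t)\<^sup>2)" .
  qed (use that C in simp)
  \<comment> \<open>The inequality of arithmetic and geometric means reduces a product of two
    factors to integrals of squares, and the half-sum preserves the bound. With one factor equal to
    1 this covers a single majorant as well.\<close>
  have Q11: "(\<integral>\<^sup>+u. ennreal (f u) * indicator {s..t} u \<partial>lborel) \<le> ennreal (?r s t)"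
    if st: "0 \<le> s" "s \<le> t" "t \<le> 1" and [measurable]: "g \<in> borel_measurable borel" "h \<in> borel_measurable borel"
      and f: "\<And>u. f u = g u * h u" and gh: "\<And>u. 0 \<le> g u" "\<And>u. 0 \<le> h u"
      and gi: "(\<integral>\<^sup>+u. ennreal (g u ^ 2) * indicator {s..t} u \<partial>lborel) \<le> ennreal (?r s t)"
      and hi: "(\<integral>\<^sup>+u. ennreal (h u ^ 2) * indicator {s..t} u \<partial>lborel) \<le> ennreal (?r s t)"
    for s t and f g h :: "real \<Rightarrow> real"
  proof -
    define k :: real where "k = 1 / 2"
    have k: "0 \<le> k" "k + k = 1" by (simp_all add: k_def)
    have "(\<integral>\<^sup>+u. ennreal (f u) * indicator {s..t} u \<partial>lborel) \<le>
      (\<integral>\<^sup>+u. ennreal (k) * (ennreal (g u ^ 2) * indicator {s..t} u) +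
        ennreal (k) * (ennreal (h u ^ 2) * indicator {s..t} u) \<partial>lborel)"
    proof (intro nn_integral_mono)
      fix u
      have "f u \<le> k * g u ^ 2 + k * h u ^ 2"
        using sum_squares_bound[of "g u" "h u"] by (simp add: f k_def)
      then have "ennreal (f u) \<le> ennreal (k * g u ^ 2 + k * h u ^ 2)"
        by (rule ennreal_leI)
      then show "ennreal (f u) * indicator {s..t} u \<le>
          ennreal (k) * (ennreal (g u ^ 2) * indicator {s..t} u) +
          ennreal (k) * (ennreal (h u ^ 2) * indicator {s..t} u)"
        by (auto simp: indicator_def ennreal_plus[symmetric] ennreal_mult'[symmetric] k(1) simp del: ennreal_plus)
    qed
    also have "\<dots> = ennreal (k) * (\<integral>\<^sup>+u. ennreal (g u ^ 2) * indicator {s..t} u \<partial>lborel) +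
        ennreal (k) * (\<integral>\<^sup>+u. ennreal (h u ^ 2) * indicator {s..t} u \<partial>lborel)"
      by (simp add: nn_integral_add nn_integral_cmult)
    also have "\<dots> \<le> ennreal (k) * ennreal (?r s t) + ennreal (k) * ennreal (?r s t)"
      using gi hi by (intro add_mono mult_left_mono) auto
    also have "\<dots> = ennreal (?r s t)"
      using st C k by (simp add: ennreal_plus[symmetric] ennreal_mult'[symmetric] distrib_right[symmetric] del: ennreal_plus)
    finally show ?thesis .
  qed
  \<comment> \<open>The constant 1 as second factor: here \<open>t - s \<le> 1 \<le> C\<close>
    enters.\<close>
  have one: "(\<integral>\<^sup>+u. ennreal (1 ^ 2) * indicator {s..t} u \<partial>lborel) \<le> ennreal (?r s t)"
    if st: "0 \<le> s" "s \<le> t" "t \<le> 1" for s t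
  proof -
    have "(t - s)\<^sup>2 \<le> 1 * (t - s)"
      using st unfolding power2_eq_square by (intro mult_right_mono) auto
    also have "\<dots> \<le> C * (t - s)"
      using st C by (intro mult_right_mono) auto
    finally have "t - s \<le> ?r s t"
      by (simp add: real_le_rsqrt)
    then show ?thesis using st by (simp add: ennreal_leI)
  qed
  \<comment> \<open>With \<open>f = Q\<^sup>4\<close>, \<open>g = Q\<^sup>7\<close> and \<open>h = Q\<close>, the factor \<open>g\<close> remains integrable over the line or
    the plane, while \<open>h\<close> provides the power of \<open>t - s\<close> that exceeds one.\<close>
  have weighted: "(\<integral>\<^sup>+u. ennreal (f u) * indicator {s..t} u \<partial>lborel)\<^sup>2 \<le>
      ennreal (?r s t) * (\<integral>\<^sup>+u. ennreal (g u) * indicator {s..t} u \<partial>lborel)"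
    if [measurable]: "g \<in> borel_measurable borel" "h \<in> borel_measurable borel"
      and gh: "\<And>u. 0 \<le> g u" "\<And>u. 0 \<le> h u" "\<And>u. 0 \<le> f u" "\<And>u. (f u)\<^sup>2 = g u * h u"
      and hi: "(\<integral>\<^sup>+u. ennreal (h u) * indicator {s..t} u \<partial>lborel) \<le> ennreal (?r s t)"
    for s t and f g h :: "real \<Rightarrow> real"
  proof -
    have fe: "f u = sqrt (g u) * sqrt (h u)" for u
      using gh by (metis real_sqrt_mult real_sqrt_unique)
    have "(\<integral>\<^sup>+u. ennreal (f u) * indicator {s..t} u \<partial>lborel)\<^sup>2 =
      (\<integral>\<^sup>+u. (ennreal (sqrt (g u)) * indicator {s..t} u) * (ennreal (sqrt (h u)) * indicator {s..t} u) \<partial>lborel)\<^sup>2"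
      by (intro arg_cong[where f = "\<lambda>x. x\<^sup>2"] nn_integral_cong)
        (auto simp: indicator_def fe ennreal_mult' gh)
    also have "\<dots> \<le> (\<integral>\<^sup>+u. (ennreal (sqrt (g u)) * indicator {s..t} u)\<^sup>2 \<partial>lborel) *
        (\<integral>\<^sup>+u. (ennreal (sqrt (h u)) * indicator {s..t} u)\<^sup>2 \<partial>lborel)"
      by (rule Cauchy_Schwarz_nn_integral) measurable
    also have "\<dots> = (\<integral>\<^sup>+u. ennreal (g u) * indicator {s..t} u \<partial>lborel) *
        (\<integral>\<^sup>+u. ennreal (h u) * indicator {s..t} u \<partial>lborel)"
      by (intro arg_cong2[where f = "(*)"] nn_integral_cong)
        (auto simp: indicator_def ennreal_power gh)
    also have "\<dots> \<le> (\<integral>\<^sup>+u. ennreal (g u) * indicator {s..t} u \<partial>lborel) * ennreal (?r s t)"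
      by (intro mult_left_mono hi) simp
    finally show ?thesis by (simp add: mult.commute)
  qed
  \<comment> \<open>The one-variable estimate produces \<open>C * sqrt C\<close>, the two-variable
    one \<open>C^2 * sqrt C\<close>; the latter is the larger because of
    \<open>1 \<le> C\<close>.\<close>
  define C' where "C' = C\<^sup>2 * sqrt C"
  have C': "1 \<le> C'" "C * sqrt C \<le> C'"
  proof -
    have s: "1 \<le> sqrt C" using C by simp
    have "1 * 1 \<le> C\<^sup>2 * sqrt C" using s C by (intro mult_mono) (auto simp: one_le_power)
    then show "1 \<le> C'" by (simp add: C'_def)
    have "C \<le> C\<^sup>2" using C by (simp add: power2_eq_square)
    then show "C * sqrt C \<le> C'" using s by (simp add: C'_def mult_right_mono)
  qed
  show ?thesis
  proof (rule that[of C'])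
    show "1 \<le> C'" by (rule C')
    fix x
    have "majorant_integral 0 1 x \<le> (\<integral>\<^sup>+u. ennreal (?Q (u - x) ^ 4) \<partial>lborel)"
      unfolding majorant_integral_def by (intro nn_integral_mono) (auto simp: indicator_def)
    also have "\<dots> \<le> ennreal C" by (rule C)
    finally show "majorant_integral 0 1 x < \<infinity>" by (simp add: le_less_trans)
  next
    fix s t :: real assume st: "0 \<le> s" "s \<le> t" "t \<le> 1"
    have "(\<integral>\<^sup>+x. (majorant_integral s t x)\<^sup>2 \<partial>lborel) \<le>
      (\<integral>\<^sup>+x. ennreal (?r s t) * (\<integral>\<^sup>+u. ennreal (?Q (u - x) ^ 7) * indicator {s..t} u \<partial>lborel) \<partial>lborel)"
    proof (intro nn_integral_mono)
      fix x
      have "(\<integral>\<^sup>+u. ennreal (?Q (u - x)) * indicator {s..t} u \<partial>lborel) \<le> ennreal (?r s t)"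
        using Q11[OF st, of "\<lambda>u. ?Q (u - x)" "\<lambda>u. 1" "\<lambda>u. ?Q (u - x)"] Q2[OF st(2), of x] one[OF st]
        by (simp add: kernel_majorant_nonneg)
      then show "(majorant_integral s t x)\<^sup>2 \<le>
          ennreal (?r s t) * (\<integral>\<^sup>+u. ennreal (?Q (u - x) ^ 7) * indicator {s..t} u \<partial>lborel)"
        unfolding majorant_integral_def
        by (intro weighted[where h = "\<lambda>u. ?Q (u - x)"])
          (simp_all add: kernel_majorant_nonneg flip: power_mult power_Suc2)
    qed
    also have "\<dots> = ennreal (?r s t) * (\<integral>\<^sup>+x. \<integral>\<^sup>+u. ennreal (?Q (u - x) ^ 7) * indicator {s..t} u \<partial>lborel \<partial>lborel)"
      by (rule nn_integral_cmult) measurable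
    also have "(\<integral>\<^sup>+x. \<integral>\<^sup>+u. ennreal (?Q (u - x) ^ 7) * indicator {s..t} u \<partial>lborel \<partial>lborel) =
        (\<integral>\<^sup>+u. \<integral>\<^sup>+x. ennreal (?Q (u - x) ^ 7) * indicator {s..t} u \<partial>lborel \<partial>lborel)"
      by (rule lborel_pair.Fubini') measurable
    also have "\<dots> = (\<integral>\<^sup>+u. (\<integral>\<^sup>+x. ennreal (?Q (u - x) ^ 7) \<partial>lborel) * indicator {s..t} u \<partial>lborel)"
      by (intro nn_integral_cong nn_integral_multc) measurable
    also have "\<dots> \<le> (\<integral>\<^sup>+u. ennreal C * indicator {s..t} u \<partial>lborel)"
      by (intro nn_integral_mono mult_right_mono C) simp
    also have "\<dots> = ennreal (C * (t - s))"
      using st C by (simp add: nn_integral_cmult ennreal_mult')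
    finally have "(\<integral>\<^sup>+x. (majorant_integral s t x)\<^sup>2 \<partial>lborel) \<le> ennreal (?r s t) * ennreal (C * (t - s))"
      by (simp add: mult_left_mono)
    also have "\<dots> = ennreal (C * sqrt C * ((t - s) * sqrt (t - s)))"
      using st C by (simp add: ennreal_mult'[symmetric] real_sqrt_mult mult_ac)
    also have "\<dots> \<le> ennreal (C' * ((t - s) * sqrt (t - s)))"
      using st C' by (intro ennreal_leI mult_right_mono) auto
    finally show "(\<integral>\<^sup>+x. (majorant_integral s t x)\<^sup>2 \<partial>lborel) \<le> ennreal (C' * ((t - s) * sqrt (t - s)))" .
    have "(\<integral>\<^sup>+x. \<integral>\<^sup>+y. (majorant_integral2 s t x y)\<^sup>2 \<partial>lborel \<partial>lborel) \<le>
      (\<integral>\<^sup>+x. \<integral>\<^sup>+y. ennreal (?r s t) * (\<integral>\<^sup>+u. ennreal (?Q (u - x) ^ 7 * ?Q (u - y) ^ 7) * indicator {s..t} u \<partial>lborel)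
        \<partial>lborel \<partial>lborel)"
    proof (intro nn_integral_mono)
      fix x y
      have "(\<integral>\<^sup>+u. ennreal (?Q (u - x) * ?Q (u - y)) * indicator {s..t} u \<partial>lborel) \<le> ennreal (?r s t)"
        using Q11[OF st, of "\<lambda>u. ?Q (u - x)" "\<lambda>u. ?Q (u - y)" "\<lambda>u. ?Q (u - x) * ?Q (u - y)"]
          Q2[OF st(2), of x] Q2[OF st(2), of y]
        by (simp add: kernel_majorant_nonneg)
      moreover have "(?Q (u - x) ^ 4 * ?Q (u - y) ^ 4)\<^sup>2 = (?Q (u - x) ^ 7 * ?Q (u - y) ^ 7) * (?Q (u - x) * ?Q (u - y))" for u
        by (simp add: eval_nat_numeral)
      ultimately show "(majorant_integral2 s t x y)\<^sup>2 \<le>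
          ennreal (?r s t) * (\<integral>\<^sup>+u. ennreal (?Q (u - x) ^ 7 * ?Q (u - y) ^ 7) * indicator {s..t} u \<partial>lborel)"
        unfolding majorant_integral2_def
        by (intro weighted[where h = "\<lambda>u. ?Q (u - x) * ?Q (u - y)"]) (simp_all add: kernel_majorant_nonneg)
    qed
    also have "\<dots> = ennreal (?r s t) * (\<integral>\<^sup>+x. \<integral>\<^sup>+y. \<integral>\<^sup>+u. ennreal (?Q (u - x) ^ 7 * ?Q (u - y) ^ 7) * indicator {s..t} u
        \<partial>lborel \<partial>lborel \<partial>lborel)"
      by (simp add: nn_integral_cmult)
    also have "(\<integral>\<^sup>+x. \<integral>\<^sup>+y. \<integral>\<^sup>+u. ennreal (?Q (u - x) ^ 7 * ?Q (u - y) ^ 7) * indicator {s..t} u \<partial>lborel \<partial>lborel \<partial>lborel) =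
        (\<integral>\<^sup>+x. \<integral>\<^sup>+u. \<integral>\<^sup>+y. ennreal (?Q (u - x) ^ 7 * ?Q (u - y) ^ 7) * indicator {s..t} u \<partial>lborel \<partial>lborel \<partial>lborel)"
      by (rule nn_integral_cong, rule lborel_pair.Fubini') measurable
    also have "\<dots> = (\<integral>\<^sup>+u. \<integral>\<^sup>+x. \<integral>\<^sup>+y. ennreal (?Q (u - x) ^ 7 * ?Q (u - y) ^ 7) * indicator {s..t} u \<partial>lborel \<partial>lborel \<partial>lborel)"
      by (rule lborel_pair.Fubini') measurable
    also have "\<dots> = (\<integral>\<^sup>+u. (\<integral>\<^sup>+x. ennreal (?Q (u - x) ^ 7) \<partial>lborel) *
        (\<integral>\<^sup>+y. ennreal (?Q (u - y) ^ 7) \<partial>lborel) * indicator {s..t} u \<partial>lborel)"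
      by (simp add: ennreal_mult' kernel_majorant_nonneg nn_integral_cmult nn_integral_multc mult.assoc)
    also have "\<dots> \<le> (\<integral>\<^sup>+u. ennreal C * ennreal C * indicator {s..t} u \<partial>lborel)"
      by (intro nn_integral_mono mult_right_mono mult_mono C) simp_all
    also have "\<dots> = ennreal (C\<^sup>2 * (t - s))"
      using st C by (simp add: nn_integral_cmult ennreal_mult'[symmetric] power2_eq_square)
    finally have "(\<integral>\<^sup>+x. \<integral>\<^sup>+y. (majorant_integral2 s t x y)\<^sup>2 \<partial>lborel \<partial>lborel) \<le>
        ennreal (?r s t) * ennreal (C\<^sup>2 * (t - s))"
      by (simp add: mult_left_mono)
    also have "\<dots> = ennreal (C' * ((t - s) * sqrt (t - s)))"
      using st C by (simp add: ennreal_mult'[symmetric] real_sqrt_mult mult_ac C'_def)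
    finally show "(\<integral>\<^sup>+x. \<integral>\<^sup>+y. (majorant_integral2 s t x y)\<^sup>2 \<partial>lborel \<partial>lborel) \<le>
        ennreal (C' * ((t - s) * sqrt (t - s)))" .
  qed
qed

text \<open>These are the entries of the covariance matrix of the two Gaussian variables behind the
  tails: with \<open>a = -1/2 - g\<close> and \<open>b = -1/2 - h\<close>, the variances are
  \<open>1 / (2 * a)\<close> and \<open>1 / (2 * b)\<close>, and the covariance is
  \<open>1 / (a + b)\<close>.\<close>

lemma nn_integral_power_tail_mult:
  assumes "g + h < -1"
  shows "(\<integral>\<^sup>+x. ennreal (power_tail g x * power_tail h x) \<partial>lborel) = ennreal (1 / (- g - h - 1))"
proof -
  have "(\<integral>\<^sup>+x. ennreal (power_tail g x * power_tail h x) \<partial>lborel) =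
      (\<integral>\<^sup>+x. ennreal (power_tail g (0 + -1 * x) * power_tail h (0 + -1 * x)) \<partial>lborel)"
    using nn_integral_real_affine[of "\<lambda>x. ennreal (power_tail g x * power_tail h x)" "-1" 0] by simp
  also have "\<dots> = (\<integral>\<^sup>+x. ennreal (x powr (g + h)) * indicator {1..} x \<partial>lborel)"
  proof (rule nn_integral_cong_AE)
    show "AE x in lborel. ennreal (power_tail g (0 + -1 * x) * power_tail h (0 + -1 * x)) =
        ennreal (x powr (g + h)) * indicator {1..} x"
      using AE_lborel_singleton[of "1 :: real"]
      by eventually_elim (auto simp: power_tail_def indicator_def powr_add)
  qed
  also have "\<dots> = ennreal (- (1 powr (g + h + 1)) / (g + h + 1))"
    using assms by (intro nn_integral_has_integral_lebesgue' has_integral_powr_to_inf) auto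
  also have "- (1 powr (g + h + 1)) / (g + h + 1) = 1 / (- g - h - 1)"
    using assms by (simp add: field_simps)
  finally show ?thesis .
qed

text \<open>The integrand of \<open>rosenblatt_kernel\<close> with each power replaced by its tail,
  which does not involve the time variable. Integration over \<open>[0, t]\<close> is then
  multiplication by \<open>t\<close>, and this is why the limit paths are straight lines.\<close>

definition tail_kernel :: "real \<Rightarrow> real \<Rightarrow> real \<times> real \<Rightarrow> real" where
  "tail_kernel g1 g2 = (\<lambda>(x, y). rosenblatt_const g1 g2 / 2 *
    (power_tail g1 x * power_tail g2 y + power_tail g2 x * power_tail g1 y))"

lemma product_difference_bound:
  fixes a b c d p q :: real
  assumes "\<bar>a - c\<bar> \<le> p" "\<bar>b - d\<bar> \<le> q" "0 \<le> c" "0 \<le> d"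
  shows "\<bar>a * b - c * d\<bar> \<le> c * q + p * d + p * q"
proof -
  have "a * b - c * d = c * (b - d) + (a - c) * d + (a - c) * (b - d)"
    by (simp add: algebra_simps)
  then have "\<bar>a * b - c * d\<bar> \<le> \<bar>c * (b - d)\<bar> + \<bar>(a - c) * d\<bar> + \<bar>(a - c) * (b - d)\<bar>"
    by (simp only: order_trans[OF abs_triangle_ineq add_right_mono[OF abs_triangle_ineq]])
  also have "\<dots> \<le> c * q + p * d + p * q"
    using assms unfolding abs_mult by (intro add_mono mult_mono) auto
  finally show ?thesis .
qed

text \<open>The integrand differs from its tail version by products with at least one error factor,
  each bounded by the fourth power of the majorant. Finiteness over the whole of
  \<open>[0, 1]\<close> guarantees that the kernels at \<open>s\<close> and \<open>t\<close> are
  convergent integrals; the formal value 0 of a divergent one would destroy additivity in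
  time.\<close>

lemma rosenblatt_kernel_increment_pointwise:
  fixes x y :: real
  assumes g: "-8/15 \<le> g1" "g1 < -1/2" "-8/15 \<le> g2" "g2 < -1/2"
    and st: "0 \<le> s" "s \<le> t" "t \<le> 1"
    and fin: "majorant_integral 0 1 x < \<infinity>" "majorant_integral 0 1 y < \<infinity>" "majorant_integral2 0 1 x y < \<infinity>"
  defines "G \<equiv> \<lambda>x. power_tail g1 x + power_tail g2 x"
  shows "ennreal \<bar>rosenblatt_kernel g1 g2 t (x, y) - rosenblatt_kernel g1 g2 s (x, y) -
      (t - s) * tail_kernel g1 g2 (x, y)\<bar> \<le>
    ennreal \<bar>rosenblatt_const g1 g2\<bar> * (ennreal (G x) * majorant_integral s t y +
      majorant_integral s t x * ennreal (G y) + majorant_integral2 s t x y)"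
proof -
  define H where "H u = pos_powr (u - x) g1 * pos_powr (u - y) g2 + pos_powr (u - x) g2 * pos_powr (u - y) g1" for u
  define c where "c = power_tail g1 x * power_tail g2 y + power_tail g2 x * power_tail g1 y"
  define A where "A = rosenblatt_const g1 g2"
  let ?E = "\<lambda>x u. kernel_majorant (u - x) ^ 4"
  have E0: "0 \<le> ?E x u" for x u by (simp add: kernel_majorant_nonneg)
  have G0: "0 \<le> G x" for x by (simp add: G_def power_tail_nonneg)
  have [measurable]: "H \<in> borel_measurable borel"
    unfolding H_def pos_powr_def by measurable
  \<comment> \<open>The common factor 2 comes from the two symmetric products; the 1/2 in the
    definition of the kernel cancels it in the end.\<close>
  have bound: "\<bar>H u - c\<bar> \<le> 2 * (G x * ?E y u + ?E x u * G y + ?E x u * ?E y u)" if "u \<in> {0..1}" for u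
  proof -
    have 1: "\<bar>pos_powr (u - x) g1 * pos_powr (u - y) g2 - power_tail g1 x * power_tail g2 y\<bar>
        \<le> power_tail g1 x * ?E y u + ?E x u * power_tail g2 y + ?E x u * ?E y u"
      using that g by (intro product_difference_bound power_difference_bound power_tail_nonneg) auto
    have 2: "\<bar>pos_powr (u - x) g2 * pos_powr (u - y) g1 - power_tail g2 x * power_tail g1 y\<bar>
        \<le> power_tail g2 x * ?E y u + ?E x u * power_tail g1 y + ?E x u * ?E y u"
      using that g by (intro product_difference_bound power_difference_bound power_tail_nonneg) auto
    have "\<bar>H u - c\<bar> \<le> (power_tail g1 x * ?E y u + ?E x u * power_tail g2 y + ?E x u * ?E y u) +
        (power_tail g2 x * ?E y u + ?E x u * power_tail g1 y + ?E x u * ?E y u)"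
      using 1 2 unfolding H_def c_def by linarith
    also have "\<dots> = G x * ?E y u + ?E x u * G y + 2 * (?E x u * ?E y u)"
      by (simp add: G_def algebra_simps)
    also have "\<dots> \<le> 2 * (G x * ?E y u + ?E x u * G y + ?E x u * ?E y u)"
    proof -
      have "0 \<le> G x * ?E y u" "0 \<le> ?E x u * G y" using E0 G0 by (simp_all only: mult_nonneg_nonneg)
      then show ?thesis unfolding distrib_left by linarith
    qed
    finally show ?thesis .
  qed
  \<comment> \<open>The set \<open>S\<close> is kept apart from the interval around it, because the
    bound is used twice: on subsets of \<open>{0..1}\<close> for integrability, and on
    \<open>{s<..t}\<close> for the estimate itself.\<close>
  have nn: "(\<integral>\<^sup>+u. ennreal (norm (indicator S u *\<^sub>R (H u - c))) \<partial>lborel) \<le>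
      2 * (ennreal (G x) * majorant_integral a b y + majorant_integral a b x * ennreal (G y) +
        majorant_integral2 a b x y)"
    if ab: "S \<subseteq> {a..b}" "0 \<le> a" "b \<le> 1" for S a b
  proof -
    have "(\<integral>\<^sup>+u. ennreal (norm (indicator S u *\<^sub>R (H u - c))) \<partial>lborel) \<le>
      (\<integral>\<^sup>+u. 2 * (ennreal (G x) * (ennreal (?E y u) * indicator {a..b} u) +
          (ennreal (?E x u) * indicator {a..b} u) * ennreal (G y) +
          ennreal (?E x u * ?E y u) * indicator {a..b} u) \<partial>lborel)"
    proof (intro nn_integral_mono)
      fix u
      show "ennreal (norm (indicator S u *\<^sub>R (H u - c))) \<le>
        2 * (ennreal (G x) * (ennreal (?E y u) * indicator {a..b} u) +
          (ennreal (?E x u) * indicator {a..b} u) * ennreal (G y) +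
          ennreal (?E x u * ?E y u) * indicator {a..b} u)"
      proof (cases "u \<in> S")
        case True
        then have u: "u \<in> {a..b}" "u \<in> {0..1}" using ab by auto
        have "ennreal \<bar>H u - c\<bar> \<le> ennreal (2 * (G x * ?E y u + ?E x u * G y + ?E x u * ?E y u))"
          by (intro ennreal_leI bound u)
        also have "\<dots> = 2 * (ennreal (G x) * ennreal (?E y u) + ennreal (?E x u) * ennreal (G y) +
          ennreal (?E x u * ?E y u))"
          using E0 G0 by (simp add: ennreal_mult')
        finally show ?thesis using True u by simp
      qed simp
    qed
    also have "\<dots> = 2 * (ennreal (G x) * majorant_integral a b y + majorant_integral a b x * ennreal (G y) +
        majorant_integral2 a b x y)"
      unfolding majorant_integral_def majorant_integral2_def
      by (simp add: nn_integral_cmult nn_integral_add nn_integral_multc)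
    finally show ?thesis .
  qed
  have int1: "integrable lborel (\<lambda>u. indicator S u *\<^sub>R (H u - c))"
    if [measurable]: "S \<in> sets borel" and "S \<subseteq> {0..1}" for S
  proof (rule integrableI_bounded)
    have "(\<integral>\<^sup>+u. ennreal (norm (indicator S u *\<^sub>R (H u - c))) \<partial>lborel) \<le>
      2 * (ennreal (G x) * majorant_integral 0 1 y + majorant_integral 0 1 x * ennreal (G y) +
        majorant_integral2 0 1 x y)"
      using that by (intro nn) auto
    also have "\<dots> < \<infinity>"
      using fin by (simp add: ennreal_mult_less_top)
    finally show "(\<integral>\<^sup>+u. ennreal (norm (indicator S u *\<^sub>R (H u - c))) \<partial>lborel) < \<infinity>" .
  qed measurable
  have intc: "integrable lborel (\<lambda>u. indicator {0..r} u *\<^sub>R c)" for r :: real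
    by (intro integrable_scaleR_left integrable_real_indicator) (auto simp: emeasure_lborel_Icc_eq)
  have intH: "(LINT u:{0..r}|lborel. H u) = (LINT u|lborel. indicator {0..r} u *\<^sub>R (H u - c)) + r * c"
    if "0 \<le> r" "r \<le> 1" for r
  proof -
    have "(LINT u:{0..r}|lborel. H u) =
        (LINT u|lborel. indicator {0..r} u *\<^sub>R (H u - c) + indicator {0..r} u *\<^sub>R c)"
      unfolding set_lebesgue_integral_def by (intro Bochner_Integration.integral_cong) (auto simp: algebra_simps)
    also have "\<dots> = (LINT u|lborel. indicator {0..r} u *\<^sub>R (H u - c)) +
        (LINT u|lborel. indicator {0..r} u *\<^sub>R c)"
      using that by (intro Bochner_Integration.integral_add int1 intc) auto
    also have "(LINT u|lborel. indicator {0..r} u *\<^sub>R c) = r * c"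
      using that by simp
    finally show ?thesis .
  qed
  have "rosenblatt_kernel g1 g2 t (x, y) - rosenblatt_kernel g1 g2 s (x, y) - (t - s) * tail_kernel g1 g2 (x, y) =
      A / 2 * ((LINT u:{0..t}|lborel. H u) - (LINT u:{0..s}|lborel. H u) - (t - s) * c)"
    by (simp add: rosenblatt_kernel_def tail_kernel_def H_def c_def A_def algebra_simps diff_divide_distrib)
  also have "\<dots> = A / 2 * ((LINT u|lborel. indicator {0..t} u *\<^sub>R (H u - c)) -
      (LINT u|lborel. indicator {0..s} u *\<^sub>R (H u - c)))"
    using st by (simp add: intH algebra_simps)
  also have "(LINT u|lborel. indicator {0..t} u *\<^sub>R (H u - c)) - (LINT u|lborel. indicator {0..s} u *\<^sub>R (H u - c)) =
      (LINT u|lborel. indicator {s<..t} u *\<^sub>R (H u - c))"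
    using st by (subst Bochner_Integration.integral_diff[OF int1 int1, symmetric])
      (auto intro!: Bochner_Integration.integral_cong simp: indicator_def)
  finally have eq: "rosenblatt_kernel g1 g2 t (x, y) - rosenblatt_kernel g1 g2 s (x, y) -
      (t - s) * tail_kernel g1 g2 (x, y) = A / 2 * (LINT u|lborel. indicator {s<..t} u *\<^sub>R (H u - c))" .
  have "ennreal (norm (LINT u|lborel. indicator {s<..t} u *\<^sub>R (H u - c))) \<le>
      (\<integral>\<^sup>+u. ennreal (norm (indicator {s<..t} u *\<^sub>R (H u - c))) \<partial>lborel)"
    using st by (intro integral_norm_bound_ennreal int1) auto
  also have "\<dots> \<le> 2 * (ennreal (G x) * majorant_integral s t y + majorant_integral s t x * ennreal (G y) +
        majorant_integral2 s t x y)" (is "_ \<le> 2 * ?R")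
    using st by (intro nn) auto
  finally have le: "ennreal \<bar>LINT u|lborel. indicator {s<..t} u *\<^sub>R (H u - c)\<bar> \<le> 2 * ?R"
    by simp
  have "ennreal \<bar>A / 2 * (LINT u|lborel. indicator {s<..t} u *\<^sub>R (H u - c))\<bar> =
      ennreal (\<bar>A\<bar> / 2) * ennreal \<bar>LINT u|lborel. indicator {s<..t} u *\<^sub>R (H u - c)\<bar>"
    by (subst ennreal_mult'[symmetric]) (simp_all add: abs_mult)
  also have "\<dots> \<le> ennreal (\<bar>A\<bar> / 2) * (2 * ?R)"
    by (intro mult_left_mono le) simp
  also have "\<dots> = ennreal (\<bar>A\<bar> / 2 * 2) * ?R"
    by (simp only: ennreal_mult'' mult.assoc) simp
  finally show ?thesis
    unfolding eq by (simp add: A_def)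
qed

text \<open>Subtracting the tail kernel removes the product of both squared tail norms. Every
  remaining term contains at most one tail, so these norms enter linearly, and the prefactor tends
  to zero under the normalization.\<close>

lemma rosenblatt_kernel_increment:
  obtains C where "0 \<le> C"
    "\<And>g1 g2 s t. -8/15 \<le> g1 \<Longrightarrow> g1 < -1/2 \<Longrightarrow> -8/15 \<le> g2 \<Longrightarrow> g2 < -1/2 \<Longrightarrow>
      0 \<le> s \<Longrightarrow> s \<le> t \<Longrightarrow> t \<le> 1 \<Longrightarrow>
      (\<integral>\<^sup>+p. ennreal ((rosenblatt_kernel g1 g2 t p - rosenblatt_kernel g1 g2 s p -
          (t - s) * tail_kernel g1 g2 p)\<^sup>2) \<partial>(lborel \<Otimes>\<^sub>M lborel)) \<le>
      ennreal (C * (rosenblatt_const g1 g2)\<^sup>2 * (1 + 1 / (-2 * g1 - 1) + 1 / (-2 * g2 - 1)) *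
        ((t - s) * sqrt (t - s)))"
proof -
  obtain C where C: "1 \<le> C"
    "\<And>s t. 0 \<le> s \<Longrightarrow> s \<le> t \<Longrightarrow> t \<le> 1 \<Longrightarrow>
      (\<integral>\<^sup>+x. (majorant_integral s t x)\<^sup>2 \<partial>lborel) \<le> ennreal (C * ((t - s) * sqrt (t - s)))"
    "\<And>s t. 0 \<le> s \<Longrightarrow> s \<le> t \<Longrightarrow> t \<le> 1 \<Longrightarrow>
      (\<integral>\<^sup>+x. \<integral>\<^sup>+y. (majorant_integral2 s t x y)\<^sup>2 \<partial>lborel \<partial>lborel) \<le> ennreal (C * ((t - s) * sqrt (t - s)))"
    "\<And>x. majorant_integral 0 1 x < \<infinity>"
    using majorant_integral_square_bounds by blast
  have pair: "(\<integral>\<^sup>+p. f (fst p) (snd p) \<partial>(lborel \<Otimes>\<^sub>M lborel)) = (\<integral>\<^sup>+x. \<integral>\<^sup>+y. f x y \<partial>lborel \<partial>lborel)"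
    if "(\<lambda>p. f (fst p) (snd p)) \<in> borel_measurable (borel \<Otimes>\<^sub>M borel)" for f :: "real \<Rightarrow> real \<Rightarrow> ennreal"
    using lborel.nn_integral_fst[of "\<lambda>p. f (fst p) (snd p)" lborel] that by simp
  \<comment> \<open>The two-factor integral is infinite at diagonal points with
    \<open>0 \<le> x < 1\<close>; its square integrability shows the exceptional set to be
    null.\<close>
  have ae: "AE p in lborel \<Otimes>\<^sub>M lborel. majorant_integral2 0 1 (fst p) (snd p) < \<infinity>"
  proof -
    have "(\<integral>\<^sup>+p. (majorant_integral2 0 1 (fst p) (snd p))\<^sup>2 \<partial>(lborel \<Otimes>\<^sub>M lborel)) \<le> ennreal (C * ((1 - 0) * sqrt (1 - 0)))"
      by (subst pair) (measurable, intro C, auto)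
    then have "(\<integral>\<^sup>+p. (majorant_integral2 0 1 (fst p) (snd p))\<^sup>2 \<partial>(lborel \<Otimes>\<^sub>M lborel)) \<noteq> \<infinity>"
      by (auto simp: top_unique)
    then have "AE p in lborel \<Otimes>\<^sub>M lborel. (majorant_integral2 0 1 (fst p) (snd p))\<^sup>2 \<noteq> \<infinity>"
      by (intro nn_integral_PInf_AE) measurable
    then show ?thesis
      by eventually_elim (auto simp: less_top power2_eq_square ennreal_mult_eq_top_iff)
  qed
  show ?thesis
  \<comment> \<open>The 12 comes from \<open>3 * (2 * T + 2 * T + 1) \<le> 12 * (1 + T)\<close>, the
    3 being that of \<open>ennreal_square_sum3_le\<close>.\<close>
  proof (rule that[of "12 * C"])
    show "0 \<le> 12 * C" using C by simp
    fix g1 g2 s t :: real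
    assume g: "-8/15 \<le> g1" "g1 < -1/2" "-8/15 \<le> g2" "g2 < -1/2" and st: "0 \<le> s" "s \<le> t" "t \<le> 1"
    define A where "A = rosenblatt_const g1 g2"
    define G where "G x = power_tail g1 x + power_tail g2 x" for x
    define \<tau> where "\<tau> = (t - s) * sqrt (t - s)"
    define T where "T = 1 / (-2 * g1 - 1) + 1 / (-2 * g2 - 1)"
    have \<tau>: "0 \<le> \<tau>" using st by (simp add: \<tau>_def)
    have T: "0 \<le> T" using g by (simp add: T_def)
    have [measurable]: "G \<in> borel_measurable borel" unfolding G_def by measurable
    have G2: "(\<integral>\<^sup>+x. (ennreal (G x))\<^sup>2 \<partial>lborel) \<le> ennreal (2 * T)"
    proof -
      have "(\<integral>\<^sup>+x. (ennreal (G x))\<^sup>2 \<partial>lborel) = (\<integral>\<^sup>+x. ennreal ((power_tail g1 x + power_tail g2 x)\<^sup>2) \<partial>lborel)"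
        by (simp add: G_def ennreal_power power_tail_nonneg del: ennreal_plus)
      also have "\<dots> \<le> 2 * (\<integral>\<^sup>+x. ennreal ((power_tail g1 x)\<^sup>2) \<partial>lborel) + 2 * (\<integral>\<^sup>+x. ennreal ((power_tail g2 x)\<^sup>2) \<partial>lborel)"
        by (rule nn_integral_square_add_le) measurable
      also have "\<dots> = 2 * ennreal (1 / (- g1 - g1 - 1)) + 2 * ennreal (1 / (- g2 - g2 - 1))"
        using g by (simp add: power2_eq_square nn_integral_power_tail_mult)
      also have "\<dots> = ennreal (2 * T)"
      proof -
        have "- g1 - g1 - 1 = -2 * g1 - 1" "- g2 - g2 - 1 = -2 * g2 - 1" by simp_all
        moreover have "2 * ennreal p + 2 * ennreal q = ennreal (2 * (p + q))" if "0 \<le> p" "0 \<le> q" for p q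
          using that by (simp add: distrib_left ennreal_mult')
        ultimately show ?thesis using g unfolding T_def by simp
      qed
      finally show ?thesis .
    qed
    have "(\<integral>\<^sup>+p. ennreal ((rosenblatt_kernel g1 g2 t p - rosenblatt_kernel g1 g2 s p -
          (t - s) * tail_kernel g1 g2 p)\<^sup>2) \<partial>(lborel \<Otimes>\<^sub>M lborel)) \<le>
      (\<integral>\<^sup>+p. ennreal (A\<^sup>2) * (3 * ((ennreal (G (fst p)))\<^sup>2 * (majorant_integral s t (snd p))\<^sup>2 +
        (majorant_integral s t (fst p))\<^sup>2 * (ennreal (G (snd p)))\<^sup>2 + (majorant_integral2 s t (fst p) (snd p))\<^sup>2))
        \<partial>(lborel \<Otimes>\<^sub>M lborel))"
    proof (rule nn_integral_mono_AE, use ae in eventually_elim)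
      fix p :: "real \<times> real" assume fin: "majorant_integral2 0 1 (fst p) (snd p) < \<infinity>"
      obtain x y where p: "p = (x, y)" by (cases p)
      let ?d = "rosenblatt_kernel g1 g2 t p - rosenblatt_kernel g1 g2 s p - (t - s) * tail_kernel g1 g2 p"
      have "ennreal \<bar>?d\<bar> \<le> ennreal \<bar>A\<bar> * (ennreal (G x) * majorant_integral s t y +
          majorant_integral s t x * ennreal (G y) + majorant_integral2 s t x y)"
        unfolding A_def G_def p using g st C(4) fin
        by (intro rosenblatt_kernel_increment_pointwise) (auto simp: p)
      then have "(ennreal \<bar>?d\<bar>)\<^sup>2 \<le> (ennreal \<bar>A\<bar> * (ennreal (G x) * majorant_integral s t y +
          majorant_integral s t x * ennreal (G y) + majorant_integral2 s t x y))\<^sup>2"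
        by (intro power_mono) auto
      also have "\<dots> = ennreal (A\<^sup>2) * (ennreal (G x) * majorant_integral s t y +
          majorant_integral s t x * ennreal (G y) + majorant_integral2 s t x y)\<^sup>2"
        by (simp add: power_mult_distrib ennreal_power)
      also have "\<dots> \<le> ennreal (A\<^sup>2) * (3 * ((ennreal (G x) * majorant_integral s t y)\<^sup>2 +
          (majorant_integral s t x * ennreal (G y))\<^sup>2 + (majorant_integral2 s t x y)\<^sup>2))"
        by (intro mult_left_mono ennreal_square_sum3_le) simp
      finally show "ennreal (?d\<^sup>2) \<le> ennreal (A\<^sup>2) * (3 * ((ennreal (G (fst p)))\<^sup>2 * (majorant_integral s t (snd p))\<^sup>2 +
        (majorant_integral s t (fst p))\<^sup>2 * (ennreal (G (snd p)))\<^sup>2 + (majorant_integral2 s t (fst p) (snd p))\<^sup>2))"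
        by (simp add: p power_mult_distrib ennreal_power)
    qed
    also have "\<dots> = ennreal (A\<^sup>2) * (3 * (
        (\<integral>\<^sup>+p. (ennreal (G (fst p)))\<^sup>2 * (majorant_integral s t (snd p))\<^sup>2 \<partial>(lborel \<Otimes>\<^sub>M lborel)) +
        (\<integral>\<^sup>+p. (majorant_integral s t (fst p))\<^sup>2 * (ennreal (G (snd p)))\<^sup>2 \<partial>(lborel \<Otimes>\<^sub>M lborel)) +
        (\<integral>\<^sup>+p. (majorant_integral2 s t (fst p) (snd p))\<^sup>2 \<partial>(lborel \<Otimes>\<^sub>M lborel))))"
      by (simp add: nn_integral_cmult nn_integral_add)
    also have "(\<integral>\<^sup>+p. (ennreal (G (fst p)))\<^sup>2 * (majorant_integral s t (snd p))\<^sup>2 \<partial>(lborel \<Otimes>\<^sub>M lborel)) =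
        (\<integral>\<^sup>+x. (ennreal (G x))\<^sup>2 \<partial>lborel) * (\<integral>\<^sup>+y. (majorant_integral s t y)\<^sup>2 \<partial>lborel)"
      by (subst pair) (simp_all add: nn_integral_cmult nn_integral_multc)
    also have "(\<integral>\<^sup>+p. (majorant_integral s t (fst p))\<^sup>2 * (ennreal (G (snd p)))\<^sup>2 \<partial>(lborel \<Otimes>\<^sub>M lborel)) =
        (\<integral>\<^sup>+y. (majorant_integral s t y)\<^sup>2 \<partial>lborel) * (\<integral>\<^sup>+x. (ennreal (G x))\<^sup>2 \<partial>lborel)"
      by (subst pair) (simp_all add: nn_integral_cmult nn_integral_multc)
    also have "(\<integral>\<^sup>+p. (majorant_integral2 s t (fst p) (snd p))\<^sup>2 \<partial>(lborel \<Otimes>\<^sub>M lborel)) =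
        (\<integral>\<^sup>+x. \<integral>\<^sup>+y. (majorant_integral2 s t x y)\<^sup>2 \<partial>lborel \<partial>lborel)"
      by (rule pair) measurable
    also have "ennreal (A\<^sup>2) * (3 * (
        (\<integral>\<^sup>+x. (ennreal (G x))\<^sup>2 \<partial>lborel) * (\<integral>\<^sup>+y. (majorant_integral s t y)\<^sup>2 \<partial>lborel) +
        (\<integral>\<^sup>+y. (majorant_integral s t y)\<^sup>2 \<partial>lborel) * (\<integral>\<^sup>+x. (ennreal (G x))\<^sup>2 \<partial>lborel) +
        (\<integral>\<^sup>+x. \<integral>\<^sup>+y. (majorant_integral2 s t x y)\<^sup>2 \<partial>lborel \<partial>lborel))) \<le>
      ennreal (A\<^sup>2) * (3 * (ennreal (2 * T) * ennreal (C * \<tau>) + ennreal (C * \<tau>) * ennreal (2 * T) + ennreal (C * \<tau>)))"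
      unfolding \<tau>_def by (intro mult_left_mono add_mono mult_mono G2 C st) auto
    also have "\<dots> = ennreal (A\<^sup>2 * (3 * (2 * T * (C * \<tau>) + C * \<tau> * (2 * T) + C * \<tau>)))"
    proof -
      have "ennreal (A\<^sup>2) * (3 * (ennreal x * ennreal y + ennreal y * ennreal x + ennreal y)) =
          ennreal (A\<^sup>2 * (3 * (x * y + y * x + y)))" if "0 \<le> x" "0 \<le> y" for x y
      proof -
        have "3 * z + 3 * z = 6 * z" for z :: ennreal by (simp flip: distrib_right)
        then show ?thesis
          using that by (simp add: ennreal_mult' distrib_left mult.commute[of "ennreal y"])
      qed
      from this[of "2 * T" "C * \<tau>"] show ?thesis using T \<tau> C(1) by simp
    qed
    also have "\<dots> \<le> ennreal (12 * C * A\<^sup>2 * (1 + T) * \<tau>)"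
    proof (rule ennreal_leI)
      have "A\<^sup>2 * (3 * (2 * T * (C * \<tau>) + C * \<tau> * (2 * T) + C * \<tau>)) = A\<^sup>2 * C * \<tau> * (12 * T + 3)"
        by (simp add: algebra_simps)
      also have "\<dots> \<le> A\<^sup>2 * C * \<tau> * (12 * T + 12)"
        using \<tau> C by (intro mult_left_mono) auto
      also have "\<dots> = 12 * C * A\<^sup>2 * (1 + T) * \<tau>"
        by (simp add: algebra_simps)
      finally show "A\<^sup>2 * (3 * (2 * T * (C * \<tau>) + C * \<tau> * (2 * T) + C * \<tau>)) \<le> 12 * C * A\<^sup>2 * (1 + T) * \<tau>" .
    qed
    finally show "(\<integral>\<^sup>+p. ennreal ((rosenblatt_kernel g1 g2 t p - rosenblatt_kernel g1 g2 s p -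
          (t - s) * tail_kernel g1 g2 p)\<^sup>2) \<partial>(lborel \<Otimes>\<^sub>M lborel)) \<le>
      ennreal (12 * C * (rosenblatt_const g1 g2)\<^sup>2 * (1 + 1 / (-2 * g1 - 1) + 1 / (-2 * g2 - 1)) *
        ((t - s) * sqrt (t - s)))"
      by (simp add: A_def T_def \<tau>_def add.assoc)
  qed
qed

section \<open>Weak convergence to random lines\<close>

lemma mspace_C01: "mspace C01 = {f. f \<in> extensional {0..1} \<and> continuous_on {0..1} f}"
proof -
  \<comment> \<open>Compactness of the interval makes the boundedness that is built into
    \<open>cfunspace\<close> automatic.\<close>
  have "compactin (top_of_set {0..1::real}) (topspace (top_of_set {0..1}))"
    by (simp add: compactin_subtopology)
  then show ?thesis
    unfolding C01_def by (subst compactin_mspace_cfunspace) (auto simp: continuous_map_iff_continuous)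
qed

lemma mdist_C01_le:
  assumes "f \<in> mspace C01" "g \<in> mspace C01"
  shows "mdist C01 f g \<le> a \<longleftrightarrow> (\<forall>t\<in>{0..1}. \<bar>f t - g t\<bar> \<le> a)"
  using cfunspace_mdist_le[of f "top_of_set {0..1}" euclidean_metric g a] assms
  by (simp add: C01_def dist_real_def)

interpretation C01: Metric_space "mspace C01" "mdist C01"
  by (rule Metric_space_mspace_mdist)

lemma openin_C01_ball:
  assumes "openin (mtopology_of C01) U" "f \<in> U"
  obtains r where "0 < r" "\<And>g. g \<in> mspace C01 \<Longrightarrow> (\<And>t. t \<in> {0..1} \<Longrightarrow> \<bar>f t - g t\<bar> \<le> r) \<Longrightarrow> g \<in> U"
proof -
  have op: "openin C01.mtopology U"
    using assms by (simp add: mtopology_of_def)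
  then have U: "U \<subseteq> mspace C01" by (simp add: C01.openin_mtopology)
  from op obtain r where r: "0 < r" "C01.mball f r \<subseteq> U"
    using assms unfolding C01.openin_mtopology by blast
  show ?thesis
  proof (rule that[of "r / 2"])
    fix g assume g: "g \<in> mspace C01" "\<And>t. t \<in> {0..1} \<Longrightarrow> \<bar>f t - g t\<bar> \<le> r / 2"
    then have "mdist C01 f g \<le> r / 2"
      using U assms by (subst mdist_C01_le) auto
    then show "g \<in> U"
      using r g U assms by (auto simp: C01.mball_def)
  qed (use r in simp)
qed

lemma restrict_in_C01: "continuous_on {0..1} f \<Longrightarrow> (\<lambda>t\<in>{0..1}. f t) \<in> mspace C01"
  unfolding mspace_C01 by (auto elim: continuous_on_eq)

text \<open>A countable dense set of paths, indexed by the countable type of lists of rationals. The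
  degree is one less than the length, and the empty list gives the zero path.\<close>

definition rational_bernstein :: "rat list \<Rightarrow> real \<Rightarrow> real" where
  "rational_bernstein qs =
    (\<lambda>t\<in>{0..1}. \<Sum>k<length qs. of_rat (qs ! k) * Bernstein (length qs - 1) k t)"

lemma rational_bernstein_in_C01: "rational_bernstein qs \<in> mspace C01"
  unfolding rational_bernstein_def Bernstein_def
  by (intro restrict_in_C01 continuous_intros)

text \<open>The Bernstein basis is nonnegative with sum 1 on the interval, so rounding the
  coefficients to rationals moves the polynomial by no more than the largest rounding error.\<close>

lemma rational_bernstein_dense:
  assumes f: "f \<in> mspace C01" and e: "0 < e"
  obtains qs where "\<And>t. t \<in> {0..1} \<Longrightarrow> \<bar>f t - rational_bernstein qs t\<bar> \<le> e"
proof -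
  have "continuous_on {0..1} f" using f by (simp add: mspace_C01)
  from Bernstein_Weierstrass[OF this, of "e / 2"] e obtain N where
    N: "\<And>n x. N \<le> n \<Longrightarrow> x \<in> {0..1} \<Longrightarrow> \<bar>f x - (\<Sum>k\<le>n. f (k / n) * Bernstein n k x)\<bar> < e / 2"
    by auto
  have "\<exists>q. \<bar>of_rat q - f (k / N)\<bar> < e / 2" for k :: nat
  proof -
    obtain x where "f (k / N) - e / 2 < of_rat x" "of_rat x < f (k / N) + e / 2"
      using of_rat_dense[of "f (k / N) - e / 2" "f (k / N) + e / 2"] e by auto
    then have "\<bar>of_rat x - f (k / N)\<bar> < e / 2" by linarith
    then show ?thesis by blast
  qed
  then obtain q where q: "\<And>k :: nat. \<bar>of_rat (q k) - f (k / N)\<bar> < e / 2" by metis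
  define qs where "qs = map q [0..<Suc N]"
  show ?thesis
  proof (rule that[of qs])
    fix t :: real assume t: "t \<in> {0..1}"
    have len: "length qs = Suc N" and nth: "\<And>k. k \<le> N \<Longrightarrow> qs ! k = q k"
      by (simp_all add: qs_def del: upt_Suc)
    have R: "rational_bernstein qs t = (\<Sum>k\<le>N. of_rat (q k) * Bernstein N k t)"
      using t by (simp add: rational_bernstein_def len nth lessThan_Suc_atMost)
    have "\<bar>(\<Sum>k\<le>N. f (k / N) * Bernstein N k t) - rational_bernstein qs t\<bar> =
        \<bar>\<Sum>k\<le>N. (f (k / N) - of_rat (q k)) * Bernstein N k t\<bar>"
      by (simp add: R sum_subtractf left_diff_distrib)
    also have "\<dots> \<le> (\<Sum>k\<le>N. e / 2 * Bernstein N k t)"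
    proof (intro order_trans[OF sum_abs] sum_mono)
      fix k
      have "\<bar>f (k / N) - of_rat (q k)\<bar> * Bernstein N k t \<le> e / 2 * Bernstein N k t"
        using q[of k] t by (intro mult_right_mono) (auto simp: abs_minus_commute Bernstein_nonneg)
      then show "\<bar>(f (k / N) - of_rat (q k)) * Bernstein N k t\<bar> \<le> e / 2 * Bernstein N k t"
        using t by (simp add: abs_mult Bernstein_nonneg)
    qed
    also have "\<dots> = e / 2"
      by (simp only: sum_distrib_left[symmetric] sum_Bernstein mult_1_right)
    finally show "\<bar>f t - rational_bernstein qs t\<bar> \<le> e"
      using N[of N t] t by linarith
  qed
qed

lemma space_borel_C01: "space borel_C01 = mspace C01"
  unfolding borel_C01_def by (rule space_measure_of) (auto simp: openin_subset mtopology_of_def C01.openin_mtopology)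

lemma openin_sets_borel_C01: "openin (mtopology_of C01) U \<Longrightarrow> U \<in> sets borel_C01"
  unfolding borel_C01_def
  by (subst sets_measure_of) (auto simp: mtopology_of_def C01.openin_mtopology)

lemma borel_measurable_C01:
  assumes "continuous_map (mtopology_of C01) euclideanreal \<phi>"
  shows "\<phi> \<in> borel_measurable borel_C01"
proof (rule borel_measurableI)
  fix S :: "real set" assume "open S"
  then have "openin (mtopology_of C01) {f \<in> topspace (mtopology_of C01). \<phi> f \<in> S}"
    using assms by (intro openin_continuous_map_preimage[of _ euclideanreal]) auto
  then show "\<phi> -` S \<inter> space borel_C01 \<in> sets borel_C01"
    by (intro openin_sets_borel_C01)
      (simp add: space_borel_C01 vimage_def Int_def conj_commute)
qed

text \<open>Rounding \<open>t\<close> down to a multiple of \<open>1 / Suc n\<close> gives rationals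
  that tend to \<open>t\<close> and stay in the interval where \<open>f\<close> is
  continuous.\<close>

lemma continuous_le_from_rationals:
  fixes f :: "real \<Rightarrow> real"
  assumes f: "continuous_on {0..1} f" and le: "\<And>t. t \<in> {0..1} \<inter> \<rat> \<Longrightarrow> \<bar>f t\<bar> \<le> r" and t: "t \<in> {0..1}"
  shows "\<bar>f t\<bar> \<le> r"
proof -
  define s where "s n = real_of_int \<lfloor>t * real (Suc n)\<rfloor> / real (Suc n)" for n
  have s: "0 \<le> s n" "s n \<le> t" "t - 1 / real (Suc n) \<le> s n" for n
  proof -
    show "0 \<le> s n" using t by (simp add: s_def)
    have "real_of_int \<lfloor>t * real (Suc n)\<rfloor> \<le> t * real (Suc n)" by simp
    then show "s n \<le> t" by (simp add: s_def field_simps del: of_nat_Suc)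
    have "(t * real (Suc n) - 1) / real (Suc n) \<le> s n"
      unfolding s_def by (intro divide_right_mono) linarith+
    then show "t - 1 / real (Suc n) \<le> s n" by (simp add: diff_divide_distrib del: of_nat_Suc)
  qed
  have "(\<lambda>n. t - 1 / real (Suc n)) \<longlonglongrightarrow> t - 0"
    by (intro tendsto_diff tendsto_const LIMSEQ_Suc lim_1_over_n)
  then have "s \<longlonglongrightarrow> t"
    using s by (intro tendsto_sandwich[of "\<lambda>n. t - 1 / real (Suc n)" s sequentially "\<lambda>_. t"]) auto
  then have "(\<lambda>n. f (s n)) \<longlonglongrightarrow> f t"
    using s t by (intro continuous_on_tendsto_compose[OF f]) (auto intro!: always_eventually order_trans[of _ t 1])
  then have "(\<lambda>n. \<bar>f (s n)\<bar>) \<longlonglongrightarrow> \<bar>f t\<bar>"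
    by (rule tendsto_rabs)
  moreover have "\<bar>f (s n)\<bar> \<le> r" for n
  proof (rule le)
    have "s n \<le> 1" using s(2)[of n] t by (meson atLeastAtMost_iff order_trans)
    moreover have "s n \<in> \<rat>" by (simp add: s_def)
    ultimately show "s n \<in> {0..1} \<inter> \<rat>" using s(1)[of n] by simp
  qed
  ultimately show ?thesis
    by (intro LIMSEQ_le_const2) auto
qed

text \<open>By separability an open set of paths is a countable union of closed balls with rational
  Bernstein centres and rational radii. Since the paths are continuous, membership in such a ball is
  decided at the countably many rational times.\<close>

lemma path01_measurable:
  assumes X: "\<And>t. t \<in> {0..1} \<Longrightarrow> X t \<in> borel_measurable M"
    and cont: "\<And>\<omega>. \<omega> \<in> space M \<Longrightarrow> continuous_on {0..1} (\<lambda>t. X t \<omega>)"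
  shows "path01 X \<in> measurable M borel_C01"
  unfolding borel_C01_def
proof (rule measurable_measure_of)
  show "{U. openin (mtopology_of C01) U} \<subseteq> Pow (mspace C01)"
    by (auto simp: mtopology_of_def C01.openin_mtopology)
  have path: "path01 X \<omega> \<in> mspace C01" if "\<omega> \<in> space M" for \<omega>
    unfolding path01_def using cont[OF that] by (rule restrict_in_C01)
  then show "path01 X \<in> space M \<rightarrow> mspace C01" by auto
  fix U assume "U \<in> {U. openin (mtopology_of C01) U}"
  then have U: "openin (mtopology_of C01) U" by simp
  define J where "J = {(qs, r). 0 < (of_rat r :: real) \<and>
    (\<forall>g\<in>mspace C01. (\<forall>t\<in>{0..1}. \<bar>g t - rational_bernstein qs t\<bar> \<le> of_rat r) \<longrightarrow> g \<in> U)}"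
  define E where "E = (\<lambda>(qs, r). {\<omega> \<in> space M. \<forall>t\<in>{0..1} \<inter> \<rat>. \<bar>X t \<omega> - rational_bernstein qs t\<bar> \<le> of_rat r})"
  have "path01 X -` U \<inter> space M = (\<Union>j\<in>J. E j)"
  proof (intro equalityI subsetI)
    fix \<omega> assume "\<omega> \<in> path01 X -` U \<inter> space M"
    then have \<omega>: "\<omega> \<in> space M" "path01 X \<omega> \<in> U" by auto
    obtain r where r: "0 < r" "\<And>g. g \<in> mspace C01 \<Longrightarrow> (\<And>t. t \<in> {0..1} \<Longrightarrow> \<bar>path01 X \<omega> t - g t\<bar> \<le> r) \<Longrightarrow> g \<in> U"
      using openin_C01_ball[OF U \<omega>(2)] by blast
    \<comment> \<open>The distance to the centre and the radius of the ball are both kept below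
      \<open>r / 2\<close>, so every path in the ball is within \<open>r\<close> of the given one
      and hence in \<open>U\<close>.\<close>
    have "0 < r / 2" using r by simp
    then obtain q where q: "0 < real_of_rat q" "of_rat q < r / 2"
      using of_rat_dense by blast
    obtain qs where qs: "\<And>t. t \<in> {0..1} \<Longrightarrow> \<bar>path01 X \<omega> t - rational_bernstein qs t\<bar> \<le> of_rat q"
      using rational_bernstein_dense[OF path[OF \<omega>(1)] q(1)] by blast
    have "g \<in> U" if g: "g \<in> mspace C01" "\<forall>t\<in>{0..1}. \<bar>g t - rational_bernstein qs t\<bar> \<le> of_rat q" for g
    proof (rule r(2)[OF g(1)])
      fix t :: real assume t: "t \<in> {0..1}"
      show "\<bar>path01 X \<omega> t - g t\<bar> \<le> r"
        using qs[OF t] g(2)[rule_format, OF t] q by linarith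
    qed
    then have "(qs, q) \<in> J" using q by (simp add: J_def)
    moreover have "\<omega> \<in> E (qs, q)"
      using \<omega> qs by (auto simp: E_def path01_def)
    ultimately show "\<omega> \<in> (\<Union>j\<in>J. E j)" by blast
  next
    fix \<omega> assume "\<omega> \<in> (\<Union>j\<in>J. E j)"
    then obtain qs r where qr: "(qs, r) \<in> J" and \<omega>: "\<omega> \<in> E (qs, r)" by auto
    then have sp: "\<omega> \<in> space M" by (simp add: E_def)
    have cd: "continuous_on {0..1} (\<lambda>t. X t \<omega> - rational_bernstein qs t)"
      using cont[OF sp] rational_bernstein_in_C01[of qs] by (intro continuous_on_diff) (simp_all add: mspace_C01)
    have "\<bar>X t \<omega> - rational_bernstein qs t\<bar> \<le> of_rat r" if "t \<in> {0..1}" for t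
      using \<omega> by (intro continuous_le_from_rationals[OF cd _ that]) (auto simp: E_def)
    then have "path01 X \<omega> \<in> U"
      using qr path[OF sp] by (auto simp: J_def path01_def)
    then show "\<omega> \<in> path01 X -` U \<inter> space M" using sp by simp
  qed
  moreover have "countable J" by simp
  moreover have "E j \<in> sets M" for j
  proof -
    obtain qs r where j: "j = (qs, r)" by (cases j)
    have "E j = space M - (\<Union>t\<in>{0..1} \<inter> \<rat>. {\<omega> \<in> space M. \<not> \<bar>X t \<omega> - rational_bernstein qs t\<bar> \<le> of_rat r})"
      by (auto simp: E_def j)
    also have "\<dots> \<in> sets M"
    proof (intro sets.Diff sets.top sets.countable_UN'')
      show "countable ({0..1} \<inter> \<rat> :: real set)" by (simp add: countable_rat)
      fix t :: real assume "t \<in> {0..1} \<inter> \<rat>"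
      then have [measurable]: "X t \<in> borel_measurable M" using X by simp
      show "{\<omega> \<in> space M. \<not> \<bar>X t \<omega> - rational_bernstein qs t\<bar> \<le> of_rat r} \<in> sets M"
        by measurable
    qed
    finally show ?thesis .
  qed
  ultimately show "path01 X -` U \<inter> space M \<in> sets M"
    by (simp add: sets.countable_UN')
qed

section \<open>Continuous functionals near straight lines\<close>

definition line01 :: "real \<Rightarrow> real \<Rightarrow> real" where
  "line01 y = (\<lambda>t\<in>{0..1}. t * y)"

lemma line01_in_C01: "line01 y \<in> mspace C01"
  unfolding line01_def by (intro restrict_in_C01 continuous_intros)

text \<open>A continuous functional need not be uniformly continuous on bounded sets of paths. The
  lines with slopes in \<open>{-K..K}\<close>, however, form a compact set, and near a compact set
  one radius serves all points.\<close>

lemma continuous_near_line01: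
  assumes \<phi>: "continuous_map (mtopology_of C01) euclideanreal \<phi>" and e: "0 < e"
  obtains \<delta> where "0 < \<delta>"
    "\<And>f y. f \<in> mspace C01 \<Longrightarrow> \<bar>y\<bar> \<le> K \<Longrightarrow> (\<And>t. t \<in> {0..1} \<Longrightarrow> \<bar>f t - t * y\<bar> \<le> \<delta>) \<Longrightarrow>
      \<bar>\<phi> f - \<phi> (line01 y)\<bar> < e"
proof -
  have "\<exists>r>0. \<forall>f\<in>mspace C01. (\<forall>t\<in>{0..1}. \<bar>f t - t * y\<bar> \<le> r) \<longrightarrow> \<bar>\<phi> f - \<phi> (line01 y)\<bar> < e / 2" for y
  proof -
    let ?U = "{f \<in> topspace (mtopology_of C01). \<phi> f \<in> ball (\<phi> (line01 y)) (e / 2)}"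
    have "openin (mtopology_of C01) ?U"
      using \<phi> by (intro openin_continuous_map_preimage[of _ euclideanreal]) auto
    moreover have "line01 y \<in> ?U"
      using e line01_in_C01 by simp
    ultimately obtain r where r: "0 < r"
      "\<And>g. g \<in> mspace C01 \<Longrightarrow> (\<And>t. t \<in> {0..1} \<Longrightarrow> \<bar>line01 y t - g t\<bar> \<le> r) \<Longrightarrow> g \<in> ?U"
      using openin_C01_ball by blast
    show ?thesis
    proof (intro exI[of _ r] conjI ballI impI)
      fix f assume f: "f \<in> mspace C01" "\<forall>t\<in>{0..1}. \<bar>f t - t * y\<bar> \<le> r"
      then have "f \<in> ?U"
        by (intro r(2)) (auto simp: line01_def abs_minus_commute)
      then show "\<bar>\<phi> f - \<phi> (line01 y)\<bar> < e / 2"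
        by (simp add: dist_real_def abs_minus_commute)
    qed (rule r)
  qed
  then obtain r where r: "\<And>y. 0 < r y"
    "\<And>y f. f \<in> mspace C01 \<Longrightarrow> (\<And>t. t \<in> {0..1} \<Longrightarrow> \<bar>f t - t * y\<bar> \<le> r y) \<Longrightarrow> \<bar>\<phi> f - \<phi> (line01 y)\<bar> < e / 2"
    by metis
  \<comment> \<open>The slopes are covered at half the radius; the other half is left for the
    deviation \<delta> of the path from its own line.\<close>
  have cover: "{-K..K} \<subseteq> (\<Union>c\<in>{-K..K}. ball c (r c / 2))"
    using r(1) by force
  obtain C where C: "C \<subseteq> {-K..K}" "finite C" "{-K..K} \<subseteq> (\<Union>c\<in>C. ball c (r c / 2))"
    using compactE_image[OF compact_Icc _ cover] by blast
  \<comment> \<open>The inserted 1 keeps the set nonempty when \<open>K\<close> is negative and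
    there is no centre at all.\<close>
  define \<delta> where "\<delta> = Min (insert 1 ((\<lambda>c. r c / 2) ` C))"
  have \<delta>: "0 < \<delta>" "\<And>c. c \<in> C \<Longrightarrow> \<delta> \<le> r c / 2"
  proof -
    show "0 < \<delta>" using C(2) r(1) by (auto simp: \<delta>_def)
    show "\<delta> \<le> r c / 2" if "c \<in> C" for c
      unfolding \<delta>_def using C(2) that by (intro Min_le) auto
  qed
  show ?thesis
  proof (rule that[OF \<delta>(1)])
    fix f y assume f: "f \<in> mspace C01" and y: "\<bar>y\<bar> \<le> K" and fy: "\<And>t. t \<in> {0..1} \<Longrightarrow> \<bar>f t - t * y\<bar> \<le> \<delta>"
    have "y \<in> {-K..K}" using y by auto
    then obtain c where c: "c \<in> C" "dist c y < r c / 2" using C(3) by auto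
    have ty: "\<bar>t * y - t * c\<bar> \<le> r c / 2" if "t \<in> {0..1}" for t
    proof -
      have "\<bar>t * y - t * c\<bar> = \<bar>t\<bar> * dist c y"
        by (simp add: dist_real_def abs_mult[symmetric] algebra_simps abs_minus_commute)
      also have "\<dots> \<le> 1 * (r c / 2)"
        using that c by (intro mult_mono) auto
      finally show ?thesis by simp
    qed
    have "\<bar>\<phi> f - \<phi> (line01 c)\<bar> < e / 2"
    proof (rule r(2)[OF f])
      fix t :: real assume t: "t \<in> {0..1}"
      show "\<bar>f t - t * c\<bar> \<le> r c"
        using ty[OF t] fy[OF t] \<delta>(2)[OF c(1)] by linarith
    qed
    moreover have "\<bar>\<phi> (line01 y) - \<phi> (line01 c)\<bar> < e / 2"
    proof (rule r(2)[OF line01_in_C01])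
      fix t :: real assume t: "t \<in> {0..1}"
      show "\<bar>line01 y t - t * c\<bar> \<le> r c"
        using ty[OF t] t r(1)[of c] by (simp add: line01_def)
    qed
    ultimately show "\<bar>\<phi> f - \<phi> (line01 y)\<bar> < e" by linarith
  qed
qed

lemma continuous_on_line01:
  assumes \<phi>: "continuous_map (mtopology_of C01) euclideanreal \<phi>"
  shows "continuous_on UNIV (\<lambda>y. \<phi> (line01 y))"
  unfolding continuous_on_iff
proof (intro ballI allI impI)
  fix y e :: real assume e: "0 < e"
  obtain \<delta> where \<delta>: "0 < \<delta>"
    "\<And>f z. f \<in> mspace C01 \<Longrightarrow> \<bar>z\<bar> \<le> \<bar>y\<bar> \<Longrightarrow> (\<And>t. t \<in> {0..1} \<Longrightarrow> \<bar>f t - t * z\<bar> \<le> \<delta>) \<Longrightarrow>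
      \<bar>\<phi> f - \<phi> (line01 z)\<bar> < e"
    using continuous_near_line01[OF \<phi> e, of "\<bar>y\<bar>"] by blast
  show "\<exists>d>0. \<forall>x'\<in>UNIV. dist x' y < d \<longrightarrow> dist (\<phi> (line01 x')) (\<phi> (line01 y)) < e"
  proof (intro exI[of _ \<delta>] conjI ballI impI \<delta>(1))
    fix z assume z: "dist z y < \<delta>"
    show "dist (\<phi> (line01 z)) (\<phi> (line01 y)) < e"
      unfolding dist_real_def
    proof (rule \<delta>(2)[OF line01_in_C01])
      fix t :: real assume t: "t \<in> {0..1}"
      have "\<bar>t * z - t * y\<bar> = \<bar>t\<bar> * dist z y"
        by (simp add: dist_real_def abs_mult[symmetric] algebra_simps)
      also have "\<dots> \<le> 1 * \<delta>" using t z by (intro mult_mono) auto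
      finally show "\<bar>line01 z t - t * y\<bar> \<le> \<delta>" using t by (simp add: line01_def)
    qed simp
  qed
qed

text \<open>A Slutsky argument on a single probability space. Unless the slope exceeds
  \<open>K\<close> or the uniform deviation exceeds \<open>\<delta>\<close>, the functional changes
  by less than \<open>e / 4\<close>, and each exceptional event contributes at most another
  \<open>e / 4\<close>. The measurable function \<open>S i\<close> stands in for a supremum over
  uncountably many times.\<close>

lemma (in prob_space) weak_conv_line01:
  fixes X :: "'i \<Rightarrow> real \<Rightarrow> 'a \<Rightarrow> real" and W :: "'i \<Rightarrow> 'a \<Rightarrow> real" and S :: "'i \<Rightarrow> 'a \<Rightarrow> ennreal"
  assumes \<phi>: "continuous_map (mtopology_of C01) euclideanreal \<phi>" and bdd: "bounded (\<phi> ` mspace C01)"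
    and X[measurable]: "\<And>i. path01 (X i) \<in> measurable M borel_C01"
    and W[measurable]: "\<And>i. W i \<in> borel_measurable M"
    and S[measurable]: "\<And>i. S i \<in> borel_measurable M"
    and dev: "\<forall>\<^sub>F i in F. \<forall>\<omega>\<in>space M. \<forall>t\<in>{0..1}. ennreal ((X i t \<omega> - t * W i \<omega>)\<^sup>2) \<le> S i \<omega>"
    and lim: "((\<lambda>i. \<integral>\<^sup>+\<omega>. S i \<omega> \<partial>M) \<longlongrightarrow> 0) F"
    and tight: "\<forall>\<^sub>F i in F. (\<integral>\<^sup>+\<omega>. ennreal \<bar>W i \<omega>\<bar> \<partial>M) \<le> ennreal c"
  shows "((\<lambda>i. expectation (\<lambda>\<omega>. \<phi> (path01 (X i) \<omega>)) - expectation (\<lambda>\<omega>. \<phi> (line01 (W i \<omega>)))) \<longlongrightarrow> 0) F"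
proof (rule tendstoI)
  fix e :: real assume e: "0 < e"
  have [measurable]: "\<phi> \<in> borel_measurable borel_C01"
    by (rule borel_measurable_C01[OF \<phi>])
  have [measurable]: "(\<lambda>y. \<phi> (line01 y)) \<in> borel_measurable borel"
    by (intro borel_measurable_continuous_onI continuous_on_line01 \<phi>)
  obtain b where b: "0 < b" "\<And>f. f \<in> mspace C01 \<Longrightarrow> \<bar>\<phi> f\<bar> \<le> b"
    using bdd unfolding bounded_pos by auto
  have path: "path01 (X i) \<omega> \<in> mspace C01" if "\<omega> \<in> space M" for i \<omega>
    using measurable_space[OF X that] by (simp add: space_borel_C01)
  have int1: "integrable M (\<lambda>\<omega>. \<phi> (path01 (X i) \<omega>))" for i
    using b path by (intro integrable_const_bound[where B = b]) auto
  have int2: "integrable M (\<lambda>\<omega>. \<phi> (line01 (W i \<omega>)))" for i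
    using b line01_in_C01 by (intro integrable_const_bound[where B = b]) auto
  \<comment> \<open>Chosen so that large slopes contribute
    \<open>2 * b / K * (\<bar>c\<bar> + 1) = e / 4\<close>; \<open>\<bar>c\<bar> + 1\<close> is a
    positive upper bound of \<open>c\<close>.\<close>
  define K where "K = 8 * b * (\<bar>c\<bar> + 1) / e"
  have K: "0 < K" using b e by (simp add: K_def)
  obtain \<delta> where \<delta>: "0 < \<delta>"
    "\<And>f y. f \<in> mspace C01 \<Longrightarrow> \<bar>y\<bar> \<le> K \<Longrightarrow> (\<And>t. t \<in> {0..1} \<Longrightarrow> \<bar>f t - t * y\<bar> \<le> \<delta>) \<Longrightarrow>
      \<bar>\<phi> f - \<phi> (line01 y)\<bar> < e / 4"
    using continuous_near_line01[OF \<phi>, of "e / 4" K] e by auto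
  \<comment> \<open>Below this threshold for the mean of \<open>S i\<close>, Markov's factor
    \<open>2 * b / \<delta>^2\<close> leaves a contribution of at most \<open>e / 4\<close>.\<close>
  have "0 < ennreal (e / 4 / (2 * b / \<delta>\<^sup>2))" using e b \<delta> by simp
  then have ev: "\<forall>\<^sub>F i in F. (\<integral>\<^sup>+\<omega>. S i \<omega> \<partial>M) < ennreal (e / 4 / (2 * b / \<delta>\<^sup>2))"
    by (rule order_tendstoD(2)[OF lim])
  show "\<forall>\<^sub>F i in F. dist (expectation (\<lambda>\<omega>. \<phi> (path01 (X i) \<omega>)) - expectation (\<lambda>\<omega>. \<phi> (line01 (W i \<omega>)))) 0 < e"
    using ev dev tight
  proof eventually_elim
    case (elim i)
    let ?d = "\<lambda>\<omega>. \<phi> (path01 (X i) \<omega>) - \<phi> (line01 (W i \<omega>))"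
    \<comment> \<open>on the exceptional events the difference is at most 2b, which Markov's inequality bounds pointwise\<close>
    have pw: "ennreal \<bar>?d \<omega>\<bar> \<le> ennreal (e / 4) + ennreal (2 * b / K) * ennreal \<bar>W i \<omega>\<bar> + ennreal (2 * b / \<delta>\<^sup>2) * S i \<omega>"
      if \<omega>: "\<omega> \<in> space M" for \<omega>
    proof -
      have 2: "\<bar>?d \<omega>\<bar> \<le> 2 * b"
        using b(2)[OF path[OF \<omega>, of i]] b(2)[OF line01_in_C01, of "W i \<omega>"] by linarith
      consider "K < \<bar>W i \<omega>\<bar>" | "ennreal (\<delta>\<^sup>2) \<le> S i \<omega>" | "\<bar>W i \<omega>\<bar> \<le> K" "S i \<omega> < ennreal (\<delta>\<^sup>2)" by force
      then show ?thesis
      proof cases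
        case 1
        have "ennreal \<bar>?d \<omega>\<bar> \<le> ennreal (2 * b / K * \<bar>W i \<omega>\<bar>)"
          using 1 2 K b by (intro ennreal_leI order_trans[OF 2]) (simp add: field_simps)
        also have "\<dots> = ennreal (2 * b / K) * ennreal \<bar>W i \<omega>\<bar>"
          using K b by (intro ennreal_mult) auto
        also have "\<dots> \<le> ennreal (e / 4) + ennreal (2 * b / K) * ennreal \<bar>W i \<omega>\<bar> + ennreal (2 * b / \<delta>\<^sup>2) * S i \<omega>"
          by (simp add: add_increasing2 add_increasing)
        finally show ?thesis .
      next
        case 2
        have "ennreal \<bar>?d \<omega>\<bar> \<le> ennreal (2 * b / \<delta>\<^sup>2 * \<delta>\<^sup>2)"
          using \<open>\<bar>?d \<omega>\<bar> \<le> 2 * b\<close> \<delta> by (intro ennreal_leI) simp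
        also have "\<dots> = ennreal (2 * b / \<delta>\<^sup>2) * ennreal (\<delta>\<^sup>2)"
          using b by (intro ennreal_mult) auto
        also have "\<dots> \<le> ennreal (2 * b / \<delta>\<^sup>2) * S i \<omega>"
          by (intro mult_left_mono 2) simp
        also have "\<dots> \<le> ennreal (e / 4) + ennreal (2 * b / K) * ennreal \<bar>W i \<omega>\<bar> + ennreal (2 * b / \<delta>\<^sup>2) * S i \<omega>"
          by (simp add: add_increasing)
        finally show ?thesis .
      next
        case 3
        have "\<bar>?d \<omega>\<bar> < e / 4"
        proof (rule \<delta>(2)[OF path[OF \<omega>] 3(1)])
          fix t :: real assume t: "t \<in> {0..1}"
          have "ennreal ((X i t \<omega> - t * W i \<omega>)\<^sup>2) < ennreal (\<delta>\<^sup>2)"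
            using elim(2) \<omega> t 3(2) by (meson le_less_trans)
          then have "(X i t \<omega> - t * W i \<omega>)\<^sup>2 \<le> \<delta>\<^sup>2"
            by (simp add: ennreal_less_iff)
          then show "\<bar>path01 (X i) \<omega> t - t * W i \<omega>\<bar> \<le> \<delta>"
            using \<delta>(1) t by (simp add: path01_def abs_le_square_iff[symmetric])
        qed
        then have "ennreal \<bar>?d \<omega>\<bar> \<le> ennreal (e / 4)" by (intro ennreal_leI) simp
        also have "\<dots> \<le> ennreal (e / 4) + ennreal (2 * b / K) * ennreal \<bar>W i \<omega>\<bar> + ennreal (2 * b / \<delta>\<^sup>2) * S i \<omega>"
          by (simp add: add_increasing2)
        finally show ?thesis .
      qed
    qed
    have "ennreal \<bar>expectation ?d\<bar> \<le> (\<integral>\<^sup>+\<omega>. ennreal (norm (?d \<omega>)) \<partial>M)"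
      using integral_norm_bound_ennreal[of M ?d] int1 int2 by simp
    also have "\<dots> \<le> (\<integral>\<^sup>+\<omega>. ennreal (e / 4) + ennreal (2 * b / K) * ennreal \<bar>W i \<omega>\<bar> + ennreal (2 * b / \<delta>\<^sup>2) * S i \<omega> \<partial>M)"
      by (intro nn_integral_mono) (use pw in simp)
    also have "\<dots> = ennreal (e / 4) + ennreal (2 * b / K) * (\<integral>\<^sup>+\<omega>. ennreal \<bar>W i \<omega>\<bar> \<partial>M) +
        ennreal (2 * b / \<delta>\<^sup>2) * (\<integral>\<^sup>+\<omega>. S i \<omega> \<partial>M)"
      by (simp add: nn_integral_add nn_integral_cmult emeasure_space_1)
    also have "\<dots> \<le> ennreal (e / 4) + ennreal (2 * b / K) * ennreal (\<bar>c\<bar> + 1) +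
        ennreal (2 * b / \<delta>\<^sup>2) * ennreal (e / 4 / (2 * b / \<delta>\<^sup>2))"
      using elim(1) order_trans[OF elim(3) ennreal_leI[of c "\<bar>c\<bar> + 1"]]
      by (intro add_mono mult_left_mono) (simp_all add: less_imp_le del: ennreal_plus)
    also have "\<dots> = ennreal (e / 4 + 2 * b / K * (\<bar>c\<bar> + 1) + 2 * b / \<delta>\<^sup>2 * (e / 4 / (2 * b / \<delta>\<^sup>2)))"
      using e b K \<delta> by (subst ennreal_mult[symmetric], simp, simp)+ (simp add: ennreal_plus[symmetric] del: ennreal_plus)
    also have "2 * b / K * (\<bar>c\<bar> + 1) = e / 4"
    proof -
      have "2 * b / (8 * b * d / e) * d = e / 4" if "0 < d" for d
        using b e that by (simp add: field_simps)
      from this[of "\<bar>c\<bar> + 1"] show ?thesis by (simp add: K_def)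
    qed
    also have "2 * b / \<delta>\<^sup>2 * (e / 4 / (2 * b / \<delta>\<^sup>2)) = e / 4"
      using b \<delta> by (simp add: field_simps)
    finally have "\<bar>expectation ?d\<bar> \<le> e / 4 + e / 4 + e / 4"
      using e by (subst (asm) ennreal_le_iff) auto
    then show ?case
      using e int1 int2 by simp
  qed
qed

section \<open>Chaining\<close>

text \<open>Increments of order \<open>(t - s)\<^sup>3\<^sup>/\<^sup>2\<close> in mean square allow any weight in \<open>(1, \<surd>2)\<close> for the dyadic
  levels; \<open>100/81\<close> has a rational square root.\<close>

lemma dyadic_chaining:
  fixes f :: "real \<Rightarrow> real"
  assumes f: "continuous_on {0..1} f" and S: "0 \<le> S"
    and inc: "\<And>j k. k < 2 ^ j \<Longrightarrow>
      (f (real (Suc k) / 2 ^ j) - f (real k / 2 ^ j))\<^sup>2 * (100 / 81) ^ j \<le> S"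
    and t: "t \<in> {0..1}"
  shows "(f t - f 0)\<^sup>2 \<le> 100 * S"
proof -
  define c where "c = sqrt S"
  have c: "0 \<le> c" "c\<^sup>2 = S" using S by (simp_all add: c_def)
  \<comment> \<open>Taking roots turns the weight 100/81 per level into the decay 9/10 of the
    increments.\<close>
  have inc': "\<bar>f (real (Suc k) / 2 ^ j) - f (real k / 2 ^ j)\<bar> \<le> c * (9/10) ^ j" if "k < 2 ^ j" for j k
  proof -
    have "((f (real (Suc k) / 2 ^ j) - f (real k / 2 ^ j)) * (10/9) ^ j)\<^sup>2 \<le> c\<^sup>2"
    proof -
      have "((10/9 :: real) ^ j)\<^sup>2 = (100 / 81) ^ j"
        by (simp add: power2_eq_square power_mult_distrib[symmetric])
      then show ?thesis using inc[OF that] by (simp only: c power_mult_distrib)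
    qed
    then have "\<bar>f (real (Suc k) / 2 ^ j) - f (real k / 2 ^ j)\<bar> * (10/9) ^ j \<le> c"
      using c(1) by (simp only: abs_le_square_iff[symmetric] abs_mult abs_of_nonneg power_abs abs_divide abs_numeral)
    then have "\<bar>f (real (Suc k) / 2 ^ j) - f (real k / 2 ^ j)\<bar> * (10/9) ^ j * (9/10) ^ j \<le> c * (9/10) ^ j"
      by (intro mult_right_mono) auto
    then show ?thesis by (simp add: mult.assoc power_mult_distrib[symmetric])
  qed
  \<comment> \<open>Passing from \<open>k\<close> to \<open>k div 2\<close> leads to a point of the
    next coarser grid across at most one increment, so a point of level \<open>n\<close> is reached
    from 0 with at most one increment per level.\<close>
  have grid: "\<bar>f (real k / 2 ^ n) - f 0\<bar> \<le> c * (\<Sum>j\<le>n. (9/10) ^ j)" if "k \<le> 2 ^ n" for n k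
    using that
  proof (induction n arbitrary: k)
    case 0
    then consider "k = 0" | "k = 1" by fastforce
    then show ?case
      using inc'[of 0 0] c by cases simp_all
  next
    case (Suc n)
    define k' where "k' = k div 2"
    have k': "k' \<le> 2 ^ n" using Suc.prems by (simp add: k'_def)
    have e: "real (2 * k') / 2 ^ Suc n = real k' / 2 ^ n" by simp
    have geo: "c * (\<Sum>j\<le>Suc n. (9/10) ^ j) = c * (\<Sum>j\<le>n. (9/10) ^ j) + c * (9/10) ^ Suc n"
      by (simp add: distrib_left)
    show ?case
    proof (cases "even k")
      case True
      then have "k = 2 * k'" by (simp add: k'_def)
      then have "\<bar>f (real k / 2 ^ Suc n) - f 0\<bar> \<le> c * (\<Sum>j\<le>n. (9/10) ^ j)"
        using Suc.IH[OF k'] by (simp only: e)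
      then show ?thesis using c unfolding geo by (simp add: add_increasing2)
    next
      case False
      then have k: "k = Suc (2 * k')" by (simp add: k'_def)
      then have "2 * k' < 2 ^ Suc n" using Suc.prems by simp
      from inc'[OF this] have "\<bar>f (real k / 2 ^ Suc n) - f (real k' / 2 ^ n)\<bar> \<le> c * (9/10) ^ Suc n"
        unfolding k e .
      then show ?thesis using Suc.IH[OF k'] unfolding geo by linarith
    qed
  qed
  \<comment> \<open>The whole geometric series has the sum 10, and its square is the 100 in the
    conclusion.\<close>
  have geo: "(\<Sum>j\<le>n. (9/10 :: real) ^ j) \<le> 10" for n
  proof -
    have "(\<Sum>j\<le>n. (9/10 :: real) ^ j) = (1 - (9/10) ^ Suc n) * 10"
      by (simp add: sum_gp0)
    then show ?thesis by simp
  qed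
  define s where "s n = real (nat \<lfloor>t * 2 ^ n\<rfloor>) / 2 ^ n" for n
  have s: "0 \<le> s n" "s n \<le> t" "t - (1/2) ^ n \<le> s n" "nat \<lfloor>t * 2 ^ n\<rfloor> \<le> 2 ^ n" for n
  proof -
    have n: "real (nat \<lfloor>t * 2 ^ n\<rfloor>) = real_of_int \<lfloor>t * 2 ^ n\<rfloor>" using t by simp
    show "0 \<le> s n" by (simp add: s_def)
    have "real (nat \<lfloor>t * 2 ^ n\<rfloor>) \<le> t * 2 ^ n" unfolding n by simp
    then show "s n \<le> t" by (simp add: s_def field_simps)
    have "t * 2 ^ n - 1 \<le> real (nat \<lfloor>t * 2 ^ n\<rfloor>)" unfolding n by linarith
    then have "(t * 2 ^ n - 1) / 2 ^ n \<le> s n" unfolding s_def by (intro divide_right_mono) auto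
    then show "t - (1/2) ^ n \<le> s n" by (simp add: diff_divide_distrib power_divide)
    have "real (nat \<lfloor>t * 2 ^ n\<rfloor>) \<le> 1 * 2 ^ n"
      using \<open>real (nat \<lfloor>t * 2 ^ n\<rfloor>) \<le> t * 2 ^ n\<close> t by (elim order_trans) (intro mult_right_mono, auto)
    then have "real (nat \<lfloor>t * 2 ^ n\<rfloor>) \<le> real (2 ^ n)" by simp
    then show "nat \<lfloor>t * 2 ^ n\<rfloor> \<le> 2 ^ n" by (simp only: of_nat_le_iff)
  qed
  have "(\<lambda>n. t - (1/2) ^ n) \<longlonglongrightarrow> t - 0"
    by (intro tendsto_diff tendsto_const LIMSEQ_realpow_zero) auto
  then have "s \<longlonglongrightarrow> t"
    using s by (intro tendsto_sandwich[of "\<lambda>n. t - (1/2) ^ n" s sequentially "\<lambda>_. t"]) auto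
  moreover have "s n \<in> {0..1}" for n
    using s(1,2)[of n] t by (meson atLeastAtMost_iff order_trans)
  ultimately have "(\<lambda>n. f (s n)) \<longlonglongrightarrow> f t"
    using t by (intro continuous_on_tendsto_compose[OF f]) auto
  then have lim: "(\<lambda>n. \<bar>f (s n) - f 0\<bar>) \<longlonglongrightarrow> \<bar>f t - f 0\<bar>"
    by (intro tendsto_intros)
  have "\<bar>f (s n) - f 0\<bar> \<le> c * 10" for n
  proof -
    have "\<bar>f (s n) - f 0\<bar> \<le> c * (\<Sum>j\<le>n. (9/10) ^ j)"
      unfolding s_def by (rule grid[OF s(4)])
    also have "\<dots> \<le> c * 10" by (intro mult_left_mono geo c)
    finally show ?thesis .
  qed
  then have "\<bar>f t - f 0\<bar> \<le> c * 10"
    by (intro LIMSEQ_le_const2[OF lim]) auto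
  then have "\<bar>f t - f 0\<bar>\<^sup>2 \<le> (c * 10)\<^sup>2"
    by (intro power_mono) auto
  then show ?thesis by (simp add: power_mult_distrib c)
qed

text \<open>\<open>S\<close> is 100 times the weighted sum of all squared dyadic increments; it
  dominates every time at once, is measurable, and its mean is a sum of means. Level
  \<open>j\<close> has \<open>2 ^ j\<close> intervals with means
  \<open>\<eta> * (1 / 2 ^ j * sqrt (1 / 2 ^ j))\<close>, so the weighted level sums decay
  geometrically. The 1000 is the 100 of the chaining bound times the sum 10 of the series.\<close>

lemma continuous_process_sup_bound:
  fixes X :: "real \<Rightarrow> 'a \<Rightarrow> real"
  assumes X[measurable]: "\<And>t. t \<in> {0..1} \<Longrightarrow> X t \<in> borel_measurable M"
    and cont: "\<And>\<omega>. \<omega> \<in> space M \<Longrightarrow> continuous_on {0..1} (\<lambda>t. X t \<omega>)"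
    and \<eta>: "0 \<le> \<eta>"
    and inc: "\<And>s t. 0 \<le> s \<Longrightarrow> s \<le> t \<Longrightarrow> t \<le> 1 \<Longrightarrow>
      (\<integral>\<^sup>+\<omega>. ennreal ((X t \<omega> - X s \<omega>)\<^sup>2) \<partial>M) \<le> ennreal (\<eta> * ((t - s) * sqrt (t - s)))"
  obtains S where "S \<in> borel_measurable M" "(\<integral>\<^sup>+\<omega>. S \<omega> \<partial>M) \<le> ennreal (1000 * \<eta>)"
    "\<And>\<omega> t. \<omega> \<in> space M \<Longrightarrow> t \<in> {0..1} \<Longrightarrow> ennreal ((X t \<omega> - X 0 \<omega>)\<^sup>2) \<le> S \<omega>"
proof -
  define D where "D j k \<omega> = ennreal ((X (real (Suc k) / 2 ^ j) \<omega> - X (real k / 2 ^ j) \<omega>)\<^sup>2)" for j k :: nat and \<omega>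
  define S where "S \<omega> = (\<Sum>j. ennreal ((100 / 81) ^ j) * (\<Sum>k<2 ^ j. D j k \<omega>))" for \<omega>
  have grid: "0 \<le> real k / 2 ^ j" "real k / 2 ^ j \<le> real (Suc k) / 2 ^ j" "real (Suc k) / 2 ^ j \<le> 1"
    if "k < 2 ^ j" for j k :: nat
  proof -
    have "real (Suc k) \<le> real (2 ^ j)" using that by (simp only: of_nat_le_iff Suc_le_eq)
    then show "real (Suc k) / 2 ^ j \<le> 1" by (simp add: divide_le_eq_1)
  qed (simp_all add: divide_right_mono)
  have D[measurable]: "D j k \<in> borel_measurable M" if "k < 2 ^ j" for j k
  proof -
    have [measurable]: "X (real (Suc k) / 2 ^ j) \<in> borel_measurable M" "X (real k / 2 ^ j) \<in> borel_measurable M"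
      using grid[OF that] by (auto intro!: X simp del: of_nat_Suc)
    show ?thesis unfolding D_def by measurable
  qed
  have S_meas: "S \<in> borel_measurable M"
    unfolding S_def by measurable
  have "(\<integral>\<^sup>+\<omega>. S \<omega> \<partial>M) = (\<Sum>j. \<integral>\<^sup>+\<omega>. ennreal ((100 / 81) ^ j) * (\<Sum>k<2 ^ j. D j k \<omega>) \<partial>M)"
    unfolding S_def by (rule nn_integral_suminf) measurable
  also have "\<dots> = (\<Sum>j. ennreal ((100 / 81) ^ j) * (\<Sum>k<2 ^ j. \<integral>\<^sup>+\<omega>. D j k \<omega> \<partial>M))"
  proof (rule suminf_cong)
    fix j
    have "(\<integral>\<^sup>+\<omega>. ennreal ((100 / 81) ^ j) * (\<Sum>k<2 ^ j. D j k \<omega>) \<partial>M) =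
        ennreal ((100 / 81) ^ j) * (\<integral>\<^sup>+\<omega>. (\<Sum>k<2 ^ j. D j k \<omega>) \<partial>M)"
      by (rule nn_integral_cmult) measurable
    also have "(\<integral>\<^sup>+\<omega>. (\<Sum>k<2 ^ j. D j k \<omega>) \<partial>M) = (\<Sum>k<2 ^ j. \<integral>\<^sup>+\<omega>. D j k \<omega> \<partial>M)"
      by (rule nn_integral_sum) measurable
    finally show "(\<integral>\<^sup>+\<omega>. ennreal ((100 / 81) ^ j) * (\<Sum>k<2 ^ j. D j k \<omega>) \<partial>M) =
      ennreal ((100 / 81) ^ j) * (\<Sum>k<2 ^ j. \<integral>\<^sup>+\<omega>. D j k \<omega> \<partial>M)" .
  qed
  also have "\<dots> \<le> (\<Sum>j. ennreal (\<eta> * (9/10) ^ j))"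
  proof (intro suminf_le)
    fix j :: nat
    \<comment> \<open>This gives the ratio
      \<open>100 / 81 * sqrt (1/2) \<le> 71 / 81 < 9 / 10\<close> between successive levels.\<close>
    have s2: "sqrt (1/2) \<le> 71 / 100"
      by (rule real_le_lsqrt) (simp_all add: power2_eq_square)
    have "(\<Sum>k<2 ^ j. \<integral>\<^sup>+\<omega>. D j k \<omega> \<partial>M) \<le> (\<Sum>k<(2::nat) ^ j. ennreal (\<eta> * (1 / 2 ^ j * sqrt (1 / 2 ^ j))))"
    proof (rule sum_mono)
      fix k :: nat assume "k \<in> {..<2 ^ j}"
      then have k: "k < 2 ^ j" by simp
      have "(\<integral>\<^sup>+\<omega>. D j k \<omega> \<partial>M) \<le> ennreal (\<eta> * ((real (Suc k) / 2 ^ j - real k / 2 ^ j) *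
          sqrt (real (Suc k) / 2 ^ j - real k / 2 ^ j)))"
        unfolding D_def by (rule inc[OF grid[OF k]])
      also have "real (Suc k) / 2 ^ j - real k / 2 ^ j = 1 / 2 ^ j"
        by (simp add: diff_divide_distrib[symmetric])
      finally show "(\<integral>\<^sup>+\<omega>. D j k \<omega> \<partial>M) \<le> ennreal (\<eta> * (1 / 2 ^ j * sqrt (1 / 2 ^ j)))" .
    qed
    also have "\<dots> = ennreal (2 ^ j * (\<eta> * (1 / 2 ^ j * sqrt (1 / 2 ^ j))))"
      using \<eta> by (simp add: ennreal_of_nat_eq_real_of_nat ennreal_mult'[symmetric])
    also have "2 ^ j * (\<eta> * (1 / 2 ^ j * sqrt (1 / 2 ^ j))) = \<eta> * sqrt (1/2) ^ j"
      by (simp add: real_sqrt_power[symmetric] power_divide real_sqrt_divide)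
    finally have "ennreal ((100 / 81) ^ j) * (\<Sum>k<2 ^ j. \<integral>\<^sup>+\<omega>. D j k \<omega> \<partial>M) \<le>
        ennreal ((100 / 81) ^ j) * ennreal (\<eta> * sqrt (1/2) ^ j)"
      by (rule mult_left_mono) simp
    also have "\<dots> = ennreal ((100 / 81) ^ j * (\<eta> * sqrt (1/2) ^ j))"
      using \<eta> by (intro ennreal_mult[symmetric]) auto
    also have "(100 / 81) ^ j * (\<eta> * sqrt (1/2) ^ j) = \<eta> * (100 / 81 * sqrt (1/2)) ^ j"
      by (simp only: power_mult_distrib mult_ac)
    also have "\<dots> \<le> ennreal (\<eta> * (9/10) ^ j)"
      using s2 \<eta> by (intro ennreal_leI mult_left_mono power_mono) auto
    finally show "ennreal ((100 / 81) ^ j) * (\<Sum>k<2 ^ j. \<integral>\<^sup>+\<omega>. D j k \<omega> \<partial>M) \<le> ennreal (\<eta> * (9/10) ^ j)" .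
  qed auto
  also have "\<dots> = ennreal (10 * \<eta>)"
  proof -
    have "(\<lambda>j. \<eta> * (9/10) ^ j) sums (\<eta> * (1 / (1 - 9/10)))"
      by (intro sums_mult geometric_sums) simp
    then show ?thesis
      using \<eta> by (intro suminf_ennreal_eq) (auto simp: mult.commute)
  qed
  finally have S_int: "(\<integral>\<^sup>+\<omega>. S \<omega> \<partial>M) \<le> ennreal (10 * \<eta>)" .
  show ?thesis
  proof (rule that[of "\<lambda>\<omega>. 100 * S \<omega>"])
    show "(\<lambda>\<omega>. 100 * S \<omega>) \<in> borel_measurable M" using S_meas by measurable
    have "(\<integral>\<^sup>+\<omega>. 100 * S \<omega> \<partial>M) = 100 * (\<integral>\<^sup>+\<omega>. S \<omega> \<partial>M)"
      using S_meas by (intro nn_integral_cmult)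
    also have "\<dots> \<le> 100 * ennreal (10 * \<eta>)" by (intro mult_left_mono S_int) simp
    also have "\<dots> = ennreal (1000 * \<eta>)"
      by (subst ennreal_numeral[symmetric], subst ennreal_mult'[symmetric]) simp_all
    finally show "(\<integral>\<^sup>+\<omega>. 100 * S \<omega> \<partial>M) \<le> ennreal (1000 * \<eta>)" .
    fix \<omega> t assume \<omega>: "\<omega> \<in> space M" and t: "t \<in> {0..1 :: real}"
    show "ennreal ((X t \<omega> - X 0 \<omega>)\<^sup>2) \<le> 100 * S \<omega>"
    proof (cases "S \<omega>")
      case (real r)
      have "(X t \<omega> - X 0 \<omega>)\<^sup>2 \<le> 100 * r"
      proof (rule dyadic_chaining[OF cont[OF \<omega>] real(1) _ t])
        fix j k :: nat assume k: "k < 2 ^ j"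
        have "ennreal ((X (real (Suc k) / 2 ^ j) \<omega> - X (real k / 2 ^ j) \<omega>)\<^sup>2 * (100 / 81) ^ j) =
            ennreal ((100 / 81) ^ j) * D j k \<omega>"
          by (simp add: D_def ennreal_mult' mult.commute)
        also have "\<dots> \<le> ennreal ((100 / 81) ^ j) * (\<Sum>k<2 ^ j. D j k \<omega>)"
          using k by (intro mult_left_mono member_le_sum) auto
        also have "\<dots> \<le> S \<omega>"
          unfolding S_def using sum_le_suminf[of "\<lambda>j. ennreal ((100 / 81) ^ j) * (\<Sum>k<2 ^ j. D j k \<omega>)" "{j}"]
          by simp
        finally show "(X (real (Suc k) / 2 ^ j) \<omega> - X (real k / 2 ^ j) \<omega>)\<^sup>2 * (100 / 81) ^ j \<le> r"
          using real by (simp del: of_nat_Suc)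
      qed
      then have "ennreal ((X t \<omega> - X 0 \<omega>)\<^sup>2) \<le> ennreal (100 * r)" by (rule ennreal_leI)
      then show ?thesis using real by (simp add: ennreal_mult')
    qed (simp add: ennreal_mult_top)
  qed
qed

section \<open>Discretization of the power tails\<close>

text \<open>Cells of length \<open>1 / n\<close>, numbered leftwards from -1. The first
  \<open>n * n\<close> of them cover the window from \<open>-1 - n\<close> to -1, so that one
  parameter drives both the refinement and the exhaustion of the half-line.\<close>

definition mesh_cell :: "nat \<Rightarrow> nat \<Rightarrow> real set" where
  "mesh_cell n k = {-1 - real (Suc k) / real n ..< -1 - real k / real n}"

text \<open>The power at the left end of the cell, the one farther from 0. For exponents
  \<open>g \<le> 0\<close> this keeps the step function below \<open>power_tail\<close>, which then
  is a dominating function.\<close>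

definition mesh_value :: "real \<Rightarrow> nat \<Rightarrow> nat \<Rightarrow> real" where
  "mesh_value g n k = (1 + real (Suc k) / real n) powr g"

definition mesh_step :: "real \<Rightarrow> nat \<Rightarrow> real \<Rightarrow> real" where
  "mesh_step g n x = (\<Sum>k<n * n. mesh_value g n k * indicator (mesh_cell n k) x)"

lemma mesh_cell_sets [measurable]: "mesh_cell n k \<in> sets borel"
  by (simp add: mesh_cell_def)

lemma emeasure_mesh_cell: "emeasure lborel (mesh_cell n k) = ennreal (1 / real n)"
proof -
  have "- 1 - real k / real n - (- 1 - real (Suc k) / real n) = 1 / real n"
    by (simp add: add_divide_distrib)
  then show ?thesis
    unfolding mesh_cell_def by (subst emeasure_lborel_Ico) (auto simp: divide_right_mono simp del: of_nat_Suc)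
qed

text \<open>Membership in the half-open cell amounts to \<open>k < (-1 - x) * n \<le> k + 1\<close>,
  which the ceiling solves for \<open>k\<close>. Disjointness and the evaluation of sums over cells
  rest on this explicit index.\<close>

lemma mesh_cell_eq:
  assumes n: "0 < n"
  shows "x \<in> mesh_cell n k \<longleftrightarrow> k = nat (\<lceil>(-1 - x) * real n\<rceil> - 1) \<and> x < -1"
proof -
  have "x \<in> mesh_cell n k \<longleftrightarrow> real k < (-1 - x) * real n \<and> (-1 - x) * real n \<le> real (Suc k)"
    using n by (auto simp: mesh_cell_def field_simps)
  also have "\<dots> \<longleftrightarrow> \<lceil>(-1 - x) * real n\<rceil> = int k + 1"
    by (simp only: ceiling_eq_iff) (simp add: add.commute)
  also have "\<dots> \<longleftrightarrow> k = nat (\<lceil>(-1 - x) * real n\<rceil> - 1) \<and> 0 < \<lceil>(-1 - x) * real n\<rceil>"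
    by linarith
  also have "0 < \<lceil>(-1 - x) * real n\<rceil> \<longleftrightarrow> x < -1"
    using n by (simp add: zero_less_ceiling zero_less_mult_iff)
  finally show ?thesis .
qed

lemma mesh_cell_disjoint:
  assumes "0 < n" "k \<noteq> l"
  shows "mesh_cell n k \<inter> mesh_cell n l = {}"
  using assms by (auto simp: mesh_cell_eq)

lemma mesh_cell_sum:
  assumes n: "0 < n"
  shows "(\<Sum>k<n * n. c k * indicator (mesh_cell n k) x) =
    (let k = nat (\<lceil>(-1 - x) * real n\<rceil> - 1) in if x < -1 \<and> k < n * n then c k else (0 :: real))"
proof -
  let ?k = "nat (\<lceil>(-1 - x) * real n\<rceil> - 1)"
  have "(\<Sum>k<n * n. c k * indicator (mesh_cell n k) x) = (\<Sum>k<n * n. if k = ?k then (if x < -1 then c k else 0) else 0)"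
    by (intro sum.cong) (auto simp: indicator_def mesh_cell_eq[OF n])
  also have "\<dots> = (if ?k \<in> {..<n * n} then if x < -1 then c ?k else 0 else 0)"
    by (rule sum.delta) simp
  finally show ?thesis by (simp add: Let_def)
qed

lemma mesh_step_measurable [measurable]: "mesh_step g n \<in> borel_measurable borel"
  unfolding mesh_step_def by measurable

lemma mesh_step_mult:
  assumes n: "0 < n"
  shows "mesh_step g n x * mesh_step h n x =
    (\<Sum>k<n * n. mesh_value g n k * mesh_value h n k * indicator (mesh_cell n k) x)"
  unfolding mesh_step_def mesh_cell_sum[OF n] by (simp add: Let_def)

lemma mesh_step_nonneg: "0 \<le> mesh_step g n x"
  unfolding mesh_step_def mesh_value_def by (intro sum_nonneg) simp

text \<open>The left end of the cell that contains \<open>x\<close> has a distance between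
  \<open>- x\<close> and \<open>- x + 1 / n\<close> from 0, and the power is decreasing. For the
  lower bound \<open>x\<close> has to lie in the window that the cells cover.\<close>

lemma mesh_step_bounds:
  assumes n: "0 < n" and g: "g \<le> 0"
  shows "mesh_step g n x \<le> power_tail g x"
    and "x < -1 \<Longrightarrow> -1 - real n \<le> x \<Longrightarrow> (- x + 1 / real n) powr g \<le> mesh_step g n x"
proof -
  define k where "k = nat (\<lceil>(-1 - x) * real n\<rceil> - 1)"
  have m: "mesh_step g n x = (if x < -1 \<and> k < n * n then mesh_value g n k else 0)"
    unfolding mesh_step_def mesh_cell_sum[OF n] by (simp add: Let_def k_def)
  have b: "- x \<le> 1 + real (Suc k) / real n" "1 + real (Suc k) / real n \<le> - x + 1 / real n" if "x < -1"
  proof -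
    have "x \<in> mesh_cell n k" using that by (simp add: mesh_cell_eq[OF n] k_def)
    then show "- x \<le> 1 + real (Suc k) / real n" "1 + real (Suc k) / real n \<le> - x + 1 / real n"
      by (simp_all add: mesh_cell_def add_divide_distrib)
  qed
  show "mesh_step g n x \<le> power_tail g x"
    unfolding m power_tail_def mesh_value_def using b(1) g
    by (auto intro!: powr_mono2' simp del: of_nat_Suc)
  assume x: "x < -1" "-1 - real n \<le> x"
  have "(-1 - x) * real n \<le> real n * real n"
    using x by (intro mult_right_mono) auto
  then have "\<lceil>(-1 - x) * real n\<rceil> \<le> int (n * n)"
    by (simp add: ceiling_le_iff)
  moreover have "0 < n * n" using n by simp
  ultimately have "k < n * n"
    unfolding k_def by linarith
  moreover have "(- x + 1 / real n) powr g \<le> mesh_value g n k"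
    unfolding mesh_value_def using b[OF x(1)] g x n by (intro powr_mono2') auto
  ultimately show "(- x + 1 / real n) powr g \<le> mesh_step g n x"
    using x by (simp add: m)
qed

lemma mesh_step_tendsto:
  assumes g: "g \<le> 0"
  shows "(\<lambda>n. mesh_step g n x) \<longlonglongrightarrow> power_tail g x"
proof (cases "x < -1")
  case False
  then have "mesh_step g n x = 0" if "0 < n" for n
    unfolding mesh_step_def mesh_cell_sum[OF that] by simp
  then have "\<forall>\<^sub>F n in sequentially. mesh_step g n x = power_tail g x"
    using False by (auto simp: power_tail_def intro!: eventually_sequentiallyI[of 1])
  then show ?thesis by (rule tendsto_eventually)
next
  case True
  have "(\<lambda>n. (- x + 1 / real n) powr g) \<longlonglongrightarrow> (- x + 0) powr g"
    using True by (intro tendsto_intros lim_1_over_n) auto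
  then have l: "(\<lambda>n. (- x + 1 / real n) powr g) \<longlonglongrightarrow> power_tail g x"
    using True by (simp add: power_tail_def)
  have ev: "\<forall>\<^sub>F n in sequentially. 0 < n \<and> - 1 - x \<le> real n"
    by (intro eventually_conj eventually_gt_at_top)
      (meson eventually_sequentiallyI of_nat_le_iff order_trans real_arch_simple)
  show ?thesis
  proof (rule tendsto_sandwich[OF _ _ l tendsto_const])
    show "\<forall>\<^sub>F n in sequentially. (- x + 1 / real n) powr g \<le> mesh_step g n x"
      using ev by eventually_elim (use True g in \<open>intro mesh_step_bounds(2); linarith\<close>)
    show "\<forall>\<^sub>F n in sequentially. mesh_step g n x \<le> power_tail g x"
      using ev by eventually_elim (use g in \<open>auto intro!: mesh_step_bounds(1)\<close>)
  qed
qed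

lemma integral_power_tail_mult:
  assumes "g + h < -1"
  shows "integrable lborel (\<lambda>x. power_tail g x * power_tail h x)"
    and "(LINT x|lborel. power_tail g x * power_tail h x) = 1 / (- g - h - 1)"
proof -
  have "has_bochner_integral lborel (\<lambda>x. power_tail g x * power_tail h x) (1 / (- g - h - 1))"
    using assms by (intro has_bochner_integral_nn_integral)
      (auto simp: nn_integral_power_tail_mult power_tail_nonneg)
  then show "integrable lborel (\<lambda>x. power_tail g x * power_tail h x)"
    "(LINT x|lborel. power_tail g x * power_tail h x) = 1 / (- g - h - 1)"
    by (auto simp: has_bochner_integral_iff)
qed

lemma mesh_inner_product:
  assumes n: "0 < n"
  shows "(LINT x|lborel. mesh_step g n x * mesh_step h n x) =
    (\<Sum>k<n * n. mesh_value g n k * mesh_value h n k) / real n"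
proof -
  have "(LINT x|lborel. mesh_step g n x * mesh_step h n x) =
      (\<Sum>k<n * n. LINT x|lborel. mesh_value g n k * mesh_value h n k * indicator (mesh_cell n k) x)"
    unfolding mesh_step_mult[OF n]
    by (intro Bochner_Integration.integral_sum integrable_mult_right integrable_real_indicator)
      (auto simp: emeasure_mesh_cell)
  also have "\<dots> = (\<Sum>k<n * n. mesh_value g n k * mesh_value h n k * (1 / real n))"
    by (intro sum.cong refl) (simp add: measure_def emeasure_mesh_cell)
  finally show ?thesis by (simp add: sum_divide_distrib)
qed

text \<open>The Riemann sums are exact integrals of products of mesh steps, so dominated convergence
  under the product of the tails handles refinement and exhaustion together.\<close>

lemma mesh_inner_product_tendsto:
  assumes gh: "g + h < -1" "g \<le> 0" "h \<le> 0"
  shows "(\<lambda>n. (\<Sum>k<n * n. mesh_value g n k * mesh_value h n k) / real n) \<longlonglongrightarrow> 1 / (- g - h - 1)"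
proof -
  have "(\<lambda>n. LINT x|lborel. mesh_step g n x * mesh_step h n x) \<longlonglongrightarrow>
      (LINT x|lborel. power_tail g x * power_tail h x)"
  proof (rule integral_dominated_convergence[where w = "\<lambda>x. power_tail g x * power_tail h x"])
    show "AE x in lborel. (\<lambda>n. mesh_step g n x * mesh_step h n x) \<longlonglongrightarrow> power_tail g x * power_tail h x"
      using gh by (intro always_eventually allI tendsto_mult mesh_step_tendsto)
    show "AE x in lborel. norm (mesh_step g n x * mesh_step h n x) \<le> power_tail g x * power_tail h x" for n
    proof (intro always_eventually allI)
      fix x
      have "mesh_step g n x * mesh_step h n x \<le> power_tail g x * power_tail h x"
      proof (cases "n = 0")
        case True then show ?thesis by (simp add: mesh_step_def power_tail_nonneg)
      next
        case False then show ?thesis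
          using gh by (intro mult_mono mesh_step_bounds mesh_step_nonneg power_tail_nonneg) auto
      qed
      then show "norm (mesh_step g n x * mesh_step h n x) \<le> power_tail g x * power_tail h x"
        by (simp add: mesh_step_nonneg)
    qed
  qed (use gh integral_power_tail_mult in auto)
  then have "(\<lambda>n. LINT x|lborel. mesh_step g n x * mesh_step h n x) \<longlonglongrightarrow> 1 / (- g - h - 1)"
    using gh by (simp add: integral_power_tail_mult)
  then show ?thesis
    by (rule Lim_transform_eventually)
      (auto intro!: eventually_sequentiallyI[of 1] simp: mesh_inner_product)
qed

lemma mesh_step_L2_tendsto:
  assumes g: "g < -1/2"
  shows "(\<lambda>n. \<integral>\<^sup>+x. ennreal ((power_tail g x - mesh_step g n x)\<^sup>2) \<partial>lborel) \<longlonglongrightarrow> 0"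
proof -
  have "(\<lambda>n. \<integral>\<^sup>+x. ennreal ((power_tail g x - mesh_step g n x)\<^sup>2) \<partial>lborel) \<longlonglongrightarrow> (\<integral>\<^sup>+x. ennreal 0 \<partial>(lborel :: real measure))"
  proof (rule nn_integral_dominated_convergence[where w = "\<lambda>x. ennreal (power_tail g x * power_tail g x)"])
    show "AE x in lborel. (\<lambda>n. ennreal ((power_tail g x - mesh_step g n x)\<^sup>2)) \<longlonglongrightarrow> ennreal 0"
    proof (intro always_eventually allI tendsto_ennrealI)
      fix x
      have "(\<lambda>n. (power_tail g x - mesh_step g n x)\<^sup>2) \<longlonglongrightarrow> (power_tail g x - power_tail g x)\<^sup>2"
        using g by (intro tendsto_intros mesh_step_tendsto) auto
      then show "(\<lambda>n. (power_tail g x - mesh_step g n x)\<^sup>2) \<longlonglongrightarrow> 0" by simp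
    qed
    show "AE x in lborel. ennreal ((power_tail g x - mesh_step g n x)\<^sup>2) \<le> ennreal (power_tail g x * power_tail g x)" for n
    proof (intro always_eventually allI ennreal_leI)
      fix x
      have "mesh_step g n x \<le> power_tail g x"
        using g mesh_step_bounds(1)[of n g x]
        by (cases "n = 0") (auto simp: mesh_step_def power_tail_nonneg)
      then show "(power_tail g x - mesh_step g n x)\<^sup>2 \<le> power_tail g x * power_tail g x"
        unfolding power2_eq_square by (intro mult_mono) (auto simp: mesh_step_nonneg power_tail_nonneg)
    qed
  qed (use g in \<open>auto simp: nn_integral_power_tail_mult\<close>)
  then show ?thesis by simp
qed

text \<open>The full double sum factors, and the excluded diagonal is subtracted. With
  \<open>x\<close> and \<open>y\<close> abstract the identity evaluates the step function at a pair
  of points as well as its integral at an outcome.\<close>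

lemma off_diagonal_double_sum:
  fixes p q x y :: "nat \<Rightarrow> real"
  shows "(\<Sum>k<m. \<Sum>l<m. (if k = l then 0 else c / 2 * (p k * q l + q k * p l)) * x k * y l) =
    c / 2 * ((\<Sum>k<m. p k * x k) * (\<Sum>l<m. q l * y l) + (\<Sum>k<m. q k * x k) * (\<Sum>l<m. p l * y l)) -
    c * (\<Sum>k<m. p k * q k * x k * y k)"
proof -
  have "(\<Sum>k<m. \<Sum>l<m. (if k = l then 0 else c / 2 * (p k * q l + q k * p l)) * x k * y l) =
      (\<Sum>k<m. \<Sum>l<m. c / 2 * (p k * x k * (q l * y l)) + c / 2 * (q k * x k * (p l * y l)) -
        (if l = k then c * (p k * q k * x k * y k) else 0))"
    by (intro sum.cong refl) (auto simp: field_simps)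
  also have "\<dots> = (\<Sum>k<m. \<Sum>l<m. c / 2 * (p k * x k * (q l * y l))) +
      (\<Sum>k<m. \<Sum>l<m. c / 2 * (q k * x k * (p l * y l))) - (\<Sum>k<m. c * (p k * q k * x k * y k))"
    by (simp add: sum.distrib sum_subtractf)
  also have "(\<Sum>k<m. \<Sum>l<m. c / 2 * (p k * x k * (q l * y l))) = c / 2 * ((\<Sum>k<m. p k * x k) * (\<Sum>l<m. q l * y l))"
    by (simp only: sum_product, simp only: sum_distrib_left)
  also have "(\<Sum>k<m. \<Sum>l<m. c / 2 * (q k * x k * (p l * y l))) = c / 2 * ((\<Sum>k<m. q k * x k) * (\<Sum>l<m. p l * y l))"
    by (simp only: sum_product, simp only: sum_distrib_left)
  finally show ?thesis
    by (simp only: sum_distrib_left[symmetric] distrib_left)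
qed

section \<open>Laws and variances of sums over cells, and L2 errors of the discretization\<close>

context white_noise
begin

lemma noise_standard_gauss:
  assumes A: "A \<in> sets borel" "emeasure lborel A < \<infinity>" and v: "measure lborel A = v" "0 < v"
  shows "distr M borel (\<lambda>\<omega>. B A \<omega> / sqrt v) = std_gauss"
proof -
  have "distributed M lborel (B A) (normal_density 0 (sqrt v))"
    using noise_centered_normal[OF A] v by (simp add: centered_normal_def)
  then have "distributed M lborel (\<lambda>\<omega>. B A \<omega> / sqrt v) std_normal_density"
    using normal_standard_normal_convert[of "sqrt v" "B A" 0] v by simp
  then have "distr M lborel (\<lambda>\<omega>. B A \<omega> / sqrt v) = std_gauss"
    by (simp add: distributed_def)
  moreover have "distr M borel (\<lambda>\<omega>. B A \<omega> / sqrt v) = distr M lborel (\<lambda>\<omega>. B A \<omega> / sqrt v)"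
    by (rule distr_cong) auto
  ultimately show ?thesis by simp
qed

text \<open>All cells have the same measure \<open>v\<close>, so division by \<open>sqrt v\<close>
  makes the noises independent standard Gaussians; the factor moves into the coefficients of
  \<open>gauss_product_law\<close>.\<close>

lemma noise_product_law:
  fixes p q :: "nat \<Rightarrow> real"
  assumes S: "off_diagonal_step m A a" and m: "0 < m" and v: "0 < v" "\<And>k. k < m \<Longrightarrow> measure lborel (A k) = v"
    and h[measurable]: "h \<in> borel_measurable borel"
  defines "\<kappa> \<equiv> v * (\<Sum>k<m. p k * q k)"
  defines "\<mu> \<equiv> sqrt ((v * (\<Sum>k<m. (p k)\<^sup>2)) * (v * (\<Sum>k<m. (q k)\<^sup>2)) - \<kappa>\<^sup>2)"
  shows "(\<integral>\<^sup>+\<omega>. h ((\<Sum>k<m. p k * B (A k) \<omega>) * (\<Sum>k<m. q k * B (A k) \<omega>)) \<partial>M) =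
    (\<integral>\<^sup>+x. \<integral>\<^sup>+y. h (\<kappa> * x\<^sup>2 + \<mu> * x * y) \<partial>std_gauss \<partial>std_gauss)"
proof -
  have A: "A k \<in> sets borel" "emeasure lborel (A k) < \<infinity>" if "k < m" for k
    using S that by (auto simp: off_diagonal_step_def)
  define Y where "Y k \<omega> = B (A k) \<omega> / sqrt v" for k \<omega>
  have [measurable]: "Y k \<in> borel_measurable M" if "k < m" for k
    unfolding Y_def using noise_measurable[OF A, OF that that] by measurable
  have "indep_vars (\<lambda>_. borel) Y {..<m}"
    unfolding Y_def by (rule indep_vars_compose2[OF noise_indep[OF S]]) measurable
  then have "distr M (\<Pi>\<^sub>M k\<in>{..<m}. borel) (\<lambda>\<omega>. \<lambda>k\<in>{..<m}. Y k \<omega>) = (\<Pi>\<^sub>M k\<in>{..<m}. distr M borel (Y k))"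
    using m by (subst indep_vars_iff_distr_eq_PiM'[symmetric]) auto
  also have "\<dots> = PiM {..<m} (\<lambda>_. std_gauss)"
    unfolding Y_def using noise_standard_gauss[OF A v(2) v(1)] by (intro PiM_cong) auto
  finally have law: "distr M (\<Pi>\<^sub>M k\<in>{..<m}. borel) (\<lambda>\<omega>. \<lambda>k\<in>{..<m}. Y k \<omega>) = PiM {..<m} (\<lambda>_. std_gauss)" .
  let ?p = "\<lambda>k. sqrt v * p k" and ?q = "\<lambda>k. sqrt v * q k"
  let ?H = "\<lambda>\<omega>. h ((\<Sum>k<m. ?p k * \<omega> k) * (\<Sum>k<m. ?q k * \<omega> k))"
  have "(\<integral>\<^sup>+\<omega>. h ((\<Sum>k<m. p k * B (A k) \<omega>) * (\<Sum>k<m. q k * B (A k) \<omega>)) \<partial>M) =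
      (\<integral>\<^sup>+\<omega>. ?H (\<lambda>k\<in>{..<m}. Y k \<omega>) \<partial>M)"
    by (rule nn_integral_cong, rule arg_cong[of _ _ h], rule arg_cong2[of _ _ _ _ "(*)"]; rule sum.cong)
      (use v in \<open>auto simp: Y_def\<close>)
  also have "\<dots> = (\<integral>\<^sup>+\<omega>. ?H \<omega> \<partial>distr M (\<Pi>\<^sub>M k\<in>{..<m}. borel) (\<lambda>\<omega>. \<lambda>k\<in>{..<m}. Y k \<omega>))"
    by (subst nn_integral_distr) auto
  also have "\<dots> = (\<integral>\<^sup>+\<omega>. ?H \<omega> \<partial>PiM {..<m} (\<lambda>_. std_gauss))"
    unfolding law ..
  also have "\<dots> = (\<integral>\<^sup>+x. \<integral>\<^sup>+y. h ((\<Sum>k<m. ?p k * ?q k) * x\<^sup>2 +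
      sqrt ((\<Sum>k<m. (?p k)\<^sup>2) * (\<Sum>k<m. (?q k)\<^sup>2) - (\<Sum>k<m. ?p k * ?q k)\<^sup>2) * x * y) \<partial>std_gauss \<partial>std_gauss)"
    by (rule gauss_product_law) measurable
  also have "(\<Sum>k<m. ?p k * ?q k) = \<kappa>"
    unfolding \<kappa>_def sum_distrib_left using v by (intro sum.cong refl) (simp add: mult_ac)
  also have "(\<Sum>k<m. (?p k)\<^sup>2) = v * (\<Sum>k<m. (p k)\<^sup>2)"
    using v by (simp add: power_mult_distrib sum_distrib_left)
  also have "(\<Sum>k<m. (?q k)\<^sup>2) = v * (\<Sum>k<m. (q k)\<^sup>2)"
    using v by (simp add: power_mult_distrib sum_distrib_left)
  finally show ?thesis unfolding \<mu>_def .
qed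

text \<open>Centred squares of independent noises are uncorrelated, each with variance
  \<open>3 * v^2 - v^2\<close>. This measures the price of leaving out the diagonal in a product of
  two sums.\<close>

lemma noise_squares_variance:
  assumes S: "off_diagonal_step m A a"
  shows "(\<integral>\<^sup>+\<omega>. ennreal ((\<Sum>k<m. c k * ((B (A k) \<omega>)\<^sup>2 - measure lborel (A k)))\<^sup>2) \<partial>M) =
    ennreal (2 * (\<Sum>k<m. (c k)\<^sup>2 * (measure lborel (A k))\<^sup>2))"
proof -
  define v where "v k = measure lborel (A k)" for k
  have A: "A k \<in> sets borel" "emeasure lborel (A k) < \<infinity>" if "k < m" for k
    using S that by (auto simp: off_diagonal_step_def)
  have mom: "integrable M (\<lambda>\<omega>. (B (A k) \<omega>)\<^sup>2)" "expectation (\<lambda>\<omega>. (B (A k) \<omega>)\<^sup>2) = v k"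
    "expectation (\<lambda>\<omega>. (B (A k) \<omega>) ^ 4) = 3 * (v k)\<^sup>2" if "k < m" for k
    unfolding v_def using noise_moments[OF A, OF that that] by blast+
  have int2: "integrable M (\<lambda>\<omega>. (B (A k) \<omega>)\<^sup>2 * (B (A l) \<omega>)\<^sup>2)" if "k < m" "l < m" for k l
    using noise_four_products(1)[OF S that(1) that(1) that(2) that(2)] by (simp add: power2_eq_square)
  have cross: "((B (A k) \<omega>)\<^sup>2 - v k) * ((B (A l) \<omega>)\<^sup>2 - v l) =
      (B (A k) \<omega>)\<^sup>2 * (B (A l) \<omega>)\<^sup>2 - v l * (B (A k) \<omega>)\<^sup>2 - v k * (B (A l) \<omega>)\<^sup>2 + v k * v l" for k l \<omega>
    by (simp add: algebra_simps)
  have int: "integrable M (\<lambda>\<omega>. ((B (A k) \<omega>)\<^sup>2 - v k) * ((B (A l) \<omega>)\<^sup>2 - v l))" if "k < m" "l < m" for k l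
    unfolding cross using int2[OF that] mom(1)[OF that(1)] mom(1)[OF that(2)] by simp
  have E: "expectation (\<lambda>\<omega>. ((B (A k) \<omega>)\<^sup>2 - v k) * ((B (A l) \<omega>)\<^sup>2 - v l)) =
      (if l = k then 2 * (v k)\<^sup>2 else 0)" if kl: "k < m" "l < m" for k l
  proof -
    have "expectation (\<lambda>\<omega>. ((B (A k) \<omega>)\<^sup>2 - v k) * ((B (A l) \<omega>)\<^sup>2 - v l)) =
        expectation (\<lambda>\<omega>. (B (A k) \<omega>)\<^sup>2 * (B (A l) \<omega>)\<^sup>2) - v k * v l"
      unfolding cross using int2[OF kl] mom[OF kl(1)] mom[OF kl(2)] by (simp add: prob_space)
    also have "\<dots> = (if l = k then 2 * (v k)\<^sup>2 else 0)"
    proof (cases "l = k")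
      case True
      have "(\<lambda>\<omega>. (B (A k) \<omega>)\<^sup>2 * (B (A k) \<omega>)\<^sup>2) = (\<lambda>\<omega>. (B (A k) \<omega>) ^ 4)"
        by (simp add: power_add[symmetric])
      then show ?thesis using True mom(3)[OF kl(1)] by (simp add: power2_eq_square)
    next
      case False
      then show ?thesis using noise_four_products(3)[OF S kl(1) kl(1) kl(2) kl(2)] by (simp add: v_def)
    qed
    finally show ?thesis .
  qed
  have sq: "(\<Sum>k<m. c k * ((B (A k) \<omega>)\<^sup>2 - v k))\<^sup>2 =
      (\<Sum>k<m. \<Sum>l<m. c k * c l * (((B (A k) \<omega>)\<^sup>2 - v k) * ((B (A l) \<omega>)\<^sup>2 - v l)))" for \<omega>
    unfolding power2_eq_square sum_product by (simp add: mult_ac)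
  have "(\<integral>\<^sup>+\<omega>. ennreal ((\<Sum>k<m. c k * ((B (A k) \<omega>)\<^sup>2 - v k))\<^sup>2) \<partial>M) =
      ennreal (expectation (\<lambda>\<omega>. (\<Sum>k<m. c k * ((B (A k) \<omega>)\<^sup>2 - v k))\<^sup>2))"
  proof (rule nn_integral_eq_integral)
    show "integrable M (\<lambda>\<omega>. (\<Sum>k<m. c k * ((B (A k) \<omega>)\<^sup>2 - v k))\<^sup>2)"
      unfolding sq by (intro Bochner_Integration.integrable_sum integrable_mult_right int) auto
  qed simp
  also have "expectation (\<lambda>\<omega>. (\<Sum>k<m. c k * ((B (A k) \<omega>)\<^sup>2 - v k))\<^sup>2) =
      (\<Sum>k<m. \<Sum>l<m. c k * c l * expectation (\<lambda>\<omega>. ((B (A k) \<omega>)\<^sup>2 - v k) * ((B (A l) \<omega>)\<^sup>2 - v l)))"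
    unfolding sq
    by (subst Bochner_Integration.integral_sum, (intro Bochner_Integration.integrable_sum integrable_mult_right int; simp),
      intro sum.cong refl)+ simp
  also have "\<dots> = (\<Sum>k<m. \<Sum>l<m. if l = k then 2 * ((c k)\<^sup>2 * (v k)\<^sup>2) else 0)"
    by (intro sum.cong refl, simp only: lessThan_iff E) (auto simp: power2_eq_square)
  also have "\<dots> = 2 * (\<Sum>k<m. (c k)\<^sup>2 * (v k)\<^sup>2)"
    by (simp add: sum_distrib_left)
  finally show ?thesis unfolding v_def .
qed

end

text \<open>The difference of products is an error times a tail plus a mesh step times an error; the
  mesh step is then estimated by its tail, whose norm is explicit.\<close>

lemma mesh_product_L2:
  assumes n: "0 < n" and g: "g < -1/2" "h < -1/2"
  shows "(\<integral>\<^sup>+x. \<integral>\<^sup>+y. ennreal ((power_tail g x * power_tail h y - mesh_step g n x * mesh_step h n y)\<^sup>2) \<partial>lborel \<partial>lborel) \<le>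
    2 * ((\<integral>\<^sup>+x. ennreal ((power_tail g x - mesh_step g n x)\<^sup>2) \<partial>lborel) * ennreal (1 / (-2 * h - 1))) +
    2 * (ennreal (1 / (-2 * g - 1)) * (\<integral>\<^sup>+x. ennreal ((power_tail h x - mesh_step h n x)\<^sup>2) \<partial>lborel))"
    (is "_ \<le> ?R")
proof -
  have tail: "(\<integral>\<^sup>+x. ennreal ((power_tail g x)\<^sup>2) \<partial>lborel) = ennreal (1 / (-2 * g - 1))" if "g < -1/2" for g
  proof -
    have "- g - g - 1 = -2 * g - 1" by simp
    then show ?thesis using nn_integral_power_tail_mult[of g g] that by (simp add: power2_eq_square)
  qed
  have "(\<integral>\<^sup>+x. \<integral>\<^sup>+y. ennreal ((power_tail g x * power_tail h y - mesh_step g n x * mesh_step h n y)\<^sup>2) \<partial>lborel \<partial>lborel) \<le>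
      (\<integral>\<^sup>+x. \<integral>\<^sup>+y. 2 * (ennreal ((power_tail g x - mesh_step g n x)\<^sup>2) * ennreal ((power_tail h y)\<^sup>2)) +
        2 * (ennreal ((power_tail g x)\<^sup>2) * ennreal ((power_tail h y - mesh_step h n y)\<^sup>2)) \<partial>lborel \<partial>lborel)"
  proof (intro nn_integral_mono)
    fix x y
    let ?a = "(power_tail g x - mesh_step g n x) * power_tail h y"
    let ?b = "mesh_step g n x * (power_tail h y - mesh_step h n y)"
    have "(power_tail g x * power_tail h y - mesh_step g n x * mesh_step h n y)\<^sup>2 = (?a + ?b)\<^sup>2"
      by (simp add: algebra_simps)
    also have "\<dots> \<le> 2 * ?a\<^sup>2 + 2 * ?b\<^sup>2"
      using sum_squares_bound[of ?a ?b] by (simp add: power2_sum)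
    also have "\<dots> \<le> 2 * ((power_tail g x - mesh_step g n x)\<^sup>2 * (power_tail h y)\<^sup>2) +
        2 * ((power_tail g x)\<^sup>2 * (power_tail h y - mesh_step h n y)\<^sup>2)"
      using g unfolding power_mult_distrib
      by (intro add_mono mult_left_mono mult_right_mono power_mono mesh_step_bounds n mesh_step_nonneg) auto
    finally have "ennreal ((power_tail g x * power_tail h y - mesh_step g n x * mesh_step h n y)\<^sup>2) \<le>
        ennreal (2 * ((power_tail g x - mesh_step g n x)\<^sup>2 * (power_tail h y)\<^sup>2) +
        2 * ((power_tail g x)\<^sup>2 * (power_tail h y - mesh_step h n y)\<^sup>2))"
      by (rule ennreal_leI)
    then show "ennreal ((power_tail g x * power_tail h y - mesh_step g n x * mesh_step h n y)\<^sup>2) \<le>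
        2 * (ennreal ((power_tail g x - mesh_step g n x)\<^sup>2) * ennreal ((power_tail h y)\<^sup>2)) +
        2 * (ennreal ((power_tail g x)\<^sup>2) * ennreal ((power_tail h y - mesh_step h n y)\<^sup>2))"
      by (simp add: ennreal_mult')
  qed
  also have "\<dots> = 2 * ((\<integral>\<^sup>+x. ennreal ((power_tail g x - mesh_step g n x)\<^sup>2) \<partial>lborel) * (\<integral>\<^sup>+x. ennreal ((power_tail h x)\<^sup>2) \<partial>lborel)) +
      2 * ((\<integral>\<^sup>+x. ennreal ((power_tail g x)\<^sup>2) \<partial>lborel) * (\<integral>\<^sup>+x. ennreal ((power_tail h x - mesh_step h n x)\<^sup>2) \<partial>lborel))"
    by (simp add: nn_integral_add nn_integral_cmult nn_integral_multc)
  finally show ?thesis using g by (simp only: tail)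
qed

lemma mesh_diagonal_L2:
  assumes n: "0 < n"
  shows "(\<integral>\<^sup>+x. \<integral>\<^sup>+y. ennreal ((\<Sum>k<n * n. c k * indicator (mesh_cell n k) x * indicator (mesh_cell n k) y)\<^sup>2)
      \<partial>lborel \<partial>lborel) = ennreal ((\<Sum>k<n * n. (c k)\<^sup>2) / (real n)\<^sup>2)"
proof -
  have sq: "(\<Sum>k<n * n. c k * indicator (mesh_cell n k) x * indicator (mesh_cell n k) y)\<^sup>2 =
      (\<Sum>k<n * n. (c k)\<^sup>2 * indicator (mesh_cell n k) x * indicator (mesh_cell n k) y :: real)" for x y
  proof -
    have "(\<Sum>k<n * n. c k * indicator (mesh_cell n k) y * indicator (mesh_cell n k) x)\<^sup>2 =
      (\<Sum>k<n * n. (c k)\<^sup>2 * indicator (mesh_cell n k) y * indicator (mesh_cell n k) x :: real)"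
      unfolding mesh_cell_sum[OF n] by (simp add: Let_def power_mult_distrib indicator_def)
    then show ?thesis by (simp add: mult_ac)
  qed
  have "(\<integral>\<^sup>+x. \<integral>\<^sup>+y. ennreal ((\<Sum>k<n * n. c k * indicator (mesh_cell n k) x * indicator (mesh_cell n k) y)\<^sup>2)
      \<partial>lborel \<partial>lborel) =
    (\<integral>\<^sup>+x. \<integral>\<^sup>+y. (\<Sum>k<n * n. ennreal ((c k)\<^sup>2) * indicator (mesh_cell n k) x * indicator (mesh_cell n k) y) \<partial>lborel \<partial>lborel)"
  proof (intro nn_integral_cong)
    fix x y :: real
    have "ennreal (\<Sum>k<n * n. (c k)\<^sup>2 * indicator (mesh_cell n k) x * indicator (mesh_cell n k) y) =
        (\<Sum>k<n * n. ennreal ((c k)\<^sup>2 * indicator (mesh_cell n k) x * indicator (mesh_cell n k) y))"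
      by (simp add: sum_ennreal)
    also have "\<dots> = (\<Sum>k<n * n. ennreal ((c k)\<^sup>2) * indicator (mesh_cell n k) x * indicator (mesh_cell n k) y)"
      by (intro sum.cong) (auto simp: indicator_def)
    finally show "ennreal ((\<Sum>k<n * n. c k * indicator (mesh_cell n k) x * indicator (mesh_cell n k) y)\<^sup>2) =
        (\<Sum>k<n * n. ennreal ((c k)\<^sup>2) * indicator (mesh_cell n k) x * indicator (mesh_cell n k) y)"
      by (simp only: sq)
  qed
  also have "\<dots> = (\<Sum>k<n * n. ennreal ((c k)\<^sup>2) * ennreal (1 / real n) * ennreal (1 / real n))"
  proof -
    let ?f = "\<lambda>k x y. ennreal ((c k)\<^sup>2) * indicator (mesh_cell n k) x * indicator (mesh_cell n k) y"
    have "(\<integral>\<^sup>+x. \<integral>\<^sup>+y. (\<Sum>k<n * n. ?f k x y) \<partial>lborel \<partial>lborel) = (\<integral>\<^sup>+x. (\<Sum>k<n * n. \<integral>\<^sup>+y. ?f k x y \<partial>lborel) \<partial>lborel)"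
      by (intro nn_integral_cong nn_integral_sum) measurable
    also have "\<dots> = (\<Sum>k<n * n. \<integral>\<^sup>+x. \<integral>\<^sup>+y. ?f k x y \<partial>lborel \<partial>lborel)"
      by (rule nn_integral_sum) measurable
    also have "\<dots> = (\<Sum>k<n * n. ennreal ((c k)\<^sup>2) * ennreal (1 / real n) * ennreal (1 / real n))"
      by (intro sum.cong refl) (simp add: nn_integral_cmult_indicator nn_integral_cmult nn_integral_multc emeasure_mesh_cell)
    finally show ?thesis .
  qed
  also have "\<dots> = (\<Sum>k<n * n. ennreal ((c k)\<^sup>2 / (real n)\<^sup>2))"
    by (intro sum.cong refl) (simp add: ennreal_mult'[symmetric] power2_eq_square)
  finally show ?thesis by (simp add: sum_ennreal sum_divide_distrib)
qed

section \<open>Approximation of the tail kernel and of its double integral\<close>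

context white_noise
begin

text \<open>\<open>f\<close> is an off-diagonal step function with integral \<open>W\<close>, and
  \<open>W'\<close> is \<open>c\<close> times the centred product of two finite Gaussian sums, whose
  law is explicit. The two differ by diagonal terms, which fade like \<open>1 / n\<close> because
  the mesh values are at most 1. The covariance of the sums is \<kappa>, and
  \<open>\<kappa>^2 + \<mu>^2\<close> is the product of their variances.\<close>

lemma tail_kernel_approximation:
  assumes g: "g1 < -1/2" "g2 < -1/2" and e: "0 < e"
  defines "c \<equiv> rosenblatt_const g1 g2"
  obtains f W W' \<kappa> \<mu> where "is_double_wiener_ito_integral M B f W" "W' \<in> borel_measurable M"
    "(\<integral>\<^sup>+p. ennreal ((tail_kernel g1 g2 p - f p)\<^sup>2) \<partial>(lborel \<Otimes>\<^sub>M lborel)) \<le> ennreal (c\<^sup>2 * e)"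
    "(\<integral>\<^sup>+\<omega>. ennreal ((W \<omega> - W' \<omega>)\<^sup>2) \<partial>M) \<le> ennreal (c\<^sup>2 * e)"
    "\<And>h. h \<in> borel_measurable borel \<Longrightarrow>
      (\<integral>\<^sup>+\<omega>. h (W' \<omega>) \<partial>M) = (\<integral>\<^sup>+x. \<integral>\<^sup>+y. h (c * (\<kappa> * (x\<^sup>2 - 1) + \<mu> * x * y)) \<partial>std_gauss \<partial>std_gauss)"
    "\<bar>\<kappa> - 1 / (- g1 - g2 - 1)\<bar> \<le> e" "0 \<le> \<mu>"
    "\<bar>\<kappa>\<^sup>2 + \<mu>\<^sup>2 - 1 / ((-2 * g1 - 1) * (-2 * g2 - 1))\<bar> \<le> e"
proof -
  let ?p = "mesh_value g1" and ?q = "mesh_value g2"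
  define \<kappa> where "\<kappa> n = (\<Sum>k<n * n. ?p n k * ?q n k) / real n" for n
  define \<sigma> where "\<sigma> n = (\<Sum>k<n * n. ?p n k * ?p n k) / real n" for n
  define \<tau> where "\<tau> n = (\<Sum>k<n * n. ?q n k * ?q n k) / real n" for n
  \<comment> \<open>Up to the factor \<open>c^2\<close>, this is the squared norm of the diagonal
    part of the kernel, and twice this is the variance of the diagonal part of the product of
    sums.\<close>
  define T where "T n = (\<Sum>k<n * n. (?p n k * ?q n k)\<^sup>2) / (real n)\<^sup>2" for n
  define X where "X n = 2 * ((\<integral>\<^sup>+x. ennreal ((power_tail g1 x - mesh_step g1 n x)\<^sup>2) \<partial>lborel) * ennreal (1 / (-2 * g2 - 1))) +
    2 * (ennreal (1 / (-2 * g1 - 1)) * (\<integral>\<^sup>+x. ennreal ((power_tail g2 x - mesh_step g2 n x)\<^sup>2) \<partial>lborel))" for n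
  have \<kappa>: "\<kappa> \<longlonglongrightarrow> 1 / (- g1 - g2 - 1)"
    unfolding \<kappa>_def using g by (intro mesh_inner_product_tendsto) auto
  have "\<sigma> \<longlonglongrightarrow> 1 / (- g1 - g1 - 1)" "\<tau> \<longlonglongrightarrow> 1 / (- g2 - g2 - 1)"
    unfolding \<sigma>_def \<tau>_def using g by (intro mesh_inner_product_tendsto; simp)+
  then have "(\<lambda>n. \<sigma> n * \<tau> n) \<longlonglongrightarrow> 1 / (- g1 - g1 - 1) * (1 / (- g2 - g2 - 1))"
    by (rule tendsto_mult)
  also have "1 / (- g1 - g1 - 1) * (1 / (- g2 - g2 - 1)) = 1 / ((-2 * g1 - 1) * (-2 * g2 - 1))"
    by simp
  finally have \<sigma>\<tau>: "(\<lambda>n. \<sigma> n * \<tau> n) \<longlonglongrightarrow> 1 / ((-2 * g1 - 1) * (-2 * g2 - 1))" .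
  have mv: "0 \<le> mesh_value g n k" "mesh_value g n k \<le> 1" if "g < -1/2" for g n k
  proof -
    show "0 \<le> mesh_value g n k" by (simp add: mesh_value_def)
    have "mesh_value g n k \<le> 1 powr g"
      unfolding mesh_value_def using that by (intro powr_mono2') auto
    then show "mesh_value g n k \<le> 1" by simp
  qed
  have T: "0 \<le> T n" "T n \<le> \<kappa> n * (1 / real n)" for n
  proof -
    show "0 \<le> T n" by (simp add: T_def sum_nonneg)
    have "T n \<le> (\<Sum>k<n * n. ?p n k * ?q n k) / (real n)\<^sup>2"
      unfolding T_def
    proof (intro divide_right_mono sum_mono)
      fix k
      have "0 \<le> ?p n k * ?q n k" "?p n k * ?q n k \<le> 1"
        using mv[OF g(1), of n k] mv[OF g(2), of n k] by (simp_all add: mult_le_one)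
      then show "(?p n k * ?q n k)\<^sup>2 \<le> ?p n k * ?q n k"
        unfolding power2_eq_square by (intro mult_left_le)
    qed simp
    then show "T n \<le> \<kappa> n * (1 / real n)"
      by (simp add: \<kappa>_def power2_eq_square)
  qed
  have "(\<lambda>n. \<kappa> n * (1 / real n)) \<longlonglongrightarrow> 1 / (- g1 - g2 - 1) * 0"
    by (intro tendsto_mult \<kappa> lim_1_over_n)
  then have "T \<longlonglongrightarrow> 0"
    using T by (intro tendsto_sandwich[of "\<lambda>_. 0" T sequentially "\<lambda>n. \<kappa> n * (1 / real n)"]) auto
  then have "(\<lambda>n. ennreal (3 * T n)) \<longlonglongrightarrow> ennreal (3 * 0)"
    by (intro tendsto_ennrealI tendsto_mult tendsto_const)
  moreover have "X \<longlonglongrightarrow> 2 * (0 * ennreal (1 / (-2 * g2 - 1))) + 2 * (ennreal (1 / (-2 * g1 - 1)) * 0)"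
    unfolding X_def using g by (intro tendsto_add tendsto_mult_ennreal tendsto_const mesh_step_L2_tendsto) auto
  ultimately have "(\<lambda>n. X n + X n + ennreal (3 * T n)) \<longlonglongrightarrow> 0 + 0 + 0"
    by (intro tendsto_add) simp_all
  then have "\<forall>\<^sub>F n in sequentially. X n + X n + ennreal (3 * T n) < ennreal e"
    using e by (intro order_tendstoD) auto
  moreover have "\<forall>\<^sub>F n in sequentially. dist (\<kappa> n) (1 / (- g1 - g2 - 1)) < e"
    by (rule tendstoD[OF \<kappa> e])
  moreover have "\<forall>\<^sub>F n in sequentially. dist (\<sigma> n * \<tau> n) (1 / ((-2 * g1 - 1) * (-2 * g2 - 1))) < e"
    by (rule tendstoD[OF \<sigma>\<tau> e])
  ultimately have "\<forall>\<^sub>F n in sequentially. 0 < n \<and> X n + X n + ennreal (3 * T n) < ennreal e \<and>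
      dist (\<kappa> n) (1 / (- g1 - g2 - 1)) < e \<and> dist (\<sigma> n * \<tau> n) (1 / ((-2 * g1 - 1) * (-2 * g2 - 1))) < e"
    by (intro eventually_conj eventually_gt_at_top)
  then obtain n where n: "0 < n" and XT: "X n + X n + ennreal (3 * T n) < ennreal e"
    and \<kappa>e: "dist (\<kappa> n) (1 / (- g1 - g2 - 1)) < e"
    and \<sigma>\<tau>e: "dist (\<sigma> n * \<tau> n) (1 / ((-2 * g1 - 1) * (-2 * g2 - 1))) < e"
    using eventually_happens'[OF sequentially_bot] by blast
  define m where "m = n * n"
  define a where "a k l = (if k = l then 0 else c / 2 * (?p n k * ?q n l + ?q n k * ?p n l))" for k l :: nat
  let ?A = "mesh_cell n"
  let ?U = "\<lambda>\<omega>. \<Sum>k<m. ?p n k * B (?A k) \<omega>" and ?V = "\<lambda>\<omega>. \<Sum>k<m. ?q n k * B (?A k) \<omega>"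
  have meas: "measure lborel (?A k) = 1 / real n" for k
    by (simp add: measure_def emeasure_mesh_cell)
  have S: "off_diagonal_step m ?A a"
    using mesh_cell_disjoint[OF n]
    by (auto simp: off_diagonal_step_def disjoint_family_on_def emeasure_mesh_cell a_def)
  have [measurable]: "B (?A k) \<in> borel_measurable M" for k
    by (rule noise_measurable) (auto simp: emeasure_mesh_cell)
  define f where "f = step_function m ?A a"
  define W where "W = step_integral B m ?A a"
  \<comment> \<open>\<open>\<kappa> n\<close> is the expectation of the product, so
    \<open>W'\<close> is centred, as is the off-diagonal integral \<open>W\<close>.\<close>
  define W' where "W' \<omega> = c * (?U \<omega> * ?V \<omega> - \<kappa> n)" for \<omega>
  define \<mu> where "\<mu> = sqrt (\<sigma> n * \<tau> n - (\<kappa> n)\<^sup>2)"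
  have CS: "(\<kappa> n)\<^sup>2 \<le> \<sigma> n * \<tau> n"
  proof -
    have "(\<Sum>k<n * n. ?p n k * ?q n k)\<^sup>2 \<le> (\<Sum>k<n * n. (?p n k)\<^sup>2) * (\<Sum>k<n * n. (?q n k)\<^sup>2)"
      by (rule Cauchy_Schwarz_ineq_sum)
    then have "(\<Sum>k<n * n. ?p n k * ?q n k)\<^sup>2 / (real n)\<^sup>2 \<le>
        (\<Sum>k<n * n. (?p n k)\<^sup>2) * (\<Sum>k<n * n. (?q n k)\<^sup>2) / (real n)\<^sup>2"
      by (rule divide_right_mono) simp
    then show ?thesis
      by (simp add: \<kappa>_def \<sigma>_def \<tau>_def power_divide power2_eq_square)
  qed
  show ?thesis
  proof (rule that[of f W W' "\<kappa> n" \<mu>])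
    show "is_double_wiener_ito_integral M B f W"
      unfolding f_def W_def by (rule double_integral_step[OF S])
    show "W' \<in> borel_measurable M"
      unfolding W'_def by measurable
    show "\<bar>\<kappa> n - 1 / (- g1 - g2 - 1)\<bar> \<le> e" using \<kappa>e by (simp add: dist_real_def)
    show "0 \<le> \<mu>" using CS by (simp add: \<mu>_def)
    show "\<bar>(\<kappa> n)\<^sup>2 + \<mu>\<^sup>2 - 1 / ((-2 * g1 - 1) * (-2 * g2 - 1))\<bar> \<le> e"
      using \<sigma>\<tau>e CS by (simp add: \<mu>_def dist_real_def)
    show "(\<integral>\<^sup>+\<omega>. h (W' \<omega>) \<partial>M) =
        (\<integral>\<^sup>+x. \<integral>\<^sup>+y. h (c * (\<kappa> n * (x\<^sup>2 - 1) + \<mu> * x * y)) \<partial>std_gauss \<partial>std_gauss)"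
      if [measurable]: "h \<in> borel_measurable borel" for h
    proof -
      have "(\<integral>\<^sup>+\<omega>. h (W' \<omega>) \<partial>M) = (\<integral>\<^sup>+x. \<integral>\<^sup>+y. (\<lambda>z. h (c * (z - \<kappa> n)))
          (1 / real n * (\<Sum>k<m. ?p n k * ?q n k) * x\<^sup>2 +
           sqrt (1 / real n * (\<Sum>k<m. (?p n k)\<^sup>2) * (1 / real n * (\<Sum>k<m. (?q n k)\<^sup>2)) -
             (1 / real n * (\<Sum>k<m. ?p n k * ?q n k))\<^sup>2) * x * y) \<partial>std_gauss \<partial>std_gauss)"
        unfolding W'_def
        by (rule noise_product_law[OF S, of "1 / real n" "\<lambda>z. h (c * (z - \<kappa> n))"])
          (use n in \<open>auto simp: m_def meas\<close>)
      also have "1 / real n * (\<Sum>k<m. ?p n k * ?q n k) = \<kappa> n"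
        by (simp add: \<kappa>_def m_def)
      also have "1 / real n * (\<Sum>k<m. (?p n k)\<^sup>2) = \<sigma> n"
        by (simp add: \<sigma>_def m_def power2_eq_square)
      also have "1 / real n * (\<Sum>k<m. (?q n k)\<^sup>2) = \<tau> n"
        by (simp add: \<tau>_def m_def power2_eq_square)
      finally show ?thesis
        by (simp add: \<mu>_def algebra_simps)
    qed
    show "(\<integral>\<^sup>+\<omega>. ennreal ((W \<omega> - W' \<omega>)\<^sup>2) \<partial>M) \<le> ennreal (c\<^sup>2 * e)"
    proof -
      \<comment> \<open>The off-diagonal terms agree; what is left is the diagonal of the product,
        minus its mean.\<close>
      have "W \<omega> - W' \<omega> = - c * (\<Sum>k<m. ?p n k * ?q n k * ((B (?A k) \<omega>)\<^sup>2 - measure lborel (?A k)))" for \<omega>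
      proof -
        have W_eq: "W \<omega> = c / 2 * (?U \<omega> * ?V \<omega> + ?V \<omega> * ?U \<omega>) - c * (\<Sum>k<m. ?p n k * ?q n k * B (?A k) \<omega> * B (?A k) \<omega>)"
          unfolding W_def step_integral_def a_def by (rule off_diagonal_double_sum)
        have Z_eq: "(\<Sum>k<m. ?p n k * ?q n k * ((B (?A k) \<omega>)\<^sup>2 - measure lborel (?A k))) =
            (\<Sum>k<m. ?p n k * ?q n k * B (?A k) \<omega> * B (?A k) \<omega>) - \<kappa> n"
          by (simp add: meas \<kappa>_def m_def right_diff_distrib sum_subtractf sum_divide_distrib power2_eq_square mult_ac)
        have "c / 2 * (u * v + v * u) - c * Y - c * (u * v - k) = - c * (Y - k)" for u v Y k :: real
          by (simp add: field_simps)
        then show ?thesis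
          unfolding W_eq Z_eq W'_def .
      qed
      then have "(\<integral>\<^sup>+\<omega>. ennreal ((W \<omega> - W' \<omega>)\<^sup>2) \<partial>M) = (\<integral>\<^sup>+\<omega>. ennreal (c\<^sup>2) *
          ennreal ((\<Sum>k<m. ?p n k * ?q n k * ((B (?A k) \<omega>)\<^sup>2 - measure lborel (?A k)))\<^sup>2) \<partial>M)"
        by (simp add: power_mult_distrib ennreal_mult')
      also have "\<dots> = ennreal (c\<^sup>2) * (\<integral>\<^sup>+\<omega>.
          ennreal ((\<Sum>k<m. ?p n k * ?q n k * ((B (?A k) \<omega>)\<^sup>2 - measure lborel (?A k)))\<^sup>2) \<partial>M)"
        by (rule nn_integral_cmult) measurable
      also have "\<dots> = ennreal (c\<^sup>2) * ennreal (2 * T n)"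
        unfolding noise_squares_variance[OF S]
        by (simp add: meas T_def m_def power_divide sum_divide_distrib)
      also have "\<dots> \<le> ennreal (c\<^sup>2) * ennreal e"
      proof (intro mult_left_mono)
        have "ennreal (2 * T n) \<le> ennreal (3 * T n)" using T by (intro ennreal_leI) simp
        also have "\<dots> \<le> X n + X n + ennreal (3 * T n)" by (simp add: add_increasing)
        also have "\<dots> \<le> ennreal e" using XT by simp
        finally show "ennreal (2 * T n) \<le> ennreal e" .
      qed simp
      finally show ?thesis using e by (simp add: ennreal_mult')
    qed
    show "(\<integral>\<^sup>+p. ennreal ((tail_kernel g1 g2 p - f p)\<^sup>2) \<partial>(lborel \<Otimes>\<^sub>M lborel)) \<le> ennreal (c\<^sup>2 * e)"
    proof -
      define D where "D x y = power_tail g1 x * power_tail g2 y - mesh_step g1 n x * mesh_step g2 n y" for x y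
      define G where "G x y = (\<Sum>k<n * n. ?p n k * ?q n k * indicator (?A k) x * indicator (?A k) y :: real)" for x y
      have [measurable]: "(\<lambda>p. D (fst p) (snd p)) \<in> borel_measurable (borel \<Otimes>\<^sub>M borel)"
        "(\<lambda>p. G (fst p) (snd p)) \<in> borel_measurable (borel \<Otimes>\<^sub>M borel)"
        unfolding D_def G_def by measurable
      have D': "(\<lambda>p. D (snd p) (fst p)) \<in> borel_measurable (borel \<Otimes>\<^sub>M borel)"
        unfolding D_def by measurable
      have Dx: "(\<lambda>y. D x y) \<in> borel_measurable borel" "(\<lambda>y. D y x) \<in> borel_measurable borel"
        "(\<lambda>y. G x y) \<in> borel_measurable borel" for x
        unfolding D_def G_def by measurable
      have eq: "tail_kernel g1 g2 (x, y) - f (x, y) = c * (D x y / 2 + D y x / 2 + G x y)" for x y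
      proof -
        have "f (x, y) = c / 2 * (mesh_step g1 n x * mesh_step g2 n y + mesh_step g2 n x * mesh_step g1 n y) - c * G x y"
          unfolding f_def step_function_def prod.case a_def G_def mesh_step_def m_def
          by (rule off_diagonal_double_sum)
        then show ?thesis
          by (simp add: tail_kernel_def D_def c_def[symmetric] field_simps)
      qed
      have bound: "ennreal ((tail_kernel g1 g2 (x, y) - f (x, y))\<^sup>2) \<le>
          ennreal (c\<^sup>2) * (ennreal ((D x y)\<^sup>2) + ennreal ((D y x)\<^sup>2) + 3 * ennreal ((G x y)\<^sup>2))" for x y
      proof -
        \<comment> \<open>The kernel error is half the product error, half its transpose and the
          diagonal. The constants are rounded up to match
          \<open>X n + X n + 3 * T n\<close>.\<close>
        have "(u / 2 + v / 2 + w)\<^sup>2 \<le> u\<^sup>2 + v\<^sup>2 + 3 * w\<^sup>2" for u v w :: real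
        proof -
          have "(u / 2 + v / 2 + w)\<^sup>2 \<le> 3 * ((u / 2)\<^sup>2 + (v / 2)\<^sup>2 + w\<^sup>2)"
            using sum_squares_bound[of "u / 2" "v / 2"] sum_squares_bound[of "u / 2" w] sum_squares_bound[of "v / 2" w]
            by (simp add: power2_eq_square algebra_simps)
          also have "\<dots> \<le> u\<^sup>2 + v\<^sup>2 + 3 * w\<^sup>2"
          proof -
            have half: "(u / 2)\<^sup>2 = u\<^sup>2 / 4" "(v / 2)\<^sup>2 = v\<^sup>2 / 4" by (simp_all add: power_divide)
            have ineq: "3 * (x / 4 + y / 4 + z) \<le> x + y + 3 * z" if "0 \<le> x" "0 \<le> y" for x y z :: real
              using that by simp
            show ?thesis unfolding half by (rule ineq) simp_all
          qed
          finally show ?thesis .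
        qed
        then have "ennreal ((tail_kernel g1 g2 (x, y) - f (x, y))\<^sup>2) \<le>
            ennreal (c\<^sup>2 * ((D x y)\<^sup>2 + (D y x)\<^sup>2 + 3 * (G x y)\<^sup>2))"
          unfolding eq power_mult_distrib by (intro ennreal_leI mult_left_mono) auto
        then show ?thesis by (simp add: ennreal_mult')
      qed
      have "(\<integral>\<^sup>+p. ennreal ((tail_kernel g1 g2 p - f p)\<^sup>2) \<partial>(lborel \<Otimes>\<^sub>M lborel)) \<le>
          (\<integral>\<^sup>+p. ennreal (c\<^sup>2) * (ennreal ((D (fst p) (snd p))\<^sup>2) + ennreal ((D (snd p) (fst p))\<^sup>2) +
            3 * ennreal ((G (fst p) (snd p))\<^sup>2)) \<partial>(lborel \<Otimes>\<^sub>M lborel))"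
        using bound by (intro nn_integral_mono) (metis prod.collapse)
      also have "\<dots> = (\<integral>\<^sup>+x. \<integral>\<^sup>+y. ennreal (c\<^sup>2) * (ennreal ((D x y)\<^sup>2) + ennreal ((D y x)\<^sup>2) +
            3 * ennreal ((G x y)\<^sup>2)) \<partial>lborel \<partial>lborel)"
        using D' by (subst lborel.nn_integral_fst[symmetric]) simp_all
      also have "\<dots> = ennreal (c\<^sup>2) * ((\<integral>\<^sup>+x. \<integral>\<^sup>+y. ennreal ((D x y)\<^sup>2) \<partial>lborel \<partial>lborel) +
          (\<integral>\<^sup>+x. \<integral>\<^sup>+y. ennreal ((D y x)\<^sup>2) \<partial>lborel \<partial>lborel) + 3 * (\<integral>\<^sup>+x. \<integral>\<^sup>+y. ennreal ((G x y)\<^sup>2) \<partial>lborel \<partial>lborel))"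
      proof -
        have [measurable]: "(\<lambda>x. \<integral>\<^sup>+y. ennreal ((D x y)\<^sup>2) \<partial>lborel) \<in> borel_measurable borel"
          "(\<lambda>x. \<integral>\<^sup>+y. ennreal ((D y x)\<^sup>2) \<partial>lborel) \<in> borel_measurable borel"
          "(\<lambda>x. \<integral>\<^sup>+y. ennreal ((G x y)\<^sup>2) \<partial>lborel) \<in> borel_measurable borel"
          unfolding D_def G_def by measurable
        show ?thesis using Dx by (simp add: nn_integral_add nn_integral_cmult)
      qed
      also have "(\<integral>\<^sup>+x. \<integral>\<^sup>+y. ennreal ((D y x)\<^sup>2) \<partial>lborel \<partial>lborel) = (\<integral>\<^sup>+x. \<integral>\<^sup>+y. ennreal ((D x y)\<^sup>2) \<partial>lborel \<partial>lborel)"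
        by (rule lborel_pair.Fubini') (simp add: case_prod_unfold)
      also have "(\<integral>\<^sup>+x. \<integral>\<^sup>+y. ennreal ((G x y)\<^sup>2) \<partial>lborel \<partial>lborel) = ennreal (T n)"
        unfolding G_def T_def using mesh_diagonal_L2[OF n] by simp
      also have "ennreal (c\<^sup>2) * ((\<integral>\<^sup>+x. \<integral>\<^sup>+y. ennreal ((D x y)\<^sup>2) \<partial>lborel \<partial>lborel) +
          (\<integral>\<^sup>+x. \<integral>\<^sup>+y. ennreal ((D x y)\<^sup>2) \<partial>lborel \<partial>lborel) + 3 * ennreal (T n)) \<le>
          ennreal (c\<^sup>2) * (X n + X n + 3 * ennreal (T n))"
        unfolding D_def X_def by (intro mult_left_mono add_mono mesh_product_L2 n g) auto
      also have "3 * ennreal (T n) = ennreal (3 * T n)"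
        using T by (simp add: ennreal_mult')
      also have "ennreal (c\<^sup>2) * (X n + X n + ennreal (3 * T n)) \<le> ennreal (c\<^sup>2) * ennreal e"
        using XT by (intro mult_left_mono) auto
      finally show ?thesis using e by (simp add: ennreal_mult')
    qed
  qed
qed

end

section \<open>The normalizing constant\<close>

text \<open>The factor \<open>q\<close> removes the pole: \<open>q * Beta p q\<close> equals
  \<open>Gamma p * Gamma (q + 1) / Gamma (p + q)\<close>, which is continuous at
  \<open>p = 1/2\<close>, \<open>q = 0\<close> with the value \<open>Gamma 1 = 1\<close>.\<close>

lemma Beta_times_second_tendsto:
  fixes p q :: "'i \<Rightarrow> real"
  assumes p: "(p \<longlongrightarrow> 1/2) F" and q: "(q \<longlongrightarrow> 0) F" and q0: "\<forall>\<^sub>F i in F. 0 < q i"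
  shows "((\<lambda>i. q i * Beta (p i) (q i)) \<longlongrightarrow> 1) F"
proof -
  have nz: "1/2 \<notin> (\<int>\<^sub>\<le>\<^sub>0 :: real set)" "1 \<notin> (\<int>\<^sub>\<le>\<^sub>0 :: real set)"
    by (auto elim!: nonpos_Ints_cases)
  have "((\<lambda>i. Gamma (p i) * Gamma (q i + 1) / Gamma (p i + q i)) \<longlongrightarrow> Gamma (1/2) * Gamma (0 + 1) / Gamma (1/2 + 0)) F"
    using nz by (intro tendsto_intros p q) (auto simp: Gamma_eq_zero_iff)
  also have "Gamma (1/2) * Gamma (0 + 1) / Gamma (1/2 + 0) = (1 :: real)"
    using nz by (simp add: Gamma_eq_zero_iff)
  finally show ?thesis
  proof (rule Lim_transform_eventually)
    show "\<forall>\<^sub>F i in F. Gamma (p i) * Gamma (q i + 1) / Gamma (p i + q i) = q i * Beta (p i) (q i)"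
      using q0
    proof eventually_elim
      case (elim i)
      then have "q i \<notin> \<int>\<^sub>\<le>\<^sub>0" by (auto elim!: nonpos_Ints_cases)
      then show ?case by (simp add: Beta_def Gamma_plus1)
    qed
  qed
qed

text \<open>With \<open>a = -1/2 - g1\<close> and \<open>b = -1/2 - g2\<close>, the number \<open>2 \<surd>(a b) / (a + b)\<close> is the
  correlation of the two Gaussian variables whose product dominates.\<close>

lemma rosenblatt_const_asymptotics:
  fixes g1 g2 :: "'i \<Rightarrow> real"
  assumes domain: "\<And>i. (g1 i, g2 i) \<in> rosenblatt_domain"
    and g1: "(g1 \<longlongrightarrow> -1/2) F" and g2: "(g2 \<longlongrightarrow> -1/2) F"
    and \<rho>: "0 \<le> \<rho>" and ratio: "((\<lambda>i. (g1 i + 1/2) / (g2 i + 1/2)) \<longlongrightarrow> \<rho>) F"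
  defines "c \<equiv> \<lambda>i. rosenblatt_const (g1 i) (g2 i)" and "r2 \<equiv> 4 * \<rho> / (1 + \<rho>)\<^sup>2"
  shows "((\<lambda>i. (c i)\<^sup>2) \<longlongrightarrow> 0) F"
    and "((\<lambda>i. (c i)\<^sup>2 * (1 + 1 / (-2 * g1 i - 1) + 1 / (-2 * g2 i - 1))) \<longlongrightarrow> 0) F"
    and "((\<lambda>i. (c i)\<^sup>2 / ((-2 * g1 i - 1) * (-2 * g2 i - 1))) \<longlongrightarrow> 1 / (1 + r2)) F"
    and "((\<lambda>i. c i / (- g1 i - g2 i - 1)) \<longlongrightarrow> sqrt (r2 / (1 + r2))) F"
    and "\<forall>\<^sub>F i in F. 0 \<le> c i"
proof -
  define a where "a i = - 1/2 - g1 i" for i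
  define b where "b i = - 1/2 - g2 i" for i
  have ab: "0 < a i" "0 < b i" "a i + b i < 1/2" for i
    using domain[of i] by (auto simp: rosenblatt_domain_def a_def b_def)
  have g: "g1 i = - 1/2 - a i" "g2 i = - 1/2 - b i" for i by (simp_all add: a_def b_def)
  have a0: "(a \<longlongrightarrow> 0) F" unfolding a_def by (rule tendsto_eq_intros g1 refl | simp)+
  have b0: "(b \<longlongrightarrow> 0) F" unfolding b_def by (rule tendsto_eq_intros g2 refl | simp)+
  have ratio': "((\<lambda>i. a i / b i) \<longlongrightarrow> \<rho>) F"
    using ratio by (simp add: g)
  have r2: "0 \<le> r2" using \<rho> by (simp add: r2_def)
  \<comment> \<open>Dividing numerator and denominator by the square of \<open>b i\<close> leaves a
    continuous function of the ratio \<open>a i / b i\<close>.\<close>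
  have R: "((\<lambda>i. 4 * (a i * b i) / (a i + b i)\<^sup>2) \<longlongrightarrow> r2) F"
  proof -
    have "((\<lambda>i. 4 * (a i / b i) / (1 + a i / b i)\<^sup>2) \<longlongrightarrow> r2) F"
      unfolding r2_def using \<rho> by (intro tendsto_intros ratio') auto
    moreover have "4 * (a i / b i) / (1 + a i / b i)\<^sup>2 = 4 * (a i * b i) / (a i + b i)\<^sup>2" for i
    proof -
      have "1 + a i / b i = (a i + b i) / b i" using ab[of i] by (simp add: field_simps)
      then show ?thesis using ab[of i] by (simp add: power_divide power2_eq_square)
    qed
    ultimately show ?thesis by simp
  qed
  define y where "y i = Beta (g1 i + 1) (a i + b i) * Beta (g2 i + 1) (a i + b i) +
    Beta (g1 i + 1) (2 * a i) * Beta (g2 i + 1) (2 * b i)" for i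
  define x where "x i = (1 - (a i + b i)) * (1 - 2 * (a i + b i))" for i
  have c_eq: "c i = sqrt (x i) / sqrt (y i)" for i
  proof -
    have e: "- g1 i - g2 i - 1 = a i + b i" "- 2 * g1 i - 1 = 2 * a i" "- 2 * g2 i - 1 = 2 * b i"
      "g1 i + g2 i + 2 = 1 - (a i + b i)" "2 * (g1 i + g2 i) + 3 = 1 - 2 * (a i + b i)"
      by (simp_all add: g)
    show ?thesis unfolding c_def rosenblatt_const_def x_def y_def e ..
  qed
  have x: "0 < x i" for i using ab[of i] by (simp add: x_def)
  have ab0: "((\<lambda>i. a i + b i) \<longlongrightarrow> 0) F" by (rule tendsto_eq_intros a0 b0 refl | simp)+
  have xl: "(x \<longlongrightarrow> 1) F" unfolding x_def by (rule tendsto_eq_intros ab0 refl | simp)+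
  have G1: "((\<lambda>i. g1 i + 1) \<longlongrightarrow> 1/2) F" by (rule tendsto_eq_intros g1 refl | simp)+
  have G2: "((\<lambda>i. g2 i + 1) \<longlongrightarrow> 1/2) F" by (rule tendsto_eq_intros g2 refl | simp)+
  have a2: "((\<lambda>i. 2 * a i) \<longlongrightarrow> 0) F" and b2: "((\<lambda>i. 2 * b i) \<longlongrightarrow> 0) F"
    by (rule tendsto_eq_intros a0 b0 refl | simp)+
  have pos: "\<forall>\<^sub>F i in F. 0 < a i + b i" "\<forall>\<^sub>F i in F. 0 < 2 * a i" "\<forall>\<^sub>F i in F. 0 < 2 * b i"
    using ab by (auto intro!: always_eventually add_pos_pos)
  \<comment> \<open>The two products of Beta values grow like \<open>1 / (a + b)^2\<close> and
    \<open>1 / (4 * a * b)\<close>; the factor \<open>4 * a * b\<close> makes their sum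
    converge.\<close>
  have "((\<lambda>i. 4 * (a i * b i) / (a i + b i)\<^sup>2 *
      (((a i + b i) * Beta (g1 i + 1) (a i + b i)) * ((a i + b i) * Beta (g2 i + 1) (a i + b i))) +
      (2 * a i * Beta (g1 i + 1) (2 * a i)) * (2 * b i * Beta (g2 i + 1) (2 * b i))) \<longlongrightarrow>
      r2 * (1 * 1) + 1 * 1) F"
    by (intro tendsto_add tendsto_mult R Beta_times_second_tendsto G1 G2 ab0 a2 b2 pos)
  moreover have "4 * (a i * b i) / (a i + b i)\<^sup>2 *
      (((a i + b i) * Beta (g1 i + 1) (a i + b i)) * ((a i + b i) * Beta (g2 i + 1) (a i + b i))) +
      (2 * a i * Beta (g1 i + 1) (2 * a i)) * (2 * b i * Beta (g2 i + 1) (2 * b i)) = 4 * (a i * b i) * y i" for i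
  proof -
    have cancel: "4 * (a i * b i) / (a i + b i)\<^sup>2 * (((a i + b i) * u) * ((a i + b i) * v)) = 4 * (a i * b i) * (u * v)" for u v
      using ab[of i] by (simp add: power2_eq_square)
    show ?thesis by (simp only: cancel y_def distrib_left) (simp add: mult_ac)
  qed
  ultimately have yl: "((\<lambda>i. 4 * (a i * b i) * y i) \<longlongrightarrow> 1 + r2) F"
    by (simp add: add.commute)
  \<comment> \<open>The positivity that allows squaring the root in \<open>c i\<close> is read off
    from the positive limit \<open>1 + r2\<close>.\<close>
  have "\<forall>\<^sub>F i in F. 0 < 4 * (a i * b i) * y i"
    using r2 by (intro order_tendstoD(1)[OF yl]) simp
  then have ypos: "\<forall>\<^sub>F i in F. 0 < y i"
    by eventually_elim (use ab in \<open>auto simp: zero_less_mult_iff mult_less_0_iff dest: order.asym\<close>)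
  then show "\<forall>\<^sub>F i in F. 0 \<le> c i"
    by eventually_elim (use x in \<open>auto simp: c_eq less_imp_le\<close>)
  have "((\<lambda>i. x i / (4 * (a i * b i) * y i)) \<longlongrightarrow> 1 / (1 + r2)) F"
    using r2 by (intro tendsto_divide xl yl) simp
  then have main: "((\<lambda>i. (c i)\<^sup>2 / (4 * (a i * b i))) \<longlongrightarrow> 1 / (1 + r2)) F"
  proof (rule Lim_transform_eventually)
    show "\<forall>\<^sub>F i in F. x i / (4 * (a i * b i) * y i) = (c i)\<^sup>2 / (4 * (a i * b i))"
      using ypos
    proof eventually_elim
      case (elim i)
      have "(c i)\<^sup>2 = x i / y i"
        using x[of i] elim by (simp add: c_eq power_divide)
      then show ?case by (simp add: mult.commute)
    qed
  qed
  have e: "(- 2 * g1 i - 1) = 2 * a i" "(- 2 * g2 i - 1) = 2 * b i" "- g1 i - g2 i - 1 = a i + b i" for i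
    by (simp_all add: g)
  show "((\<lambda>i. (c i)\<^sup>2 / ((-2 * g1 i - 1) * (-2 * g2 i - 1))) \<longlongrightarrow> 1 / (1 + r2)) F"
    unfolding e using main by (simp add: mult_ac)
  have "((\<lambda>i. (c i)\<^sup>2 / (4 * (a i * b i)) * (4 * (a i * b i))) \<longlongrightarrow> 1 / (1 + r2) * (4 * (0 * 0))) F"
    by (intro tendsto_mult main a0 b0 tendsto_const)
  moreover have "(c i)\<^sup>2 / (4 * (a i * b i)) * (4 * (a i * b i)) = (c i)\<^sup>2" for i
    using ab[of i] by simp
  ultimately show "((\<lambda>i. (c i)\<^sup>2) \<longlongrightarrow> 0) F"
    by simp
  \<comment> \<open>The second factor is \<open>4 * a * b\<close> times
    \<open>1 + 1 / (2 * a) + 1 / (2 * b)\<close>. It tends to zero, which makes everything but the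
    pure tail part of the kernel negligible.\<close>
  have "((\<lambda>i. (c i)\<^sup>2 / (4 * (a i * b i)) * (4 * (a i * b i) + 2 * b i + 2 * a i)) \<longlongrightarrow>
      1 / (1 + r2) * (4 * (0 * 0) + 2 * 0 + 2 * 0)) F"
    by (intro tendsto_mult tendsto_add main a0 b0 tendsto_const)
  moreover have "(c i)\<^sup>2 / (4 * (a i * b i)) * (4 * (a i * b i) + 2 * b i + 2 * a i) =
      (c i)\<^sup>2 * (1 + 1 / (-2 * g1 i - 1) + 1 / (-2 * g2 i - 1))" for i
    unfolding e using ab[of i] by (simp add: field_simps)
  ultimately show "((\<lambda>i. (c i)\<^sup>2 * (1 + 1 / (-2 * g1 i - 1) + 1 / (-2 * g2 i - 1))) \<longlongrightarrow> 0) F"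
    by simp
  have "((\<lambda>i. sqrt ((c i)\<^sup>2 / (4 * (a i * b i)) * (4 * (a i * b i) / (a i + b i)\<^sup>2))) \<longlongrightarrow> sqrt (1 / (1 + r2) * r2)) F"
    by (intro tendsto_real_sqrt tendsto_mult main R)
  then have "((\<lambda>i. sqrt ((c i)\<^sup>2 / (4 * (a i * b i)) * (4 * (a i * b i) / (a i + b i)\<^sup>2))) \<longlongrightarrow> sqrt (r2 / (1 + r2))) F"
    by simp
  then show "((\<lambda>i. c i / (- g1 i - g2 i - 1)) \<longlongrightarrow> sqrt (r2 / (1 + r2))) F"
  proof (rule Lim_transform_eventually)
    show "\<forall>\<^sub>F i in F. sqrt ((c i)\<^sup>2 / (4 * (a i * b i)) * (4 * (a i * b i) / (a i + b i)\<^sup>2)) = c i / (- g1 i - g2 i - 1)"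
      using ypos
    proof eventually_elim
      case (elim i)
      have eq: "(c i)\<^sup>2 / (4 * (a i * b i)) * (4 * (a i * b i) / (a i + b i)\<^sup>2) = (c i / (a i + b i))\<^sup>2"
        using ab[of i] by (simp add: power_divide)
      have "0 \<le> c i / (a i + b i)"
        using x[of i] elim ab[of i] by (simp add: c_eq)
      then show ?case unfolding e eq real_sqrt_abs by (rule abs_of_nonneg)
    qed
  qed
qed

section \<open>The law of the limit\<close>

text \<open>Numerator and denominator are multiplied by \<open>2 * sqrt \<rho>\<close>. In terms of
  the correlation \<open>r\<close> the singularity at \<open>\<rho> = 0\<close> is gone, and
  \<open>1 + r\<close> and \<open>r - 1\<close> are twice the eigenvalues of the limiting quadratic
  form.\<close>

lemma coeff_formulas:
  assumes "0 < \<rho>"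
  defines "r \<equiv> 2 * sqrt \<rho> / (1 + \<rho>)"
  shows "coeff1_formula \<rho> = (1 + r) / sqrt (2 * (1 + r\<^sup>2))"
    and "coeff2_formula \<rho> = (r - 1) / sqrt (2 * (1 + r\<^sup>2))"
proof -
  define q where "q = sqrt \<rho>"
  have q: "0 < q" "\<rho> = q\<^sup>2" using assms by (simp_all add: q_def)
  have r: "r = 2 * q / (1 + q\<^sup>2)" unfolding r_def q_def[symmetric] by (simp add: q(2))
  have p: "0 < 1 + q\<^sup>2" by (simp add: add_pos_nonneg)
  have i1: "2 * q * inverse (\<rho> + 1) = r" by (simp add: r q(2) field_simps)
  have i2: "2 * q * inverse (2 * sqrt \<rho>) = 1" using q by (simp flip: q_def)
  have "(2 * q)\<^sup>2 * (2 * (inverse (\<rho> + 1))\<^sup>2 + inverse (2 * \<rho>)) =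
      2 * (2 * q * inverse (\<rho> + 1))\<^sup>2 + 4 * q\<^sup>2 * inverse (2 * q\<^sup>2)"
    by (simp add: q(2) power_mult_distrib algebra_simps)
  also have "4 * q\<^sup>2 * inverse (2 * q\<^sup>2) = 2" using q by simp
  finally have "2 * (1 + r\<^sup>2) = (2 * q)\<^sup>2 * (2 * (inverse (\<rho> + 1))\<^sup>2 + inverse (2 * \<rho>))"
    by (simp add: i1)
  then have s: "sqrt (2 * (1 + r\<^sup>2)) = 2 * q * sqrt (2 * (inverse (\<rho> + 1))\<^sup>2 + inverse (2 * \<rho>))"
    using q by (simp add: real_sqrt_mult)
  have "2 * q \<noteq> 0" using q by simp
  then have c: "u / v = 2 * q * u / (2 * q * v)" for u v
    by simp
  show "coeff1_formula \<rho> = (1 + r) / sqrt (2 * (1 + r\<^sup>2))"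
    unfolding coeff1_formula_def s by (subst c) (simp only: distrib_left i1 i2, simp add: add.commute)
  show "coeff2_formula \<rho> = (r - 1) / sqrt (2 * (1 + r\<^sup>2))"
    unfolding coeff2_formula_def s by (subst c) (simp only: right_diff_distrib i1 i2)
qed

text \<open>At \<open>\<rho> = 0\<close> the coefficients are defined as one-sided limits; these are
  computed from the expressions in \<open>r\<close>, which are continuous there.\<close>

lemma coeffs_eq:
  assumes "0 \<le> \<rho>"
  defines "r \<equiv> 2 * sqrt \<rho> / (1 + \<rho>)"
  shows "coeff1 \<rho> = (1 + r) / sqrt (2 * (1 + r\<^sup>2))" and "coeff2 \<rho> = (r - 1) / sqrt (2 * (1 + r\<^sup>2))"
proof -
  have 0: "Lim (at_right 0) f = l"
    if l: "((\<lambda>\<rho>. g (2 * sqrt \<rho> / (1 + \<rho>))) \<longlongrightarrow> l) (at_right 0)"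
      and f: "\<And>\<rho>. 0 < \<rho> \<Longrightarrow> f \<rho> = g (2 * sqrt \<rho> / (1 + \<rho>))" for f g :: "real \<Rightarrow> real" and l
  proof (rule tendsto_Lim)
    show "(f \<longlongrightarrow> l) (at_right 0)"
      using l by (rule Lim_transform_eventually) (simp add: eventually_at_filter f)
  qed simp
  have R: "((\<lambda>\<rho>. 2 * sqrt \<rho> / (1 + \<rho>)) \<longlongrightarrow> 2 * sqrt 0 / (1 + 0)) (at_right 0)"
    by (intro tendsto_intros) simp_all
  have nz: "sqrt (2 * (1 + (2 * sqrt 0 / (1 + 0 :: real))\<^sup>2)) \<noteq> 0" by simp
  have "Lim (at_right 0) coeff1_formula = (1 + 2 * sqrt 0 / (1 + 0)) / sqrt (2 * (1 + (2 * sqrt 0 / (1 + 0))\<^sup>2))"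
    by (rule 0[where g = "\<lambda>r. (1 + r) / sqrt (2 * (1 + r\<^sup>2))"])
      (use coeff_formulas nz in \<open>intro tendsto_intros R | simp\<close>)+
  moreover have "Lim (at_right 0) coeff2_formula = (2 * sqrt 0 / (1 + 0) - 1) / sqrt (2 * (1 + (2 * sqrt 0 / (1 + 0))\<^sup>2))"
    by (rule 0[where g = "\<lambda>r. (r - 1) / sqrt (2 * (1 + r\<^sup>2))"])
      (use coeff_formulas nz in \<open>intro tendsto_intros R | simp\<close>)+
  ultimately show "coeff1 \<rho> = (1 + r) / sqrt (2 * (1 + r\<^sup>2))" "coeff2 \<rho> = (r - 1) / sqrt (2 * (1 + r\<^sup>2))"
    using assms(1) coeff_formulas[of \<rho>] by (cases "\<rho> = 0"; simp add: coeff1_def coeff2_def r_def)+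
qed

lemma distr_std_gauss_pair_eqI:
  fixes f :: "'c \<Rightarrow> real" and g :: "real \<times> real \<Rightarrow> real"
  assumes [measurable]: "f \<in> borel_measurable K" "g \<in> borel_measurable (borel \<Otimes>\<^sub>M borel)"
    and eq: "\<And>h. h \<in> borel_measurable borel \<Longrightarrow>
      (\<integral>\<^sup>+\<omega>. h (f \<omega>) \<partial>K) = (\<integral>\<^sup>+x. \<integral>\<^sup>+y. h (g (x, y)) \<partial>std_gauss \<partial>std_gauss)"
  shows "distr K borel f = distr (std_gauss \<Otimes>\<^sub>M std_gauss) borel g"
proof (rule measure_eqI)
  fix S assume "S \<in> sets (distr K borel f)"
  then have [measurable]: "S \<in> sets borel" by simp
  have "emeasure (distr K borel f) S = (\<integral>\<^sup>+z. indicator S z \<partial>distr K borel f)"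
    by simp
  also have "\<dots> = (\<integral>\<^sup>+\<omega>. indicator S (f \<omega>) \<partial>K)"
    by (rule nn_integral_distr) measurable
  also have "\<dots> = (\<integral>\<^sup>+x. \<integral>\<^sup>+y. indicator S (g (x, y)) \<partial>std_gauss \<partial>std_gauss)"
    by (rule eq) measurable
  also have "\<dots> = (\<integral>\<^sup>+p. indicator S (g p) \<partial>(std_gauss \<Otimes>\<^sub>M std_gauss))"
    by (rule std_gauss.nn_integral_fst) measurable
  also have "\<dots> = (\<integral>\<^sup>+z. indicator S z \<partial>distr (std_gauss \<Otimes>\<^sub>M std_gauss) borel g)"
    by (rule nn_integral_distr[symmetric]) measurable
  finally show "emeasure (distr K borel f) S = emeasure (distr (std_gauss \<Otimes>\<^sub>M std_gauss) borel g) S"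
    by simp
qed simp

text \<open>The form \<open>r * x^2 + sqrt (1 - r^2) * x * y\<close> has trace \<open>r\<close> and
  determinant \<open>- (1 - r^2) / 4\<close>, hence eigenvalues \<open>(r + 1) / 2\<close> and
  \<open>(r - 1) / 2\<close>. They add up to \<open>r\<close>, so the centring constant splits along
  with the trace.\<close>

lemma gauss_quadratic_form_diagonal:
  fixes r :: real
  assumes r: "0 \<le> r" "r \<le> 1" and [measurable]: "h \<in> borel_measurable borel"
  shows "(\<integral>\<^sup>+x. \<integral>\<^sup>+y. h (k * (r * (x\<^sup>2 - 1) + sqrt (1 - r\<^sup>2) * x * y)) \<partial>std_gauss \<partial>std_gauss) =
    (\<integral>\<^sup>+x. \<integral>\<^sup>+y. h (k * ((1 + r) / 2 * (x\<^sup>2 - 1) - (1 - r) / 2 * (y\<^sup>2 - 1))) \<partial>std_gauss \<partial>std_gauss)"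
proof -
  \<comment> \<open>rotation by half of the angle whose cosine is r\<close>
  define c where "c = sqrt ((1 + r) / 2)"
  define s where "s = - sqrt ((1 - r) / 2)"
  have c: "c\<^sup>2 = (1 + r) / 2" and s: "s\<^sup>2 = (1 - r) / 2"
    using r by (simp_all add: c_def s_def)
  have cs: "c\<^sup>2 + s\<^sup>2 = 1" "r = c\<^sup>2 - s\<^sup>2" by (simp_all add: c s field_simps)
  have "sqrt (1 - r\<^sup>2) = sqrt (4 * ((1 + r) / 2 * ((1 - r) / 2)))"
    by (simp add: power2_eq_square field_simps)
  also have "\<dots> = 2 * (c * (- s))"
    by (simp add: c_def s_def real_sqrt_mult real_sqrt_divide)
  finally have sq: "sqrt (1 - r\<^sup>2) = - 2 * c * s" by simp
  have diag: "r * ((c * x + s * y)\<^sup>2 - 1) + sqrt (1 - r\<^sup>2) * (c * x + s * y) * (c * y - s * x) =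
      (1 + r) / 2 * (x\<^sup>2 - 1) - (1 - r) / 2 * (y\<^sup>2 - 1)" for x y
  proof -
    have "r * (c * x + s * y)\<^sup>2 + sqrt (1 - r\<^sup>2) * (c * x + s * y) * (c * y - s * x) =
        (c * x + s * y) * ((c\<^sup>2 + s\<^sup>2) * (c * x - s * y))"
      unfolding sq unfolding cs(2) by (simp add: power2_eq_square algebra_simps)
    also have "\<dots> = c\<^sup>2 * x\<^sup>2 - s\<^sup>2 * y\<^sup>2"
      unfolding cs(1) by (simp add: power2_eq_square algebra_simps)
    finally have "r * (c * x + s * y)\<^sup>2 + sqrt (1 - r\<^sup>2) * (c * x + s * y) * (c * y - s * x) =
        (1 + r) / 2 * x\<^sup>2 - (1 - r) / 2 * y\<^sup>2"
      unfolding c s .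
    then show ?thesis by (simp add: right_diff_distrib) (simp add: field_simps)
  qed
  have "(\<integral>\<^sup>+x. \<integral>\<^sup>+y. h (k * (r * (x\<^sup>2 - 1) + sqrt (1 - r\<^sup>2) * x * y)) \<partial>std_gauss \<partial>std_gauss) =
      (\<integral>\<^sup>+x. \<integral>\<^sup>+y. h (k * (r * ((c * x + s * y)\<^sup>2 - 1) + sqrt (1 - r\<^sup>2) * (c * x + s * y) * (c * y - s * x)))
        \<partial>std_gauss \<partial>std_gauss)"
    using std_gauss_rotation[of "\<lambda>(x, y). h (k * (r * (x\<^sup>2 - 1) + sqrt (1 - r\<^sup>2) * x * y))" c s] cs(1) by simp
  then show ?thesis unfolding diag .
qed

text \<open>The target law is brought into the shape in which the approximations come, a combination
  of \<open>x^2 - 1\<close> and \<open>x * y\<close>; convergence in law is then a matter of two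
  converging coefficients.\<close>

lemma chi_squared_pair_law:
  assumes N: "prob_space N" and X1: "std_chi_squared_1 N X1" and X2: "std_chi_squared_1 N X2"
    and indep: "prob_space.indep_var N borel X1 borel X2" and \<rho>: "0 \<le> \<rho>" "\<rho> \<le> 1"
  defines "r2 \<equiv> 4 * \<rho> / (1 + \<rho>)\<^sup>2"
  shows "distr N borel (\<lambda>\<omega>. coeff1 \<rho> * X1 \<omega> + coeff2 \<rho> * X2 \<omega>) =
    distr (std_gauss \<Otimes>\<^sub>M std_gauss) borel
      (\<lambda>(x, y). sqrt (r2 / (1 + r2)) * (x\<^sup>2 - 1) + sqrt ((1 - r2) / (1 + r2)) * x * y)"
proof (rule distr_std_gauss_pair_eqI)
  interpret N: prob_space N by (rule N)
  have [measurable]: "X1 \<in> borel_measurable N" "X2 \<in> borel_measurable N"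
    using X1 X2 by (simp_all add: std_chi_squared_1_def)
  show "(\<lambda>\<omega>. coeff1 \<rho> * X1 \<omega> + coeff2 \<rho> * X2 \<omega>) \<in> borel_measurable N" by measurable
  show "(\<lambda>(x, y). sqrt (r2 / (1 + r2)) * (x\<^sup>2 - 1) + sqrt ((1 - r2) / (1 + r2)) * x * y) \<in>
      borel_measurable (borel \<Otimes>\<^sub>M borel)" by measurable
  fix h :: "real \<Rightarrow> ennreal" assume [measurable]: "h \<in> borel_measurable borel"
  define r where "r = 2 * sqrt \<rho> / (1 + \<rho>)"
  have r2: "r2 = r\<^sup>2" using \<rho> by (simp add: r2_def r_def power_divide power_mult_distrib)
  \<comment> \<open>The upper bound is the inequality of arithmetic and geometric means for 1 and
    \<rho>.\<close>
  have r: "0 \<le> r" "r \<le> 1"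
  proof -
    show "0 \<le> r" using \<rho> by (simp add: r_def)
    have "2 * sqrt \<rho> \<le> 1 + \<rho>"
      using sum_squares_bound[of 1 "sqrt \<rho>"] \<rho> by simp
    then show "r \<le> 1" using \<rho> by (simp add: r_def)
  qed
  let ?psi = "\<lambda>x :: real. (x\<^sup>2 - 1) / sqrt 2"
  let ?g = "\<lambda>(u, v). h (coeff1 \<rho> * u + coeff2 \<rho> * v)"
  have d: "distr N borel X1 = distr std_gauss borel ?psi" "distr N borel X2 = distr std_gauss borel ?psi"
    using X1 X2 by (simp_all add: std_chi_squared_1_def)
  have "(\<integral>\<^sup>+\<omega>. h (coeff1 \<rho> * X1 \<omega> + coeff2 \<rho> * X2 \<omega>) \<partial>N) =
      (\<integral>\<^sup>+p. ?g p \<partial>distr N (borel \<Otimes>\<^sub>M borel) (\<lambda>\<omega>. (X1 \<omega>, X2 \<omega>)))"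
    by (subst nn_integral_distr) auto
  also have "distr N (borel \<Otimes>\<^sub>M borel) (\<lambda>\<omega>. (X1 \<omega>, X2 \<omega>)) = distr N borel X1 \<Otimes>\<^sub>M distr N borel X2"
    using indep by (simp add: N.indep_var_distribution_eq)
  also have "\<dots> = distr (std_gauss \<Otimes>\<^sub>M std_gauss) (borel \<Otimes>\<^sub>M borel) (\<lambda>(x, y). (?psi x, ?psi y))"
    unfolding d
  proof (rule pair_measure_distr)
    interpret psi: prob_space "distr std_gauss borel ?psi" by (rule std_gauss.prob_space_distr) measurable
    show "sigma_finite_measure (distr std_gauss borel ?psi)" ..
  qed measurable
  also have "(\<integral>\<^sup>+p. ?g p \<partial>distr (std_gauss \<Otimes>\<^sub>M std_gauss) (borel \<Otimes>\<^sub>M borel) (\<lambda>(x, y). (?psi x, ?psi y))) =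
      (\<integral>\<^sup>+p. h (coeff1 \<rho> * ?psi (fst p) + coeff2 \<rho> * ?psi (snd p)) \<partial>(std_gauss \<Otimes>\<^sub>M std_gauss))"
    by (subst nn_integral_distr) (auto simp: case_prod_unfold)
  also have "\<dots> = (\<integral>\<^sup>+x. \<integral>\<^sup>+y. h (coeff1 \<rho> * ?psi x + coeff2 \<rho> * ?psi y) \<partial>std_gauss \<partial>std_gauss)"
    by (subst std_gauss.nn_integral_fst[symmetric]) auto
  also have "\<dots> = (\<integral>\<^sup>+x. \<integral>\<^sup>+y. h (1 / sqrt (1 + r\<^sup>2) * ((1 + r) / 2 * (x\<^sup>2 - 1) - (1 - r) / 2 * (y\<^sup>2 - 1)))
      \<partial>std_gauss \<partial>std_gauss)"
  proof -
    have "coeff1 \<rho> * ?psi x + coeff2 \<rho> * ?psi y =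
        1 / sqrt (1 + r\<^sup>2) * ((1 + r) / 2 * (x\<^sup>2 - 1) - (1 - r) / 2 * (y\<^sup>2 - 1))" for x y
    proof -
      define u where "u = sqrt (1 + r\<^sup>2)"
      have u: "0 < u" by (simp add: u_def add_pos_nonneg)
      have "coeff1 \<rho> * ?psi x = 1 / u * ((1 + r) / 2 * (x\<^sup>2 - 1))" for x
        unfolding coeffs_eq(1)[OF \<rho>(1)] r_def[symmetric] real_sqrt_mult u_def[symmetric]
        using u by (simp add: field_simps)
      moreover have "coeff2 \<rho> * ?psi y = - (1 / u * ((1 - r) / 2 * (y\<^sup>2 - 1)))" for y
        unfolding coeffs_eq(2)[OF \<rho>(1)] r_def[symmetric] real_sqrt_mult u_def[symmetric]
        using u by (simp add: field_simps)
      ultimately show ?thesis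
        unfolding u_def[symmetric] by (simp only: right_diff_distrib)
    qed
    then show ?thesis by simp
  qed
  also have "\<dots> = (\<integral>\<^sup>+x. \<integral>\<^sup>+y. h (1 / sqrt (1 + r\<^sup>2) * (r * (x\<^sup>2 - 1) + sqrt (1 - r\<^sup>2) * x * y)) \<partial>std_gauss \<partial>std_gauss)"
    by (rule gauss_quadratic_form_diagonal[symmetric, OF r]) measurable
  also have "\<dots> = (\<integral>\<^sup>+x. \<integral>\<^sup>+y. h ((\<lambda>(x, y). sqrt (r2 / (1 + r2)) * (x\<^sup>2 - 1) + sqrt ((1 - r2) / (1 + r2)) * x * y) (x, y))
      \<partial>std_gauss \<partial>std_gauss)"
    using r by (simp add: r2 real_sqrt_divide add_divide_distrib)
  finally show "(\<integral>\<^sup>+\<omega>. h (coeff1 \<rho> * X1 \<omega> + coeff2 \<rho> * X2 \<omega>) \<partial>N) =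
    (\<integral>\<^sup>+x. \<integral>\<^sup>+y. h ((\<lambda>(x, y). sqrt (r2 / (1 + r2)) * (x\<^sup>2 - 1) + sqrt ((1 - r2) / (1 + r2)) * x * y) (x, y))
      \<partial>std_gauss \<partial>std_gauss)" .
qed

text \<open>Dominated convergence works along sequences, while \<open>F\<close> is an arbitrary
  filter. So the expectation is shown to be sequentially continuous in the pair of coefficients, and
  the filter enters by composition only.\<close>

lemma gauss_expectation_tendsto:
  assumes \<psi>: "continuous_on UNIV \<psi>" "\<And>y. \<bar>\<psi> y\<bar> \<le> (b :: real)"
    and k: "(k \<longlongrightarrow> k0) F" and l: "(l \<longlongrightarrow> l0) F"
  shows "((\<lambda>i. LINT p|(std_gauss \<Otimes>\<^sub>M std_gauss). \<psi> (k i * ((fst p)\<^sup>2 - 1) + l i * fst p * snd p)) \<longlongrightarrow>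
    (LINT p|(std_gauss \<Otimes>\<^sub>M std_gauss). \<psi> (k0 * ((fst p)\<^sup>2 - 1) + l0 * fst p * snd p))) F"
proof -
  define J where "J z = (LINT p|(std_gauss \<Otimes>\<^sub>M std_gauss). \<psi> (fst z * ((fst p)\<^sup>2 - 1) + snd z * fst p * snd p))"
    for z :: "real \<times> real"
  have [measurable]: "\<psi> \<in> borel_measurable borel"
    using \<psi>(1) by (rule borel_measurable_continuous_onI)
  have "continuous (at (k0, l0)) J"
    unfolding continuous_at_sequentially
  proof (intro allI impI)
    fix z assume z: "z \<longlonglongrightarrow> (k0, l0)"
    show "(J \<circ> z) \<longlonglongrightarrow> J (k0, l0)"
      unfolding J_def comp_def
    proof (rule integral_dominated_convergence[where w = "\<lambda>_. b"])
      show "AE p in std_gauss \<Otimes>\<^sub>M std_gauss. (\<lambda>i. \<psi> (fst (z i) * ((fst p)\<^sup>2 - 1) + snd (z i) * fst p * snd p)) \<longlonglongrightarrow>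
          \<psi> (fst (k0, l0) * ((fst p)\<^sup>2 - 1) + snd (k0, l0) * fst p * snd p)"
        by (intro always_eventually allI continuous_on_tendsto_compose[OF \<psi>(1)] tendsto_intros z) auto
    qed (use \<psi>(2) in auto)
  qed
  moreover have "((\<lambda>i. (k i, l i)) \<longlongrightarrow> (k0, l0)) F"
    by (intro tendsto_Pair k l)
  ultimately have "((\<lambda>i. J (k i, l i)) \<longlongrightarrow> J (k0, l0)) F"
    by (rule isCont_tendsto_compose)
  then show ?thesis by (simp add: J_def)
qed

text \<open>Follows from \<open>\<bar>x * y\<bar> \<le> (x^2 + y^2) / 2\<close> and unit second
  moments; it supplies the tightness of the random slopes.\<close>

lemma gauss_quadratic_form_abs:
  "(\<integral>\<^sup>+x. \<integral>\<^sup>+y. ennreal \<bar>k * (x\<^sup>2 - 1) + l * x * y\<bar> \<partial>std_gauss \<partial>std_gauss) \<le> ennreal (2 * \<bar>k\<bar> + \<bar>l\<bar>)"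
proof -
  have sq: "(\<integral>\<^sup>+x. ennreal (x\<^sup>2) \<partial>std_gauss) = 1"
  proof -
    have "(\<integral>\<^sup>+x. ennreal (x\<^sup>2) \<partial>std_gauss) = (\<integral>\<^sup>+x. ennreal (std_normal_density x * x\<^sup>2) \<partial>lborel)"
      by (simp add: nn_integral_std_gauss ennreal_mult')
    also have "\<dots> = ennreal (fact (2 * 1) / (2 ^ 1 * fact 1))"
      using std_normal_moment_even[of 1] by (subst nn_integral_eq_integral) (auto simp: has_bochner_integral_iff)
    finally show ?thesis by (simp add: fact_numeral)
  qed
  have one: "emeasure std_gauss UNIV = 1" using std_gauss.emeasure_space_1 by simp
  have "(\<integral>\<^sup>+x. \<integral>\<^sup>+y. ennreal \<bar>k * (x\<^sup>2 - 1) + l * x * y\<bar> \<partial>std_gauss \<partial>std_gauss) \<le>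
      (\<integral>\<^sup>+x. \<integral>\<^sup>+y. ennreal (\<bar>k\<bar> + \<bar>l\<bar> / 2) * ennreal (x\<^sup>2) + (ennreal \<bar>k\<bar> + ennreal (\<bar>l\<bar> / 2) * ennreal (y\<^sup>2)) \<partial>std_gauss \<partial>std_gauss)"
  proof (intro nn_integral_mono)
    fix x y :: real
    have xy: "\<bar>x * y\<bar> \<le> (x\<^sup>2 + y\<^sup>2) / 2"
      using sum_squares_bound[of x y] sum_squares_bound[of x "- y"] by (simp add: abs_le_iff)
    have "\<bar>k * (x\<^sup>2 - 1) + l * x * y\<bar> \<le> \<bar>k\<bar> * \<bar>x\<^sup>2 - 1\<bar> + \<bar>l\<bar> * \<bar>x * y\<bar>"
      using abs_triangle_ineq[of "k * (x\<^sup>2 - 1)" "l * x * y"] by (simp add: abs_mult)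
    also have "\<dots> \<le> \<bar>k\<bar> * (x\<^sup>2 + 1) + \<bar>l\<bar> * ((x\<^sup>2 + y\<^sup>2) / 2)"
      using xy by (intro add_mono mult_left_mono) (auto simp: abs_le_iff)
    also have "\<dots> = (\<bar>k\<bar> + \<bar>l\<bar> / 2) * x\<^sup>2 + (\<bar>k\<bar> + \<bar>l\<bar> / 2 * y\<^sup>2)"
      by (simp add: field_simps)
    finally have "ennreal \<bar>k * (x\<^sup>2 - 1) + l * x * y\<bar> \<le> ennreal ((\<bar>k\<bar> + \<bar>l\<bar> / 2) * x\<^sup>2 + (\<bar>k\<bar> + \<bar>l\<bar> / 2 * y\<^sup>2))"
      by (rule ennreal_leI)
    also have "\<dots> = ennreal (\<bar>k\<bar> + \<bar>l\<bar> / 2) * ennreal (x\<^sup>2) + (ennreal \<bar>k\<bar> + ennreal (\<bar>l\<bar> / 2) * ennreal (y\<^sup>2))"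
      by (simp add: ennreal_mult del: ennreal_plus) (simp add: ennreal_mult[symmetric] ennreal_plus[symmetric] del: ennreal_plus)
    finally show "ennreal \<bar>k * (x\<^sup>2 - 1) + l * x * y\<bar> \<le>
        ennreal (\<bar>k\<bar> + \<bar>l\<bar> / 2) * ennreal (x\<^sup>2) + (ennreal \<bar>k\<bar> + ennreal (\<bar>l\<bar> / 2) * ennreal (y\<^sup>2))" .
  qed
  also have "\<dots> = ennreal (\<bar>k\<bar> + \<bar>l\<bar> / 2) + (ennreal \<bar>k\<bar> + ennreal (\<bar>l\<bar> / 2))"
    by (simp add: nn_integral_add nn_integral_cmult sq one del: ennreal_plus)
  also have "\<dots> = ennreal (2 * \<bar>k\<bar> + \<bar>l\<bar>)"
    by (simp add: ennreal_plus[symmetric] del: ennreal_plus)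
  finally show ?thesis .
qed

section \<open>Convergence of the process\<close>

context white_noise
begin

text \<open>Collects what is obtained at fixed exponents: a random slope \<open>W\<close> of
  explicit law, and \<open>S\<close> as a bound for the squared uniform distance to the line of
  slope \<open>W\<close>. The tolerance \<open>- g1 - g2 - 1\<close> for the discretized covariances
  is positive in the domain and vanishes in the limit.\<close>

definition line_approximation :: "real \<Rightarrow> real \<Rightarrow> real \<Rightarrow> (real \<Rightarrow> 'a \<Rightarrow> real) \<Rightarrow>
    ('a \<Rightarrow> ennreal) \<Rightarrow> ('a \<Rightarrow> real) \<Rightarrow> real \<Rightarrow> real \<Rightarrow> bool" where
  "line_approximation C g1 g2 Z S W \<kappa> \<mu> \<longleftrightarrow> S \<in> borel_measurable M \<and> W \<in> borel_measurable M \<and>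
    (\<integral>\<^sup>+\<omega>. S \<omega> \<partial>M) \<le>
      ennreal (C * ((rosenblatt_const g1 g2)\<^sup>2 * (1 + 1 / (-2 * g1 - 1) + 1 / (-2 * g2 - 1)))) \<and>
    (\<forall>\<omega>\<in>space M. \<forall>t\<in>{0..1}. ennreal ((Z t \<omega> - t * W \<omega>)\<^sup>2) \<le> S \<omega>) \<and>
    (\<forall>h\<in>borel_measurable borel. (\<integral>\<^sup>+\<omega>. h (W \<omega>) \<partial>M) =
      (\<integral>\<^sup>+x. \<integral>\<^sup>+y. h (rosenblatt_const g1 g2 * (\<kappa> * (x\<^sup>2 - 1) + \<mu> * x * y)) \<partial>std_gauss \<partial>std_gauss)) \<and>
    0 \<le> \<mu> \<and> \<bar>\<kappa> - 1 / (- g1 - g2 - 1)\<bar> \<le> - g1 - g2 - 1 \<and>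
    \<bar>\<kappa>\<^sup>2 + \<mu>\<^sup>2 - 1 / ((-2 * g1 - 1) * (-2 * g2 - 1))\<bar> \<le> - g1 - g2 - 1"

text \<open>Chaining is applied to \<open>Z t - t * V\<close>, where \<open>V\<close> is the double
  integral of the step function: its increments are double integrals again, so that linearity and
  the \<open>L^2\<close> bound apply. Replacing \<open>V\<close> by the product \<open>W\<close>
  adds one random error that does not involve the time.\<close>

lemma rosenblatt_line_approximation:
  obtains C where
    "\<And>g1 g2 Z. -8/15 \<le> g1 \<Longrightarrow> g1 < -1/2 \<Longrightarrow> -8/15 \<le> g2 \<Longrightarrow> g2 < -1/2 \<Longrightarrow>
      generalized_rosenblatt_process M B g1 g2 Z \<Longrightarrow> \<exists>S W \<kappa> \<mu>. line_approximation C g1 g2 Z S W \<kappa> \<mu>"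
proof -
  obtain C where C: "0 \<le> C"
    "\<And>g1 g2 s t. -8/15 \<le> g1 \<Longrightarrow> g1 < -1/2 \<Longrightarrow> -8/15 \<le> g2 \<Longrightarrow> g2 < -1/2 \<Longrightarrow>
      0 \<le> s \<Longrightarrow> s \<le> t \<Longrightarrow> t \<le> 1 \<Longrightarrow>
      (\<integral>\<^sup>+p. ennreal ((rosenblatt_kernel g1 g2 t p - rosenblatt_kernel g1 g2 s p -
          (t - s) * tail_kernel g1 g2 p)\<^sup>2) \<partial>(lborel \<Otimes>\<^sub>M lborel)) \<le>
      ennreal (C * (rosenblatt_const g1 g2)\<^sup>2 * (1 + 1 / (-2 * g1 - 1) + 1 / (-2 * g2 - 1)) *
        ((t - s) * sqrt (t - s)))"
    using rosenblatt_kernel_increment by blast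
  show ?thesis
  \<comment> \<open>The 3 comes from splitting into three squares, the 1000 from chaining and
    \<open>16 * (C + 1)\<close> from the increments; the last 1 accounts for the replacement of
    \<open>V\<close> by \<open>W\<close>.\<close>
  proof (rule that[of "3 * (1000 * (16 * (C + 1)) + 1)"])
    fix g1 g2 :: real and Z :: "real \<Rightarrow> 'a \<Rightarrow> real"
    assume g: "-8/15 \<le> g1" "g1 < -1/2" "-8/15 \<le> g2" "g2 < -1/2"
      and Z: "generalized_rosenblatt_process M B g1 g2 Z"
    define c where "c = rosenblatt_const g1 g2"
    define e where "e = - g1 - g2 - 1"
    define U where "U = 1 + 1 / (-2 * g1 - 1) + 1 / (-2 * g2 - 1)"
    have e: "0 < e" "e \<le> 1" using g by (simp_all add: e_def)
    have U: "1 \<le> U" using g by (simp add: U_def)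
    obtain f V W \<kappa> \<mu> where V: "is_double_wiener_ito_integral M B f V" and W[measurable]: "W \<in> borel_measurable M"
      and fe: "(\<integral>\<^sup>+p. ennreal ((tail_kernel g1 g2 p - f p)\<^sup>2) \<partial>(lborel \<Otimes>\<^sub>M lborel)) \<le> ennreal (c\<^sup>2 * e)"
      and VW: "(\<integral>\<^sup>+\<omega>. ennreal ((V \<omega> - W \<omega>)\<^sup>2) \<partial>M) \<le> ennreal (c\<^sup>2 * e)"
      and law: "\<And>h. h \<in> borel_measurable borel \<Longrightarrow> (\<integral>\<^sup>+\<omega>. h (W \<omega>) \<partial>M) =
        (\<integral>\<^sup>+x. \<integral>\<^sup>+y. h (c * (\<kappa> * (x\<^sup>2 - 1) + \<mu> * x * y)) \<partial>std_gauss \<partial>std_gauss)"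
      and km: "\<bar>\<kappa> - 1 / (- g1 - g2 - 1)\<bar> \<le> e" "0 \<le> \<mu>"
        "\<bar>\<kappa>\<^sup>2 + \<mu>\<^sup>2 - 1 / ((-2 * g1 - 1) * (-2 * g2 - 1))\<bar> \<le> e"
      by (rule tail_kernel_approximation[OF g(2,4) e(1), folded c_def]) (rule that; assumption)
    have ZI: "is_double_wiener_ito_integral M B (rosenblatt_kernel g1 g2 t) (Z t)" if "0 \<le> t" for t
      using Z that by (simp add: generalized_rosenblatt_process_def)
    have Zm[measurable]: "Z t \<in> borel_measurable M" if "0 \<le> t" for t
      using ZI[OF that] by (simp add: is_double_wiener_ito_integral_def)
    have Km: "rosenblatt_kernel g1 g2 t \<in> borel_measurable (lborel \<Otimes>\<^sub>M lborel)" if "0 \<le> t" for t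
      using ZI[OF that] by (simp add: is_double_wiener_ito_integral_def)
    have [measurable]: "V \<in> borel_measurable M" "f \<in> borel_measurable (lborel \<Otimes>\<^sub>M lborel)"
      using V by (simp_all add: is_double_wiener_ito_integral_def)
    have [measurable]: "tail_kernel g1 g2 \<in> borel_measurable (lborel \<Otimes>\<^sub>M lborel)"
      unfolding tail_kernel_def by measurable
    define D where "D t \<omega> = Z t \<omega> - t * V \<omega>" for t \<omega>
    \<comment> \<open>The kernel at time 0 is an integral over a single point. \<open>Z 0\<close>
      vanishes almost surely but perhaps not everywhere, so it is carried along in the dominating
      function.\<close>
    have Z0: "(\<integral>\<^sup>+\<omega>. ennreal ((Z 0 \<omega>)\<^sup>2) \<partial>M) = 0"
    proof -
      have "(LINT s:{0..0}|lborel. H s) = 0" for H :: "real \<Rightarrow> real"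
        unfolding set_lebesgue_integral_def
        by (rule integral_eq_zero_AE) (use AE_lborel_singleton[of "0 :: real"] in \<open>eventually_elim; simp\<close>)
      then have "rosenblatt_kernel g1 g2 0 p = 0" for p
        by (cases p) (simp only: rosenblatt_kernel_def prod.case mult_zero_right)
      then show ?thesis
        using double_integral_bound[OF ZI[of 0]] by simp
    qed
    \<comment> \<open>16 is the 8 of the integral bound times the 2 of the squared triangle
      inequality; \<open>C\<close> belongs to the kernel increment and 1 to the
      discretization.\<close>
    define \<eta> where "\<eta> = 16 * (C + 1) * (c\<^sup>2 * U)"
    have inc: "(\<integral>\<^sup>+\<omega>. ennreal ((D t \<omega> - D s \<omega>)\<^sup>2) \<partial>M) \<le> ennreal (\<eta> * ((t - s) * sqrt (t - s)))"
      if st: "0 \<le> s" "s \<le> t" "t \<le> 1" for s t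
    proof -
      define \<tau> where "\<tau> = (t - s) * sqrt (t - s)"
      \<comment> \<open>The discretization error is linear in time, hence quadratic in mean square,
        which on intervals of length at most 1 is within the order of the kernel increment.\<close>
      have t2: "(t - s)\<^sup>2 \<le> \<tau>"
      proof -
        have "t - s \<le> sqrt (t - s)"
          using st by (intro real_le_rsqrt) (simp add: power2_eq_square mult_left_le)
        then show ?thesis using st by (simp add: \<tau>_def power2_eq_square mult_left_mono)
      qed
      have \<tau>: "0 \<le> \<tau>" using st by (simp add: \<tau>_def)
      let ?K = "\<lambda>p. rosenblatt_kernel g1 g2 t p + (-1) * rosenblatt_kernel g1 g2 s p + (- (t - s)) * f p"
      let ?K1 = "\<lambda>p. rosenblatt_kernel g1 g2 t p - rosenblatt_kernel g1 g2 s p - (t - s) * tail_kernel g1 g2 p"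
      have [measurable]: "rosenblatt_kernel g1 g2 t \<in> borel_measurable (lborel \<Otimes>\<^sub>M lborel)"
        "rosenblatt_kernel g1 g2 s \<in> borel_measurable (lborel \<Otimes>\<^sub>M lborel)"
        using Km st by auto
      have "is_double_wiener_ito_integral M B ?K (\<lambda>\<omega>. Z t \<omega> + (-1) * Z s \<omega> + (- (t - s)) * V \<omega>)"
        using st by (intro double_integral_combine ZI V) auto
      then have "(\<integral>\<^sup>+\<omega>. ennreal ((Z t \<omega> + (-1) * Z s \<omega> + (- (t - s)) * V \<omega>)\<^sup>2) \<partial>M) \<le>
          8 * (\<integral>\<^sup>+p. ennreal ((?K p)\<^sup>2) \<partial>(lborel \<Otimes>\<^sub>M lborel))"
        by (rule double_integral_bound)
      also have "(\<integral>\<^sup>+p. ennreal ((?K p)\<^sup>2) \<partial>(lborel \<Otimes>\<^sub>M lborel)) =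
          (\<integral>\<^sup>+p. ennreal ((?K1 p + (t - s) * (tail_kernel g1 g2 p - f p))\<^sup>2) \<partial>(lborel \<Otimes>\<^sub>M lborel))"
        by (simp add: algebra_simps)
      also have "\<dots> \<le> 2 * (\<integral>\<^sup>+p. ennreal ((?K1 p)\<^sup>2) \<partial>(lborel \<Otimes>\<^sub>M lborel)) +
          2 * (\<integral>\<^sup>+p. ennreal (((t - s) * (tail_kernel g1 g2 p - f p))\<^sup>2) \<partial>(lborel \<Otimes>\<^sub>M lborel))"
        by (rule nn_integral_square_add_le) measurable
      also have "(\<integral>\<^sup>+p. ennreal (((t - s) * (tail_kernel g1 g2 p - f p))\<^sup>2) \<partial>(lborel \<Otimes>\<^sub>M lborel)) =
          ennreal ((t - s)\<^sup>2) * (\<integral>\<^sup>+p. ennreal ((tail_kernel g1 g2 p - f p)\<^sup>2) \<partial>(lborel \<Otimes>\<^sub>M lborel))"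
        by (simp add: power_mult_distrib ennreal_mult' nn_integral_cmult)
      also have "8 * (2 * (\<integral>\<^sup>+p. ennreal ((?K1 p)\<^sup>2) \<partial>(lborel \<Otimes>\<^sub>M lborel)) + 2 * (ennreal ((t - s)\<^sup>2) *
          (\<integral>\<^sup>+p. ennreal ((tail_kernel g1 g2 p - f p)\<^sup>2) \<partial>(lborel \<Otimes>\<^sub>M lborel)))) \<le>
        8 * (2 * ennreal (C * c\<^sup>2 * U * \<tau>) + 2 * (ennreal \<tau> * ennreal (c\<^sup>2 * U)))"
      proof (intro mult_left_mono add_mono mult_mono)
        show "(\<integral>\<^sup>+p. ennreal ((?K1 p)\<^sup>2) \<partial>(lborel \<Otimes>\<^sub>M lborel)) \<le> ennreal (C * c\<^sup>2 * U * \<tau>)"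
          unfolding c_def U_def \<tau>_def by (rule C(2)[OF g st])
        show "ennreal ((t - s)\<^sup>2) \<le> ennreal \<tau>" by (rule ennreal_leI[OF t2])
        have "c\<^sup>2 * e \<le> c\<^sup>2 * U" using e U by (intro mult_left_mono) auto
        then show "(\<integral>\<^sup>+p. ennreal ((tail_kernel g1 g2 p - f p)\<^sup>2) \<partial>(lborel \<Otimes>\<^sub>M lborel)) \<le> ennreal (c\<^sup>2 * U)"
          using fe by (meson ennreal_leI order_trans)
      qed auto
      also have "\<dots> = ennreal (8 * (2 * (C * c\<^sup>2 * U * \<tau>) + 2 * (\<tau> * (c\<^sup>2 * U))))"
      proof -
        have "8 * (2 * ennreal x + 2 * (ennreal y * ennreal z)) = ennreal (8 * (2 * x + 2 * (y * z)))"
          if "0 \<le> x" "0 \<le> y" "0 \<le> z" for x y z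
          using that by (simp add: ennreal_mult')
        then show ?thesis using C(1) U \<tau> by simp
      qed
      also have "8 * (2 * (C * c\<^sup>2 * U * \<tau>) + 2 * (\<tau> * (c\<^sup>2 * U))) = \<eta> * \<tau>"
        by (simp add: \<eta>_def algebra_simps)
      finally have "(\<integral>\<^sup>+\<omega>. ennreal ((Z t \<omega> + (-1) * Z s \<omega> + (- (t - s)) * V \<omega>)\<^sup>2) \<partial>M) \<le> ennreal (\<eta> * \<tau>)"
        by (simp add: mult_left_mono)
      then show ?thesis
        by (simp add: D_def \<tau>_def algebra_simps)
    qed
    have \<eta>: "0 \<le> \<eta>" using C(1) U by (simp add: \<eta>_def)
    have Dm: "D t \<in> borel_measurable M" if "t \<in> {0..1}" for t
      unfolding D_def using Zm[of t] that by simp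
    have Dc: "continuous_on {0..1} (\<lambda>t. D t \<omega>)" if "\<omega> \<in> space M" for \<omega>
    proof -
      have "continuous_on {0..} (\<lambda>t. Z t \<omega>)"
        using Z that by (simp add: generalized_rosenblatt_process_def)
      then have "continuous_on {0..1} (\<lambda>t. Z t \<omega>)" by (rule continuous_on_subset) auto
      then show ?thesis unfolding D_def by (intro continuous_intros)
    qed
    obtain S where S[measurable]: "S \<in> borel_measurable M" and Si: "(\<integral>\<^sup>+\<omega>. S \<omega> \<partial>M) \<le> ennreal (1000 * \<eta>)"
      and SD: "\<And>\<omega> t. \<omega> \<in> space M \<Longrightarrow> t \<in> {0..1} \<Longrightarrow> ennreal ((D t \<omega> - D 0 \<omega>)\<^sup>2) \<le> S \<omega>"
    proof (rule continuous_process_sup_bound[of D M \<eta>])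
      fix S assume "S \<in> borel_measurable M" "(\<integral>\<^sup>+\<omega>. S \<omega> \<partial>M) \<le> ennreal (1000 * \<eta>)"
        "\<And>\<omega> t. \<omega> \<in> space M \<Longrightarrow> t \<in> {0..1} \<Longrightarrow> ennreal ((D t \<omega> - D 0 \<omega>)\<^sup>2) \<le> S \<omega>"
      then show thesis by (rule that)
    qed (rule Dm Dc \<eta> inc; assumption)+
    define S' where "S' \<omega> = 3 * (S \<omega> + ennreal ((Z 0 \<omega>)\<^sup>2) + ennreal ((V \<omega> - W \<omega>)\<^sup>2))" for \<omega>
    have S'm: "S' \<in> borel_measurable M" unfolding S'_def by measurable
    have "(\<integral>\<^sup>+\<omega>. S' \<omega> \<partial>M) = 3 * ((\<integral>\<^sup>+\<omega>. S \<omega> \<partial>M) + (\<integral>\<^sup>+\<omega>. ennreal ((Z 0 \<omega>)\<^sup>2) \<partial>M) + (\<integral>\<^sup>+\<omega>. ennreal ((V \<omega> - W \<omega>)\<^sup>2) \<partial>M))"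
      unfolding S'_def by (simp add: nn_integral_cmult nn_integral_add)
    also have "\<dots> \<le> 3 * (ennreal (1000 * \<eta>) + 0 + ennreal (c\<^sup>2 * e))"
      unfolding Z0 by (intro mult_left_mono add_mono Si VW) auto
    also have "\<dots> = ennreal (3 * (1000 * \<eta> + c\<^sup>2 * e))"
    proof -
      have "3 * (ennreal x + 0 + ennreal y) = ennreal (3 * (x + y))" if "0 \<le> x" "0 \<le> y" for x y
        using that by (simp add: ennreal_mult')
      then show ?thesis using \<eta> e by simp
    qed
    also have "\<dots> \<le> ennreal (3 * (1000 * (16 * (C + 1)) + 1) * (c\<^sup>2 * U))"
    proof (rule ennreal_leI)
      have "c\<^sup>2 * e \<le> c\<^sup>2 * U" using e U by (intro mult_left_mono) auto
      then show "3 * (1000 * \<eta> + c\<^sup>2 * e) \<le> 3 * (1000 * (16 * (C + 1)) + 1) * (c\<^sup>2 * U)"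
        unfolding \<eta>_def by (simp add: algebra_simps)
    qed
    finally have S'i: "(\<integral>\<^sup>+\<omega>. S' \<omega> \<partial>M) \<le> ennreal (3 * (1000 * (16 * (C + 1)) + 1) * (c\<^sup>2 * U))" .
    have S'Z: "ennreal ((Z t \<omega> - t * W \<omega>)\<^sup>2) \<le> S' \<omega>" if \<omega>: "\<omega> \<in> space M" and t: "t \<in> {0..1}" for \<omega> t
    proof -
      let ?a = "ennreal \<bar>D t \<omega> - D 0 \<omega>\<bar>" and ?b = "ennreal \<bar>Z 0 \<omega>\<bar>" and ?c = "ennreal \<bar>V \<omega> - W \<omega>\<bar>"
      have tV: "\<bar>t * (V \<omega> - W \<omega>)\<bar> \<le> \<bar>V \<omega> - W \<omega>\<bar>"
        using t by (simp add: abs_mult mult_left_le_one_le)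
      have "Z t \<omega> - t * W \<omega> = (D t \<omega> - D 0 \<omega>) + Z 0 \<omega> + t * (V \<omega> - W \<omega>)"
        by (simp add: D_def algebra_simps)
      then have "\<bar>Z t \<omega> - t * W \<omega>\<bar> \<le> \<bar>D t \<omega> - D 0 \<omega>\<bar> + \<bar>Z 0 \<omega>\<bar> + \<bar>V \<omega> - W \<omega>\<bar>"
        using tV by linarith
      then have "ennreal \<bar>Z t \<omega> - t * W \<omega>\<bar> \<le> ?a + ?b + ?c"
        by (simp add: ennreal_plus[symmetric] ennreal_leI del: ennreal_plus)
      then have "(ennreal \<bar>Z t \<omega> - t * W \<omega>\<bar>)\<^sup>2 \<le> (?a + ?b + ?c)\<^sup>2"
        by (intro power_mono) auto
      also have "\<dots> \<le> 3 * (?a\<^sup>2 + ?b\<^sup>2 + ?c\<^sup>2)" by (rule ennreal_square_sum3_le)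
      also have "\<dots> \<le> S' \<omega>"
        unfolding S'_def using SD[OF \<omega> t]
        by (intro mult_left_mono add_mono) (simp_all add: ennreal_power)
      finally show ?thesis by (simp add: ennreal_power)
    qed
    show "\<exists>S W \<kappa> \<mu>. line_approximation (3 * (1000 * (16 * (C + 1)) + 1)) g1 g2 Z S W \<kappa> \<mu>"
      unfolding line_approximation_def c_def[symmetric] U_def[symmetric] e_def[symmetric]
      by (intro exI[of _ S'] exI[of _ W] exI[of _ \<kappa>] exI[of _ \<mu>] conjI ballI S'm W S'i S'Z law km[unfolded e_def[symmetric]])
  qed
qed

end

section \<open>Identification of the weak limit\<close>

context white_noise
begin

text \<open>Two limits determine the coefficients of the Gaussian form: \<open>k\<close> follows the
  normalized covariance, and \<open>k^2 + l^2\<close> the normalized product of the variances. Their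
  combination gives \<open>l^2\<close>, and \<open>0 \<le> l\<close> fixes the sign. Uniform
  closeness to lines then lifts the convergence of slopes to paths.\<close>

lemma rosenblatt_weak_limit:
  fixes g1 g2 :: "'i \<Rightarrow> real" and Z :: "'i \<Rightarrow> real \<Rightarrow> 'a \<Rightarrow> real"
  assumes domain: "\<And>i. (g1 i, g2 i) \<in> rosenblatt_domain"
    and Z: "\<And>i. generalized_rosenblatt_process M B (g1 i) (g2 i) (Z i)"
    and meas: "\<And>i. path01 (Z i) \<in> measurable M borel_C01"
    and g1: "(g1 \<longlongrightarrow> -1/2) F" and g2: "(g2 \<longlongrightarrow> -1/2) F"
    and \<rho>: "0 \<le> \<rho>" and ratio: "((\<lambda>i. (g1 i + 1/2) / (g2 i + 1/2)) \<longlongrightarrow> \<rho>) F"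
    and \<phi>: "continuous_map (mtopology_of C01) euclideanreal \<phi>" and bdd: "bounded (\<phi> ` mspace C01)"
  defines "r2 \<equiv> 4 * \<rho> / (1 + \<rho>)\<^sup>2"
  shows "((\<lambda>i. expectation (\<lambda>\<omega>. \<phi> (path01 (Z i) \<omega>))) \<longlongrightarrow>
    (LINT p|(std_gauss \<Otimes>\<^sub>M std_gauss). \<phi> (line01
      (sqrt (r2 / (1 + r2)) * ((fst p)\<^sup>2 - 1) + sqrt ((1 - r2) / (1 + r2)) * fst p * snd p)))) F"
proof -
  define c where "c i = rosenblatt_const (g1 i) (g2 i)" for i
  define e where "e i = - g1 i - g2 i - 1" for i
  define U where "U i = 1 + 1 / (-2 * g1 i - 1) + 1 / (-2 * g2 i - 1)" for i
  define v where "v i = (-2 * g1 i - 1) * (-2 * g2 i - 1)" for i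
  note asymp = rosenblatt_const_asymptotics[OF domain g1 g2 \<rho> ratio, folded c_def r2_def]
  have r2: "0 \<le> r2" using \<rho> by (simp add: r2_def)
  have e0: "(e \<longlongrightarrow> 0) F" unfolding e_def by (rule tendsto_eq_intros g1 g2 refl | simp)+
  have dom: "g1 i < -1/2" "g2 i < -1/2" for i
    using domain[of i] by (auto simp: rosenblatt_domain_def)
  have good: "\<forall>\<^sub>F i in F. -8/15 \<le> g1 i \<and> -8/15 \<le> g2 i"
    using order_tendstoD(1)[OF g1, of "-8/15"] order_tendstoD(1)[OF g2, of "-8/15"]
    by (auto elim: eventually_elim2)
  obtain C where C: "\<And>g1 g2 Z. -8/15 \<le> g1 \<Longrightarrow> g1 < -1/2 \<Longrightarrow> -8/15 \<le> g2 \<Longrightarrow> g2 < -1/2 \<Longrightarrow>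
      generalized_rosenblatt_process M B g1 g2 Z \<Longrightarrow> \<exists>S W \<kappa> \<mu>. line_approximation C g1 g2 Z S W \<kappa> \<mu>"
    using rosenblatt_line_approximation by blast
  \<comment> \<open>The estimates are available for exponents of at least -8/15, that is,
    eventually. Zero functions at the other indices make measurability hold for every index, as
    \<open>weak_conv_line01\<close> asks.\<close>
  have "\<exists>S W \<kappa> \<mu>. S \<in> borel_measurable M \<and> W \<in> borel_measurable M \<and>
      (-8/15 \<le> g1 i \<and> -8/15 \<le> g2 i \<longrightarrow> line_approximation C (g1 i) (g2 i) (Z i) S W \<kappa> \<mu>)" for i
  proof (cases "-8/15 \<le> g1 i \<and> -8/15 \<le> g2 i")
    case True
    then obtain S W \<kappa> \<mu> where "line_approximation C (g1 i) (g2 i) (Z i) S W \<kappa> \<mu>"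
      using C dom Z by blast
    moreover from this have "S \<in> borel_measurable M" "W \<in> borel_measurable M"
      by (simp_all add: line_approximation_def)
    ultimately show ?thesis by blast
  next
    case False
    then show ?thesis by (intro exI[of _ "\<lambda>_. 0"]) auto
  qed
  then obtain S W \<kappa> \<mu> where S[measurable]: "\<And>i. S i \<in> borel_measurable M"
    and W[measurable]: "\<And>i. W i \<in> borel_measurable M"
    and la: "\<And>i. -8/15 \<le> g1 i \<and> -8/15 \<le> g2 i \<Longrightarrow>
      line_approximation C (g1 i) (g2 i) (Z i) (S i) (W i) (\<kappa> i) (\<mu> i)"
    by metis
  have ap: "\<forall>\<^sub>F i in F. (\<integral>\<^sup>+\<omega>. S i \<omega> \<partial>M) \<le> ennreal (C * ((c i)\<^sup>2 * U i)) \<and>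
      (\<forall>\<omega>\<in>space M. \<forall>t\<in>{0..1}. ennreal ((Z i t \<omega> - t * W i \<omega>)\<^sup>2) \<le> S i \<omega>) \<and>
      (\<forall>h\<in>borel_measurable borel. (\<integral>\<^sup>+\<omega>. h (W i \<omega>) \<partial>M) =
        (\<integral>\<^sup>+x. \<integral>\<^sup>+y. h (c i * (\<kappa> i * (x\<^sup>2 - 1) + \<mu> i * x * y)) \<partial>std_gauss \<partial>std_gauss)) \<and>
      0 \<le> \<mu> i \<and> \<bar>\<kappa> i - 1 / e i\<bar> \<le> e i \<and> \<bar>(\<kappa> i)\<^sup>2 + (\<mu> i)\<^sup>2 - 1 / v i\<bar> \<le> e i"
    using good
    by eventually_elim (use la in \<open>unfold line_approximation_def c_def e_def U_def v_def, blast\<close>)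
  define k where "k i = c i * \<kappa> i" for i
  define l where "l i = c i * \<mu> i" for i
  let ?k0 = "sqrt (r2 / (1 + r2))" and ?l0 = "sqrt ((1 - r2) / (1 + r2))"
  have ce: "((\<lambda>i. (c i)\<^sup>2 * e i) \<longlongrightarrow> 0) F"
    using tendsto_mult[OF asymp(1) e0] by simp
  have c0: "((\<lambda>i. \<bar>c i\<bar> * e i) \<longlongrightarrow> 0) F"
    using tendsto_mult[OF tendsto_real_sqrt[OF asymp(1)] e0] by simp
  have kl: "(k \<longlongrightarrow> ?k0) F"
  proof (rule Lim_transform2[OF asymp(4)])
    show "((\<lambda>i. c i / (- g1 i - g2 i - 1) - k i) \<longlongrightarrow> 0) F"
    proof (rule Lim_null_comparison[OF _ c0])
      show "\<forall>\<^sub>F i in F. norm (c i / (- g1 i - g2 i - 1) - k i) \<le> \<bar>c i\<bar> * e i"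
        using ap
      proof eventually_elim
        case (elim i)
        have "c i / (- g1 i - g2 i - 1) - k i = - (c i * (\<kappa> i - 1 / e i))"
          by (simp add: k_def e_def right_diff_distrib)
        then have "norm (c i / (- g1 i - g2 i - 1) - k i) = \<bar>c i\<bar> * \<bar>\<kappa> i - 1 / e i\<bar>"
          by (simp only: real_norm_def abs_minus_cancel abs_mult)
        then show ?case
          using elim by (simp add: mult_left_mono)
      qed
    qed
  qed
  have kl2: "((\<lambda>i. (c i)\<^sup>2 * ((\<kappa> i)\<^sup>2 + (\<mu> i)\<^sup>2)) \<longlongrightarrow> 1 / (1 + r2)) F"
  proof (rule Lim_transform2[OF asymp(3)])
    show "((\<lambda>i. (c i)\<^sup>2 / ((-2 * g1 i - 1) * (-2 * g2 i - 1)) - (c i)\<^sup>2 * ((\<kappa> i)\<^sup>2 + (\<mu> i)\<^sup>2)) \<longlongrightarrow> 0) F"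
    proof (rule Lim_null_comparison[OF _ ce])
      show "\<forall>\<^sub>F i in F. norm ((c i)\<^sup>2 / ((-2 * g1 i - 1) * (-2 * g2 i - 1)) - (c i)\<^sup>2 * ((\<kappa> i)\<^sup>2 + (\<mu> i)\<^sup>2)) \<le> (c i)\<^sup>2 * e i"
        using ap
      proof eventually_elim
        case (elim i)
        have "(c i)\<^sup>2 / ((-2 * g1 i - 1) * (-2 * g2 i - 1)) - (c i)\<^sup>2 * ((\<kappa> i)\<^sup>2 + (\<mu> i)\<^sup>2) =
            - ((c i)\<^sup>2 * ((\<kappa> i)\<^sup>2 + (\<mu> i)\<^sup>2 - 1 / v i))"
          unfolding v_def[symmetric] by (simp add: algebra_simps)
        then have "norm ((c i)\<^sup>2 / ((-2 * g1 i - 1) * (-2 * g2 i - 1)) - (c i)\<^sup>2 * ((\<kappa> i)\<^sup>2 + (\<mu> i)\<^sup>2)) =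
            (c i)\<^sup>2 * \<bar>(\<kappa> i)\<^sup>2 + (\<mu> i)\<^sup>2 - 1 / v i\<bar>"
          by (simp only: real_norm_def abs_minus_cancel abs_mult abs_power2)
        then show ?case
          using elim by (simp add: mult_left_mono)
      qed
    qed
  qed
  have "((\<lambda>i. sqrt ((c i)\<^sup>2 * ((\<kappa> i)\<^sup>2 + (\<mu> i)\<^sup>2) - (k i)\<^sup>2)) \<longlongrightarrow> sqrt (1 / (1 + r2) - ?k0\<^sup>2)) F"
    by (intro tendsto_real_sqrt tendsto_diff tendsto_power kl2 kl)
  moreover have "1 / (1 + r2) - ?k0\<^sup>2 = (1 - r2) / (1 + r2)"
    using r2 by (simp add: diff_divide_distrib)
  ultimately have "((\<lambda>i. sqrt ((c i)\<^sup>2 * ((\<kappa> i)\<^sup>2 + (\<mu> i)\<^sup>2) - (k i)\<^sup>2)) \<longlongrightarrow> ?l0) F"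
    by simp
  then have ll: "(l \<longlongrightarrow> ?l0) F"
  proof (rule Lim_transform_eventually)
    show "\<forall>\<^sub>F i in F. sqrt ((c i)\<^sup>2 * ((\<kappa> i)\<^sup>2 + (\<mu> i)\<^sup>2) - (k i)\<^sup>2) = l i"
      using ap asymp(5)
    proof eventually_elim
      case (elim i)
      have "(c i)\<^sup>2 * ((\<kappa> i)\<^sup>2 + (\<mu> i)\<^sup>2) - (k i)\<^sup>2 = (l i)\<^sup>2"
        by (simp add: k_def l_def power_mult_distrib distrib_left)
      moreover have "0 \<le> l i"
        using elim by (simp add: l_def)
      ultimately show ?case by simp
    qed
  qed
  have law: "\<forall>\<^sub>F i in F. \<forall>h\<in>borel_measurable borel. (\<integral>\<^sup>+\<omega>. h (W i \<omega>) \<partial>M) =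
      (\<integral>\<^sup>+x. \<integral>\<^sup>+y. h (k i * (x\<^sup>2 - 1) + l i * x * y) \<partial>std_gauss \<partial>std_gauss)"
    using ap
  proof eventually_elim
    case (elim i)
    have eq: "c i * (\<kappa> i * (x\<^sup>2 - 1) + \<mu> i * x * y) = k i * (x\<^sup>2 - 1) + l i * x * y" for x y
      by (simp add: k_def l_def algebra_simps)
    have "\<forall>h\<in>borel_measurable borel. (\<integral>\<^sup>+\<omega>. h (W i \<omega>) \<partial>M) =
        (\<integral>\<^sup>+x. \<integral>\<^sup>+y. h (c i * (\<kappa> i * (x\<^sup>2 - 1) + \<mu> i * x * y)) \<partial>std_gauss \<partial>std_gauss)"
      using elim by blast
    then show ?case unfolding eq .
  qed
  have [measurable]: "(\<lambda>y. \<phi> (line01 y)) \<in> borel_measurable borel"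
    by (intro borel_measurable_continuous_onI continuous_on_line01 \<phi>)
  \<comment> \<open>Only the law of \<open>W i\<close> is under control, so its expectation is moved
    to the Gaussian plane, where the index occurs in the two coefficients alone.\<close>
  have Elaw: "\<forall>\<^sub>F i in F. (LINT p|(std_gauss \<Otimes>\<^sub>M std_gauss). \<phi> (line01 (k i * ((fst p)\<^sup>2 - 1) + l i * fst p * snd p))) =
      expectation (\<lambda>\<omega>. \<phi> (line01 (W i \<omega>)))"
    using law
  proof eventually_elim
    case (elim i)
    let ?g = "\<lambda>p. k i * ((fst p)\<^sup>2 - 1) + l i * fst p * snd p"
    have "distr M borel (W i) = distr (std_gauss \<Otimes>\<^sub>M std_gauss) borel ?g"
      by (rule distr_std_gauss_pair_eqI) (use elim in auto)
    then have "(LINT y|distr M borel (W i). \<phi> (line01 y)) =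
        (LINT y|distr (std_gauss \<Otimes>\<^sub>M std_gauss) borel ?g. \<phi> (line01 y))"
      by simp
    then show ?case
      by (simp add: integral_distr)
  qed
  have tight: "\<forall>\<^sub>F i in F. (\<integral>\<^sup>+\<omega>. ennreal \<bar>W i \<omega>\<bar> \<partial>M) \<le> ennreal (2 * \<bar>?k0\<bar> + \<bar>?l0\<bar> + 1)"
  proof -
    have "((\<lambda>i. 2 * \<bar>k i\<bar> + \<bar>l i\<bar>) \<longlongrightarrow> 2 * \<bar>?k0\<bar> + \<bar>?l0\<bar>) F"
      by (intro tendsto_intros kl ll)
    then have "\<forall>\<^sub>F i in F. 2 * \<bar>k i\<bar> + \<bar>l i\<bar> < 2 * \<bar>?k0\<bar> + \<bar>?l0\<bar> + 1"
      by (rule order_tendstoD) simp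
    then show ?thesis
      using law
    proof eventually_elim
      case (elim i)
      have "(\<integral>\<^sup>+\<omega>. ennreal \<bar>W i \<omega>\<bar> \<partial>M) = (\<integral>\<^sup>+x. \<integral>\<^sup>+y. ennreal \<bar>k i * (x\<^sup>2 - 1) + l i * x * y\<bar> \<partial>std_gauss \<partial>std_gauss)"
        using elim(2)[THEN bspec, of "\<lambda>z. ennreal \<bar>z\<bar>"] by simp
      also have "\<dots> \<le> ennreal (2 * \<bar>k i\<bar> + \<bar>l i\<bar>)"
        by (rule gauss_quadratic_form_abs)
      also have "\<dots> \<le> ennreal (2 * \<bar>?k0\<bar> + \<bar>?l0\<bar> + 1)"
        using elim(1) by (intro ennreal_leI) simp
      finally show ?case .
    qed
  qed
  have Slim: "((\<lambda>i. \<integral>\<^sup>+\<omega>. S i \<omega> \<partial>M) \<longlongrightarrow> 0) F"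
  proof (rule tendsto_sandwich[OF _ _ tendsto_const])
    show "\<forall>\<^sub>F i in F. (\<integral>\<^sup>+\<omega>. S i \<omega> \<partial>M) \<le> ennreal (C * ((c i)\<^sup>2 * U i))"
      using ap by eventually_elim simp
    have "((\<lambda>i. C * ((c i)\<^sup>2 * U i)) \<longlongrightarrow> C * 0) F"
      using asymp(2) unfolding U_def by (intro tendsto_mult tendsto_const)
    then have "((\<lambda>i. ennreal (C * ((c i)\<^sup>2 * U i))) \<longlongrightarrow> ennreal (C * 0)) F"
      by (rule tendsto_ennrealI)
    then show "((\<lambda>i. ennreal (C * ((c i)\<^sup>2 * U i))) \<longlongrightarrow> 0) F" by simp
  qed simp
  have dev: "\<forall>\<^sub>F i in F. \<forall>\<omega>\<in>space M. \<forall>t\<in>{0..1}. ennreal ((Z i t \<omega> - t * W i \<omega>)\<^sup>2) \<le> S i \<omega>"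
    using ap by eventually_elim simp
  have "((\<lambda>i. expectation (\<lambda>\<omega>. \<phi> (path01 (Z i) \<omega>)) - expectation (\<lambda>\<omega>. \<phi> (line01 (W i \<omega>)))) \<longlongrightarrow> 0) F"
    by (rule weak_conv_line01[OF \<phi> bdd meas W S dev Slim tight])
  moreover have "((\<lambda>i. expectation (\<lambda>\<omega>. \<phi> (line01 (W i \<omega>)))) \<longlongrightarrow>
      (LINT p|(std_gauss \<Otimes>\<^sub>M std_gauss). \<phi> (line01 (?k0 * ((fst p)\<^sup>2 - 1) + ?l0 * fst p * snd p)))) F"
  proof -
    obtain b where b: "\<And>f. f \<in> mspace C01 \<Longrightarrow> \<bar>\<phi> f\<bar> \<le> b"
      using bdd unfolding bounded_iff by auto
    show ?thesis
      by (rule Lim_transform_eventually[OF gauss_expectation_tendsto[OF continuous_on_line01[OF \<phi>] _ kl ll] Elaw])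
        (rule b[OF line01_in_C01])
  qed
  ultimately show ?thesis
    using tendsto_add by fastforce
qed

end

theorem theorem2p4:
  fixes M :: "'a measure" and B :: "real set \<Rightarrow> 'a \<Rightarrow> real"
    and F :: "'i filter" and g1 g2 :: "'i \<Rightarrow> real"
    and Z :: "'i \<Rightarrow> real \<Rightarrow> 'a \<Rightarrow> real"
    and \<rho> :: real
    and N :: "'b measure" and X1 X2 :: "'b \<Rightarrow> real"
  assumes B: "brownian_random_measure M B"
    and domain: "\<And>i. (g1 i, g2 i) \<in> rosenblatt_domain"
    and order: "\<And>i. g1 i \<ge> g2 i"
    and Z: "\<And>i. generalized_rosenblatt_process M B (g1 i) (g2 i) (Z i)"
    and lim: "((\<lambda>i. (g1 i, g2 i)) \<longlongrightarrow> (-1/2, -1/2)) F"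
    and \<rho>: "\<rho> \<in> {0..1}"
    and ratio: "((\<lambda>i. (g1 i + 1/2) / (g2 i + 1/2)) \<longlongrightarrow> \<rho>) F"
    and N: "prob_space N"
    and X1: "std_chi_squared_1 N X1"
    and X2: "std_chi_squared_1 N X2"
    and indep: "prob_space.indep_var N borel X1 borel X2"
  shows "conv_in_distribution_C01 M Z N (limit_process \<rho> X1 X2) F"
proof -
  interpret white_noise M B by (rule white_noise.intro[OF B])
  have Zm: "path01 (Z i) \<in> measurable M borel_C01" for i
  proof (rule path01_measurable)
    show "Z i t \<in> borel_measurable M" if "t \<in> {0..1}" for t
      using Z[of i] that by (simp add: generalized_rosenblatt_process_def is_double_wiener_ito_integral_def)
    show "continuous_on {0..1} (\<lambda>t. Z i t \<omega>)" if "\<omega> \<in> space M" for \<omega>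
    proof (rule continuous_on_subset)
      show "continuous_on {0..} (\<lambda>t. Z i t \<omega>)"
        using Z[of i] that by (simp add: generalized_rosenblatt_process_def)
    qed auto
  qed
  have [measurable]: "X1 \<in> borel_measurable N" "X2 \<in> borel_measurable N"
    using X1 X2 by (simp_all add: std_chi_squared_1_def)
  let ?Y = "\<lambda>\<omega>. coeff1 \<rho> * X1 \<omega> + coeff2 \<rho> * X2 \<omega>"
  have Ym: "path01 (limit_process \<rho> X1 X2) \<in> measurable N borel_C01"
    unfolding limit_process_def by (rule path01_measurable) (measurable, intro continuous_intros)
  \<comment> \<open>Each limit path is exactly a line, so its law on the path space is determined by
    the law of the slope.\<close>
  have Y: "path01 (limit_process \<rho> X1 X2) \<omega> = line01 (?Y \<omega>)" for \<omega>
    by (simp add: path01_def limit_process_def line01_def)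
  have g1: "(g1 \<longlongrightarrow> -1/2) F" and g2: "(g2 \<longlongrightarrow> -1/2) F"
    using tendsto_fst[OF lim] tendsto_snd[OF lim] by simp_all
  have "((\<lambda>i. \<integral>x. \<phi> x \<partial>distr M borel_C01 (path01 (Z i))) \<longlongrightarrow>
      (\<integral>x. \<phi> x \<partial>distr N borel_C01 (path01 (limit_process \<rho> X1 X2)))) F"
    if \<phi>: "continuous_map (mtopology_of C01) euclideanreal \<phi>" and bdd: "bounded (\<phi> ` mspace C01)" for \<phi>
  proof -
    have [measurable]: "\<phi> \<in> borel_measurable borel_C01"
      by (rule borel_measurable_C01[OF \<phi>])
    have [measurable]: "(\<lambda>y. \<phi> (line01 y)) \<in> borel_measurable borel"
      by (intro borel_measurable_continuous_onI continuous_on_line01 \<phi>)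
    define r2 where "r2 = 4 * \<rho> / (1 + \<rho>)\<^sup>2"
    let ?g = "\<lambda>(x, y). sqrt (r2 / (1 + r2)) * (x\<^sup>2 - 1) + sqrt ((1 - r2) / (1 + r2)) * x * y"
    have "(\<integral>x. \<phi> x \<partial>distr N borel_C01 (path01 (limit_process \<rho> X1 X2))) = (\<integral>\<omega>. \<phi> (line01 (?Y \<omega>)) \<partial>N)"
      by (subst integral_distr[OF Ym]) (simp_all add: Y)
    also have "\<dots> = (\<integral>y. \<phi> (line01 y) \<partial>distr N borel ?Y)"
      by (rule integral_distr[symmetric]) measurable
    also have "distr N borel ?Y = distr (std_gauss \<Otimes>\<^sub>M std_gauss) borel ?g"
      unfolding r2_def using \<rho> by (intro chi_squared_pair_law N X1 X2 indep) auto
    also have "(\<integral>y. \<phi> (line01 y) \<partial>distr (std_gauss \<Otimes>\<^sub>M std_gauss) borel ?g) =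
        (\<integral>p. \<phi> (line01 (?g p)) \<partial>(std_gauss \<Otimes>\<^sub>M std_gauss))"
      by (rule integral_distr) measurable
    finally have "(\<integral>x. \<phi> x \<partial>distr N borel_C01 (path01 (limit_process \<rho> X1 X2))) =
        (\<integral>p. \<phi> (line01 (?g p)) \<partial>(std_gauss \<Otimes>\<^sub>M std_gauss))" .
    moreover have "(\<integral>x. \<phi> x \<partial>distr M borel_C01 (path01 (Z i))) = expectation (\<lambda>\<omega>. \<phi> (path01 (Z i) \<omega>))" for i
      by (rule integral_distr[OF Zm]) measurable
    moreover have "((\<lambda>i. expectation (\<lambda>\<omega>. \<phi> (path01 (Z i) \<omega>))) \<longlongrightarrow>
        (\<integral>p. \<phi> (line01 (?g p)) \<partial>(std_gauss \<Otimes>\<^sub>M std_gauss))) F"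
      using rosenblatt_weak_limit[OF domain Z Zm g1 g2 _ ratio \<phi> bdd] \<rho>
      by (simp add: case_prod_unfold r2_def)
    ultimately show ?thesis by simp
  qed
  then show ?thesis
    unfolding conv_in_distribution_C01_def weak_conv_C01_def using Zm Ym by blast
qed

end
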